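(* Let $D$ be a domain in some $\mathbb C^n$, let $k$ be a holomorphic kernel on $D$ such that every nonzero multiplicative linear functional on $\mathcal H(k)$ is given by point evaluation at some point of $D$. Let $T$ be a bounded linear operator on $\mathcal H(k)$ and suppose that $h:=T(1)$ is nowhere zero on $D$. (i) Suppose $\mathbf 0\in D$, $k$ is a diagonal holomorphic kernel on $D$, and $k_w^2\in\mathcal H(k)$ for all $w\in D$. Then $T$ is a weighted composition operator if and only if $T(k_w^2)\,T(1)=(Tk_w)^2$ for all $w\in D$. (ii) Suppose $D=\Omega$ is a domain in $\mathbb C^d$ containing $\mathbf 0$, and $k=s_1\circ\cdots\circ s_p$ is a Schur product of normalized, irreducible, diagonal (holomorphic) complete Pick kernels $s_1,\ldots,s_p$ on $\Omega$. Then $T$ is a weighted composition operator if and only if $$T(k_w)\prod_{j=1}^pT\Big(\frac1{s_{j,w}}\Big)=(T(1))^{p+1}\qquad\text{for all } w\in\Omega.$$ (iii) Suppose $D=\Omega^p=\Omega\times\cdots\times\Omega$ where $\Omega$ is a domain in $\mathbb C^d$ containing $\mathbf 0$, and $k=s_1\otimes\cdots\otimes s_p$ is a tensor product of normalized, irreducible, diagonal (holomorphic) complete Pick kernels $s_1,\ldots,s_p$ on $\Omega$. Then $T$ is a weighted composition operator if and only if $$T(k_w)\prod_{j=1}^pT\Big(\frac1{s_{j,w_j}}\Big)=(T(1))^{p+1}\qquad\text{for all } w=(w_1,\ldots,w_p)\in\Omega^p,$$ where $1/s_{j,w_j}$ denotes the function $(z_1,\ldots,z_p)\mapsto 1/s_j(z_j,w_j)$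 on $\Omega^p$. All products of functions are pointwise.
   Context: A holomorphic kernel is a reproducing kernel holomorphic in the first variable and anti-holomorphic in the second; $\mathcal H(k)$ is its reproducing kernel Hilbert space, $k_w(z)=k(z,w)$, $k_w^2(z)=k(z,w)^2$, $s_{j,w}(z)=s_j(z,w)$. Weighted composition operator: a bounded operator $T$ on a space $\mathcal H(k)$ (containing the constants) of functions on $D$ for which there is a holomorphic map $\varphi:D\to D$ with $(Tf)(z)=h(z)f(\varphi(z))$ for all $f\in\mathcal H(k)$, $z\in D$, where $h=T(1)\in\mathcal H(k)$. A linear functional $\Lambda$ on $\mathcal H(k)$ is multiplicative if $\Lambda(fg)=\Lambda(f)\Lambda(g)$ whenever $f,g\in\mathcal H(k)$ are such that the pointwise product $fg$ is also in $\mathcal H(k)$. Diagonal holomorphic kernel on a domain containing $\mathbf 0$ (in $\mathbb C^d$): a holomorphic kernel $s$ such that there are (strictly) positive numbers $\{a_\alpha\}_{\alpha\in\mathbb Z_+^d}$ for which the power series expansion of $s$ at $\mathbf 0$ is $s(z,w)=\sum_{\alpha\in\mathbb Z_+^d}a_\alpha z^\alpha\overline w^{\,\alpha}$. It is normalized if $a_{\mathbf 0}=1$. Irreducible: $s(z,w)\ne0$ for all $z,w$, and $s_z,s_w$ are linearly independent whenever $z\ne w$. Complete Pick kernel on $\Omega$: for all $N,m\in\mathbb N$, all $z_1,\ldots,z_N\in\Omega$ and all contractive $m\times m$ matrices $W_1,\ldots,W_N$, positive semidefiniteness of $[(I-W_iW_j^* )s(z_i,z_j)]_{i,j=1}^N$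 implies the existence of a contractive multiplier $\Phi$ of $\mathcal H(s)\otimes\mathbb C^m$ with $\Phi(z_i)=W_i$ for all $i$. Schur product: $(s_1\circ\cdots\circ s_p)(z,w)=\prod_j s_j(z,w)$ on $\Omega$. Tensor product: $(s_1\otimes\cdots\otimes s_p)((z_1,\ldots,z_p),(w_1,\ldots,w_p))=\prod_j s_j(z_j,w_j)$ on $\Omega^p$. In cases (ii) and (iii) the functions $1/s_{j,w}$ are known to belong to the multiplier algebra of $\mathcal H(k)$, hence to $\mathcal H(k)$. *)

theory Defs
  imports "HOL-Analysis.Analysis" "HOL-Library.Nonpos_Ints"
begin

text \<open>
  A function on a set \<open>D\<close> is represented by its extension by \<open>0\<close> outside \<open>D\<close>, so that equality
  of representatives is equality on \<open>D\<close> and pointwise operations preserve representatives.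
  Kernels, in contrast, are arbitrary off \<open>D \<times> D\<close>: only their values on \<open>D \<times> D\<close> are used.
\<close>

definition zext :: "'a set \<Rightarrow> ('a \<Rightarrow> complex) \<Rightarrow> 'a \<Rightarrow> complex" where
  "zext D f = (\<lambda>z. if z \<in> D then f z else 0)"

abbreviation one_on :: "'a set \<Rightarrow> 'a \<Rightarrow> complex" where
  "one_on D \<equiv> zext D (\<lambda>_. 1)"

abbreviation kernel_fun :: "'a set \<Rightarrow> ('a \<Rightarrow> 'a \<Rightarrow> complex) \<Rightarrow> 'a \<Rightarrow> 'a \<Rightarrow> complex" where
  "kernel_fun D k w \<equiv> zext D (\<lambda>z. k z w)"


section \<open>Domains and holomorphy in several variables\<close>

definition domain_Cn :: "(complex ^ 'n) set \<Rightarrow> bool" where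
  "domain_Cn D \<longleftrightarrow> open D \<and> connected D \<and> D \<noteq> {}"

text \<open>Complex Frechet differentiability at every point; only used on open sets.\<close>

definition holomorphic_Cn :: "(complex ^ 'n) set \<Rightarrow> (complex ^ 'n \<Rightarrow> complex) \<Rightarrow> bool" where
  "holomorphic_Cn D f \<longleftrightarrow>
     (\<forall>z\<in>D. \<exists>f'. (f has_derivative f') (at z) \<and> (\<forall>c v. f' (c *s v) = c * f' v))"

definition holomorphic_self_map :: "(complex ^ 'n) set \<Rightarrow> (complex ^ 'n \<Rightarrow> complex ^ 'n) \<Rightarrow> bool" where
  "holomorphic_self_map D \<phi> \<longleftrightarrow>
     (\<forall>z\<in>D. \<phi> z \<in> D) \<and> (\<forall>i. holomorphic_Cn D (\<lambda>z. \<phi> z $ i))"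


section \<open>Reproducing kernel Hilbert spaces\<close>

definition psd_kernel :: "'a set \<Rightarrow> ('a \<Rightarrow> 'a \<Rightarrow> complex) \<Rightarrow> bool" where
  "psd_kernel D k \<longleftrightarrow>
     (\<forall>F c. finite F \<and> F \<subseteq> D \<longrightarrow>
        (\<Sum>x\<in>F. \<Sum>y\<in>F. cnj (c x) * c y * k x y) \<in> \<real>\<^sub>\<ge>\<^sub>0)"

definition hnorm :: "(('a \<Rightarrow> complex) \<Rightarrow> ('a \<Rightarrow> complex) \<Rightarrow> complex) \<Rightarrow> ('a \<Rightarrow> complex) \<Rightarrow> real" where
  "hnorm ip f = sqrt (Re (ip f f))"

text \<open>
  \<open>rkhs D k H ip\<close> says that \<open>H\<close>, with inner product \<open>ip\<close> (linear in the first argument), is the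
  Hilbert space of functions on \<open>D\<close> with reproducing kernel \<open>k\<close>. These axioms determine \<open>H\<close>, and
  \<open>ip\<close> on \<open>H\<close>, uniquely; a pair exists for every positive semidefinite \<open>k\<close>.
\<close>

locale rkhs =
  fixes D :: "'a set"
    and k :: "'a \<Rightarrow> 'a \<Rightarrow> complex"
    and H :: "('a \<Rightarrow> complex) set"
    and ip :: "('a \<Rightarrow> complex) \<Rightarrow> ('a \<Rightarrow> complex) \<Rightarrow> complex"
  assumes vanish_off: "f \<in> H \<Longrightarrow> z \<notin> D \<Longrightarrow> f z = 0"
    and zero_mem: "(\<lambda>_. 0) \<in> H"
    and add_mem: "f \<in> H \<Longrightarrow> g \<in> H \<Longrightarrow> (\<lambda>z. f z + g z) \<in> H"
    and scale_mem: "f \<in> H \<Longrightarrow> (\<lambda>z. c * f z) \<in> H"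
    and ip_add: "f \<in> H \<Longrightarrow> g \<in> H \<Longrightarrow> u \<in> H \<Longrightarrow> ip (\<lambda>z. f z + g z) u = ip f u + ip g u"
    and ip_scale: "f \<in> H \<Longrightarrow> u \<in> H \<Longrightarrow> ip (\<lambda>z. c * f z) u = c * ip f u"
    and ip_commute: "f \<in> H \<Longrightarrow> g \<in> H \<Longrightarrow> ip g f = cnj (ip f g)"
    and ip_nonneg: "f \<in> H \<Longrightarrow> ip f f \<in> \<real>\<^sub>\<ge>\<^sub>0"
    and ip_definite: "f \<in> H \<Longrightarrow> ip f f = 0 \<Longrightarrow> f = (\<lambda>_. 0)"
    and complete:
      "(\<And>n. F n \<in> H) \<Longrightarrow>
       (\<And>e. e > 0 \<Longrightarrow> \<exists>N. \<forall>m\<ge>N. \<forall>n\<ge>N. hnorm ip (\<lambda>z. F m z - F n z) < e) \<Longrightarrow>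
       \<exists>f\<in>H. (\<lambda>n. hnorm ip (\<lambda>z. F n z - f z)) \<longlonglongrightarrow> 0"
    and kernel_mem: "w \<in> D \<Longrightarrow> kernel_fun D k w \<in> H"
    and reproducing: "f \<in> H \<Longrightarrow> w \<in> D \<Longrightarrow> f w = ip f (kernel_fun D k w)"

definition bounded_operator ::
  "('a \<Rightarrow> complex) set \<Rightarrow> (('a \<Rightarrow> complex) \<Rightarrow> ('a \<Rightarrow> complex) \<Rightarrow> complex) \<Rightarrow>
   (('a \<Rightarrow> complex) \<Rightarrow> 'a \<Rightarrow> complex) \<Rightarrow> bool" where
  "bounded_operator H ip T \<longleftrightarrow>
     (\<forall>f\<in>H. T f \<in> H) \<and>
     (\<forall>f\<in>H. \<forall>g\<in>H. T (\<lambda>z. f z + g z) = (\<lambda>z. T f z + T g z)) \<and>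
     (\<forall>f\<in>H. \<forall>c. T (\<lambda>z. c * f z) = (\<lambda>z. c * T f z)) \<and>
     (\<exists>B. \<forall>f\<in>H. hnorm ip (T f) \<le> B * hnorm ip f)"

definition weighted_composition_operator ::
  "(complex ^ 'n) set \<Rightarrow> (complex ^ 'n \<Rightarrow> complex) set \<Rightarrow>
   ((complex ^ 'n \<Rightarrow> complex) \<Rightarrow> (complex ^ 'n \<Rightarrow> complex) \<Rightarrow> complex) \<Rightarrow>
   ((complex ^ 'n \<Rightarrow> complex) \<Rightarrow> complex ^ 'n \<Rightarrow> complex) \<Rightarrow> bool" where
  "weighted_composition_operator D H ip T \<longleftrightarrow>
     bounded_operator H ip T \<and> one_on D \<in> H \<and>
     (\<exists>\<phi>. holomorphic_self_map D \<phi> \<and>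
          (\<forall>f\<in>H. \<forall>z\<in>D. T f z = T (one_on D) z * f (\<phi> z)))"

text \<open>Linear functionals on \<open>H\<close>; continuity is not required.\<close>

definition multiplicative_functional ::
  "('a \<Rightarrow> complex) set \<Rightarrow> (('a \<Rightarrow> complex) \<Rightarrow> complex) \<Rightarrow> bool" where
  "multiplicative_functional H \<Lambda> \<longleftrightarrow>
     (\<forall>f\<in>H. \<forall>g\<in>H. \<Lambda> (\<lambda>z. f z + g z) = \<Lambda> f + \<Lambda> g) \<and>
     (\<forall>f\<in>H. \<forall>c. \<Lambda> (\<lambda>z. c * f z) = c * \<Lambda> f) \<and>
     (\<forall>f\<in>H. \<forall>g\<in>H. (\<lambda>z. f z * g z) \<in> H \<longrightarrow> \<Lambda> (\<lambda>z. f z * g z) = \<Lambda> f * \<Lambda> g)"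

definition multiplicative_functionals_are_evaluations ::
  "'a set \<Rightarrow> ('a \<Rightarrow> complex) set \<Rightarrow> bool" where
  "multiplicative_functionals_are_evaluations D H \<longleftrightarrow>
     (\<forall>\<Lambda>. multiplicative_functional H \<Lambda> \<and> (\<exists>f\<in>H. \<Lambda> f \<noteq> 0) \<longrightarrow>
        (\<exists>x\<in>D. \<forall>f\<in>H. \<Lambda> f = f x))"


section \<open>Classes of kernels\<close>

definition holomorphic_kernel ::
  "(complex ^ 'n) set \<Rightarrow> (complex ^ 'n \<Rightarrow> complex ^ 'n \<Rightarrow> complex) \<Rightarrow> bool" where
  "holomorphic_kernel D k \<longleftrightarrow>
     psd_kernel D k \<and>
     (\<forall>w\<in>D. holomorphic_Cn D (\<lambda>z. k z w)) \<and>
     (\<forall>z\<in>D. holomorphic_Cn D (\<lambda>w. cnj (k z w)))"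

definition multi_power :: "complex ^ 'n \<Rightarrow> ('n \<Rightarrow> nat) \<Rightarrow> complex" where
  "multi_power z \<alpha> = (\<Prod>i\<in>UNIV. (z $ i) ^ \<alpha> i)"

text \<open>
  The expansion is that of \<open>s\<close> as a function of \<open>(z, cnj w)\<close> near the origin; there it converges
  absolutely, so unordered summation is the right notion. The coefficients are unique.
\<close>

definition diagonal_expansion ::
  "(complex ^ 'n) set \<Rightarrow> (complex ^ 'n \<Rightarrow> complex ^ 'n \<Rightarrow> complex) \<Rightarrow> (('n \<Rightarrow> nat) \<Rightarrow> real) \<Rightarrow> bool" where
  "diagonal_expansion D s a \<longleftrightarrow>
     (\<forall>\<alpha>. a \<alpha> > 0) \<and>
     (\<exists>r>0. ball 0 r \<subseteq> D \<and>
        (\<forall>z\<in>ball 0 r. \<forall>w\<in>ball 0 r.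
           ((\<lambda>\<alpha>. complex_of_real (a \<alpha>) * multi_power z \<alpha> * cnj (multi_power w \<alpha>))
              has_sum s z w) UNIV))"

definition diagonal_holomorphic_kernel ::
  "(complex ^ 'n) set \<Rightarrow> (complex ^ 'n \<Rightarrow> complex ^ 'n \<Rightarrow> complex) \<Rightarrow> bool" where
  "diagonal_holomorphic_kernel D s \<longleftrightarrow>
     holomorphic_kernel D s \<and> (\<exists>a. diagonal_expansion D s a)"

definition normalized_diagonal_holomorphic_kernel ::
  "(complex ^ 'n) set \<Rightarrow> (complex ^ 'n \<Rightarrow> complex ^ 'n \<Rightarrow> complex) \<Rightarrow> bool" where
  "normalized_diagonal_holomorphic_kernel D s \<longleftrightarrow>
     holomorphic_kernel D s \<and> (\<exists>a. diagonal_expansion D s a \<and> a (\<lambda>_. 0) = 1)"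

definition irreducible_kernel :: "'a set \<Rightarrow> ('a \<Rightarrow> 'a \<Rightarrow> complex) \<Rightarrow> bool" where
  "irreducible_kernel D s \<longleftrightarrow>
     (\<forall>z\<in>D. \<forall>w\<in>D. s z w \<noteq> 0) \<and>
     (\<forall>z\<in>D. \<forall>w\<in>D. z \<noteq> w \<longrightarrow>
        (\<forall>c d. (\<forall>x\<in>D. c * s x z + d * s x w = 0) \<longrightarrow> c = 0 \<and> d = 0))"

text \<open>
  The size \<open>m\<close> of the matrices varies inside the complete Pick property, so \<open>m \<times> m\<close> matrices are
  functions on \<open>nat \<times> nat\<close> of which only the entries with indices below \<open>m\<close> matter, and the
  Hilbert space tensor product of \<open>H\<close> with \<open>\<complex>\<^sup>m\<close> is the space of \<open>m\<close>-tuples \<open>F 0, \<dots>, F (m - 1)\<close> in \<open>H\<close>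
  with squared norm the sum of the squared norms of the components.
\<close>

definition contractive_matrix :: "nat \<Rightarrow> (nat \<Rightarrow> nat \<Rightarrow> complex) \<Rightarrow> bool" where
  "contractive_matrix m W \<longleftrightarrow>
     (\<forall>v :: nat \<Rightarrow> complex.
        (\<Sum>a<m. (cmod (\<Sum>b<m. W a b * v b))\<^sup>2) \<le> (\<Sum>b<m. (cmod (v b))\<^sup>2))"

definition contractive_multiplier ::
  "'a set \<Rightarrow> ('a \<Rightarrow> complex) set \<Rightarrow> (('a \<Rightarrow> complex) \<Rightarrow> ('a \<Rightarrow> complex) \<Rightarrow> complex) \<Rightarrow> nat \<Rightarrow>
   ('a \<Rightarrow> nat \<Rightarrow> nat \<Rightarrow> complex) \<Rightarrow> bool" where
  "contractive_multiplier D H ip m \<Phi> \<longleftrightarrow>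
     (\<forall>F :: nat \<Rightarrow> 'a \<Rightarrow> complex. (\<forall>b<m. F b \<in> H) \<longrightarrow>
        (let G = (\<lambda>a. zext D (\<lambda>z. \<Sum>b<m. \<Phi> z a b * F b z)) in
           (\<forall>a<m. G a \<in> H) \<and>
           (\<Sum>a<m. (hnorm ip (G a))\<^sup>2) \<le> (\<Sum>b<m. (hnorm ip (F b))\<^sup>2)))"

text \<open>
  Positivity of the \<open>N \<times> N\<close> block matrix with blocks \<open>(I - W\<^sub>i W\<^sub>j\<^sup>*) s(z\<^sub>i, z\<^sub>j)\<close> is tested on block
  vectors \<open>v\<close> with components \<open>v i a\<close>, where \<open>i < N\<close> and \<open>a < m\<close>.
\<close>

definition pick_matrix_psd ::
  "('a \<Rightarrow> 'a \<Rightarrow> complex) \<Rightarrow> nat \<Rightarrow> nat \<Rightarrow> (nat \<Rightarrow> 'a) \<Rightarrow> (nat \<Rightarrow> nat \<Rightarrow> nat \<Rightarrow> complex) \<Rightarrow> bool" where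
  "pick_matrix_psd s N m x W \<longleftrightarrow>
     (\<forall>v :: nat \<Rightarrow> nat \<Rightarrow> complex.
        (\<Sum>i<N. \<Sum>j<N. \<Sum>a<m. \<Sum>b<m.
           cnj (v i a)
             * (((if a = b then 1 else 0) - (\<Sum>c<m. W i a c * cnj (W j b c))) * s (x i) (x j))
             * v j b) \<in> \<real>\<^sub>\<ge>\<^sub>0)"

definition complete_pick_kernel :: "'a set \<Rightarrow> ('a \<Rightarrow> 'a \<Rightarrow> complex) \<Rightarrow> bool" where
  "complete_pick_kernel D s \<longleftrightarrow>
     (\<exists>H ip. rkhs D s H ip \<and>
        (\<forall>N m x W.
           (\<forall>i<N. x i \<in> D) \<and> (\<forall>i<N. contractive_matrix m (W i)) \<and> pick_matrix_psd s N m x W \<longrightarrow>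
           (\<exists>\<Phi>. contractive_multiplier D H ip m \<Phi> \<and>
                (\<forall>i<N. \<forall>a<m. \<forall>b<m. \<Phi> (x i) a b = W i a b))))"


section \<open>Products of kernels\<close>

definition schur_product ::
  "('p :: finite \<Rightarrow> 'a \<Rightarrow> 'a \<Rightarrow> complex) \<Rightarrow> 'a \<Rightarrow> 'a \<Rightarrow> complex" where
  "schur_product s z w = (\<Prod>j\<in>UNIV. s j z w)"

text \<open>
  \<open>(\<complex>\<^sup>d)\<^sup>p\<close> is identified with \<open>\<complex>\<^sup>p\<^sup>d\<close>, the coordinates being indexed by pairs;
  \<open>block j z\<close> is the \<open>j\<close>-th entry \<open>z\<^sub>j \<in> \<complex>\<^sup>d\<close> of \<open>z = (z\<^sub>1, \<dots>, z\<^sub>p)\<close>.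
\<close>

definition block :: "'p :: finite \<Rightarrow> complex ^ ('p \<times> 'd :: finite) \<Rightarrow> complex ^ 'd" where
  "block j z = (\<chi> i. z $ (j, i))"

definition power_domain :: "(complex ^ 'd :: finite) set \<Rightarrow> (complex ^ ('p :: finite \<times> 'd)) set" where
  "power_domain \<Omega> = {z. \<forall>j. block j z \<in> \<Omega>}"

definition tensor_product ::
  "('p :: finite \<Rightarrow> complex ^ 'd \<Rightarrow> complex ^ 'd \<Rightarrow> complex) \<Rightarrow>
   complex ^ ('p \<times> 'd :: finite) \<Rightarrow> complex ^ ('p \<times> 'd) \<Rightarrow> complex" where
  "tensor_product s z w = (\<Prod>j\<in>UNIV. s j (block j z) (block j w))"

end

(*
Fix z and put L f = T f (z) / T 1 (z), a bounded functional with L 1 = 1. The operator T is a weighted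
composition operator as soon as every such L is multiplicative, for then L is the evaluation at a point
phi(z), and the coordinates of phi are quotients of functions in H(k).

By analytic continuation the expansion of a diagonal kernel near 0 persists as
k(z,w) = sum_alpha a_alpha z^alpha cnj(w)^alpha on all of D x D; so the monomials form an orthogonal basis of H(k),
L is determined by the numbers l_alpha = L(z^alpha), and multiplicativity amounts to
l_alpha = mu^alpha with mu_i = l_(e_i). The hypothesis on T is an identity between power series in cnj(w);
compared degree by degree it leaves a nonzero multiple of l_gamma - mu^gamma once lower degrees are settled.
In the case of complete Pick factors, 1 - 1/s_j has coefficients 0 <= b_j <= a_j by the McCullough--Quiggin
theorem, and the multiple is a_gamma - sum_j b_j,gamma > 0. The bound b_j <= a_j also puts 1/s_j,w into H(k).
*)

theory Submission
  imports Defs "HOL-Complex_Analysis.Conformal_Mappings"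
begin

section \<open>Reproducing kernel Hilbert spaces\<close>

text \<open>The domain \<open>D\<close> is arbitrary, so a power series at the origin need not
  converge on it. The Hilbert space forces convergence: the continuation in \<open>z\<close> only
  allows \<open>w\<close> in a ball depending on \<open>z\<close>. This suffices to find the
  monomials in \<open>H\<close>; Bessel's inequality for \<open>k_w\<close> then gives absolute
  convergence at every point, and only then is the continuation in \<open>w\<close> possible.

  Monomials are extracted by averages over N-th roots of unity, not by integrals over a torus: an
  average of kernel functions is a finite combination, hence in \<open>H\<close>. The same device
  proves uniqueness of coefficients and nonnegativity of those of a positive kernel.

  The sign of \<open>b_j\<close> must be read off from the series of \<open>1 - 1/s_j\<close>, which
  at first converges only near the origin, by a crude bound; the bound by \<open>a_j\<close> follows
  from the sign and gives convergence everywhere.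

  At \<gamma> = \<open>e_i\<close> the decisive factor vanishes, but there the claim is the
  definition of \<open>mu_i\<close>; positivity is claimed only strictly above some
  \<open>e_i\<close>. For tensor products each \<open>s_j\<close> is regarded as a function on the
  power domain whose coefficients vanish off its block, so (ii) and (iii) share one
  argument.\<close>

context rkhs
begin

lemma sum_mem:
  assumes "\<And>i. i \<in> I \<Longrightarrow> f i \<in> H"
  shows "(\<lambda>z. \<Sum>i\<in>I. c i * f i z) \<in> H"
  using assms
proof (induction I rule: infinite_finite_induct)
  case (insert x F)
  then show ?case
    using add_mem[OF scale_mem[of "f x" "c x"], of "\<lambda>z. \<Sum>i\<in>F. c i * f i z"] by simp
qed (simp_all add: zero_mem)

lemma diff_mem:
  assumes "f \<in> H" "g \<in> H"
  shows "(\<lambda>z. f z - g z) \<in> H"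
  using add_mem[OF assms(1) scale_mem[OF assms(2), of "-1"]] by simp

lemma ip_zero: "u \<in> H \<Longrightarrow> ip (\<lambda>_. 0) u = 0"
  using ip_scale[OF zero_mem, of u 0] by simp

lemma ip_sum:
  assumes "\<And>i. i \<in> I \<Longrightarrow> f i \<in> H" "u \<in> H"
  shows "ip (\<lambda>z. \<Sum>i\<in>I. c i * f i z) u = (\<Sum>i\<in>I. c i * ip (f i) u)"
  using assms(1)
proof (induction I rule: infinite_finite_induct)
  case (insert x F)
  then show ?case
    using ip_add[OF scale_mem[of "f x" "c x"] sum_mem[of F f c] assms(2)]
    by (simp add: ip_scale assms(2))
qed (simp_all add: ip_zero assms)

lemma ip_sum_right:
  assumes "\<And>i. i \<in> I \<Longrightarrow> f i \<in> H" "u \<in> H"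
  shows "ip u (\<lambda>z. \<Sum>i\<in>I. c i * f i z) = (\<Sum>i\<in>I. cnj (c i) * ip u (f i))"
  using assms by (simp add: ip_commute[of _ u] sum_mem ip_sum)

lemma ip_scale_right: "f \<in> H \<Longrightarrow> u \<in> H \<Longrightarrow> ip u (\<lambda>z. c * f z) = cnj c * ip u f"
  by (simp add: ip_commute[of _ u] scale_mem ip_scale)

lemma ip_diff:
  assumes "f \<in> H" "g \<in> H" "u \<in> H"
  shows "ip (\<lambda>z. f z - g z) u = ip f u - ip g u"
  using ip_add[OF assms(1) scale_mem[OF assms(2), of "-1"] assms(3)] ip_scale[OF assms(2,3), of "-1"]
  by simp

lemma ip_diff_right:
  assumes "f \<in> H" "g \<in> H" "u \<in> H"
  shows "ip u (\<lambda>z. f z - g z) = ip u f - ip u g"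
  using assms by (simp add: ip_commute[of _ u] diff_mem ip_diff)

lemma hnorm_nonneg: "f \<in> H \<Longrightarrow> 0 \<le> hnorm ip f"
  using ip_nonneg[of f] by (simp add: hnorm_def complex_nonneg_Reals_iff)

lemma ip_self: "f \<in> H \<Longrightarrow> ip f f = complex_of_real ((hnorm ip f)\<^sup>2)"
  using ip_nonneg[of f] by (simp add: hnorm_def complex_nonneg_Reals_iff complex_eq_iff)

lemma hnorm_eq_0: "f \<in> H \<Longrightarrow> hnorm ip f = 0 \<Longrightarrow> f = (\<lambda>_. 0)"
  using ip_self ip_definite by simp

lemma Cauchy_Schwarz:
  assumes "f \<in> H" "g \<in> H"
  shows "cmod (ip f g) \<le> hnorm ip f * hnorm ip g"
proof (cases "hnorm ip g = 0")
  case True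
  then have "ip f g = 0"
    using hnorm_eq_0[OF assms(2)] ip_commute[OF zero_mem assms(1)] ip_zero[OF assms(1)] by simp
  with True show ?thesis by simp
next
  case False
  define n where "n = hnorm ip g"
  define c where "c = ip f g / of_real (n\<^sup>2)"
  define h where "h = (\<lambda>z. f z - c * g z)"
  have n: "n \<noteq> 0" using False n_def by simp
  have h: "h \<in> H" unfolding h_def using assms by (intro diff_mem scale_mem)
  have gg: "ip g g = of_real (n\<^sup>2)" using ip_self[OF assms(2)] n_def by simp
  have "ip h h = ip f f - cnj c * ip f g - c * (cnj (ip f g) - cnj c * ip g g)"
    unfolding h_def using assms
    by (simp add: ip_diff ip_diff_right diff_mem scale_mem ip_scale ip_scale_right
        ip_commute[OF assms] algebra_simps)
  also have "\<dots> = ip f f - cnj c * ip f g"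
    using n by (simp add: gg c_def)
  also have "\<dots> = of_real ((hnorm ip f)\<^sup>2 - (cmod (ip f g))\<^sup>2 / n\<^sup>2)"
    unfolding c_def using ip_self[OF assms(1)]
    by (simp add: complex_mod_mult_cnj complex_norm_square[symmetric] mult.commute
        del: of_real_power)
  finally have "0 \<le> (hnorm ip f)\<^sup>2 - (cmod (ip f g))\<^sup>2 / n\<^sup>2"
    using ip_nonneg[OF h] by (simp add: complex_nonneg_Reals_iff)
  then have "(cmod (ip f g))\<^sup>2 \<le> (hnorm ip f * n)\<^sup>2"
    using n by (simp add: field_simps power_mult_distrib)
  then show ?thesis
    using power2_le_imp_le mult_nonneg_nonneg[OF hnorm_nonneg[OF assms(1)] hnorm_nonneg[OF assms(2)]]
    unfolding n_def by blast
qed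

text \<open>The filter is arbitrary because both sequences and nets of finite partial sums occur
  later.\<close>

lemma tendsto_ip:
  assumes "\<And>n. F n \<in> H" "f \<in> H" "g \<in> H"
    and "((\<lambda>n. hnorm ip (\<lambda>z. F n z - f z)) \<longlongrightarrow> 0) net"
  shows "((\<lambda>n. ip (F n) g) \<longlongrightarrow> ip f g) net"
proof -
  have "((\<lambda>n. hnorm ip (\<lambda>z. F n z - f z) * hnorm ip g) \<longlongrightarrow> 0) net"
    using tendsto_mult_left_zero[OF assms(4)] .
  then have "((\<lambda>n. ip (F n) g - ip f g) \<longlongrightarrow> 0) net"
    by (rule Lim_null_comparison[rotated])
      (use assms Cauchy_Schwarz[OF diff_mem[OF assms(1,2)] assms(3)] in
        \<open>auto simp: ip_diff intro!: always_eventually\<close>)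
  then show ?thesis using Lim_null by blast
qed

lemma tendsto_pointwise:
  assumes "\<And>n. F n \<in> H" "f \<in> H"
    and "((\<lambda>n. hnorm ip (\<lambda>z. F n z - f z)) \<longlongrightarrow> 0) net"
  shows "((\<lambda>n. F n w) \<longlongrightarrow> f w) net"
proof (cases "w \<in> D")
  case True
  then show ?thesis
    using tendsto_ip[OF assms(1,2) kernel_mem[OF True] assms(3)] reproducing assms(1,2) by simp
qed (simp add: vanish_off assms)

lemma ip_kernel: "z \<in> D \<Longrightarrow> w \<in> D \<Longrightarrow> ip (kernel_fun D k w) (kernel_fun D k z) = k z w"
  using reproducing[OF kernel_mem[of w], of z] by (simp add: zext_def)

lemma kernel_commute: "z \<in> D \<Longrightarrow> w \<in> D \<Longrightarrow> k w z = cnj (k z w)"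
  using ip_commute[OF kernel_mem[of w] kernel_mem[of z]] ip_kernel by metis

text \<open>The sum is the squared norm of the combination of the kernel functions at
  \<open>x i\<close> with coefficients \<open>v i\<close>.\<close>

lemma kernel_gram:
  assumes "\<And>i. i \<in> I \<Longrightarrow> x i \<in> D"
  shows "(\<Sum>i\<in>I. \<Sum>j\<in>I. cnj (v i) * k (x i) (x j) * v j) \<in> \<real>\<^sub>\<ge>\<^sub>0"
proof -
  define g where "g = (\<lambda>z. \<Sum>i\<in>I. v i * kernel_fun D k (x i) z)"
  have g: "g \<in> H" unfolding g_def by (intro sum_mem kernel_mem assms)
  have "ip g g = (\<Sum>j\<in>I. v j * (\<Sum>i\<in>I. cnj (v i) * ip (kernel_fun D k (x j)) (kernel_fun D k (x i))))"
    unfolding g_def using assms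
    by (subst ip_sum) (auto intro!: sum_mem kernel_mem sum.cong simp del: mult_cancel_left simp: ip_sum_right kernel_mem)
  also have "\<dots> = (\<Sum>j\<in>I. \<Sum>i\<in>I. cnj (v i) * k (x i) (x j) * v j)"
    using assms by (simp add: ip_kernel sum_distrib_left ac_simps)
  also have "\<dots> = (\<Sum>i\<in>I. \<Sum>j\<in>I. cnj (v i) * k (x i) (x j) * v j)"
    by (rule sum.swap)
  finally show ?thesis using ip_nonneg[OF g] by simp
qed

end

section \<open>Necessity in the McCullough--Quiggin theorem\<close>

lemma psd_kernel_subset: "psd_kernel D k \<Longrightarrow> X \<subseteq> D \<Longrightarrow> psd_kernel X k"
  unfolding psd_kernel_def by blast

lemma psd_kernel_diag:
  assumes "psd_kernel X G" "x \<in> X"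
  shows "G x x \<in> \<real>\<^sub>\<ge>\<^sub>0"
  using assms(1)[unfolded psd_kernel_def, rule_format, of "{x}" "\<lambda>_. 1"] assms(2) by simp

lemma psd_kernel_two:
  assumes "psd_kernel X G" "x \<in> X" "y \<in> X" "x \<noteq> y"
  shows "cnj a * a * G x x + cnj a * b * G x y + cnj b * a * G y x + cnj b * b * G y y \<in> \<real>\<^sub>\<ge>\<^sub>0"
  using assms(1)[unfolded psd_kernel_def, rule_format, of "{x,y}" "\<lambda>u. if u = x then a else b"] assms(2-)
  by (simp add: add_ac)

text \<open>Hermitian symmetry is not part of \<open>psd_kernel\<close>; it follows because the form
  is real at the coefficient vectors \<open>(1, 1)\<close> and \<open>(1, \<i>)\<close>.\<close>

lemma psd_kernel_commute:
  assumes "psd_kernel X G" "x \<in> X" "y \<in> X"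
  shows "G y x = cnj (G x y)"
proof (cases "x = y")
  case True
  then show ?thesis
    using psd_kernel_diag[OF assms(1,2)] by (simp add: complex_nonneg_Reals_iff complex_eq_iff)
next
  case False
  show ?thesis
    using psd_kernel_two[OF assms False, of 1 1] psd_kernel_two[OF assms False, of 1 \<i>]
      psd_kernel_diag[OF assms(1,2)] psd_kernel_diag[OF assms(1,3)]
    by (auto simp: complex_nonneg_Reals_iff complex_eq_iff)
qed

text \<open>With coefficients \<open>- t * G x y\<close> at \<open>x\<close> and 1 at
  \<open>y\<close> the form is \<open>G y y - 2 * t * q\<close>, where \<open>q\<close> is the
  squared modulus of \<open>G x y\<close>; for large \<open>t\<close> this is negative if
  \<open>q\<close> is positive.\<close>

lemma psd_kernel_zero_row:
  assumes "psd_kernel X G" "x \<in> X" "y \<in> X" "G x x = 0"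
  shows "G x y = 0"
proof (rule ccontr)
  assume ne: "G x y \<noteq> 0"
  then have xy: "x \<noteq> y" using assms by auto
  define q where "q = (cmod (G x y))\<^sup>2"
  have q: "q > 0" using ne by (simp add: q_def)
  have qq: "G x y * cnj (G x y) = of_real q" "cnj (G x y) * G x y = of_real q"
    unfolding q_def by (metis complex_norm_square of_real_power mult.commute)+
  have t: "0 \<le> Re (G y y) - 2 * t * q" for t :: real
  proof -
    have "cnj (- of_real t * G x y) * (1::complex) * G x y + cnj 1 * (- of_real t * G x y) * G y x
        = of_real (- 2 * t * q)"
      using psd_kernel_commute[OF assms(1-3)] qq
      by (simp add: mult.assoc)
    then show ?thesis
      using psd_kernel_two[OF assms(1-3) xy, of "- of_real t * G x y" 1] assms(4)
      by (simp add: complex_nonneg_Reals_iff complex_eq_iff)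
  qed
  show False using t[of "Re (G y y) / q"] t[of 0] t[of "(Re (G y y) + 1) / q"] q by simp
qed

text \<open>Completing the square: as a function of the coefficient at \<open>x\<close> the form is
  minimal at \<open>- p / G x x\<close>, and the minimum is the form of the Schur
  complement.\<close>

lemma psd_kernel_schur_complement:
  assumes "psd_kernel (insert x X) G" "x \<notin> X" "G x x \<noteq> 0"
  shows "psd_kernel X (\<lambda>u v. G u v - G u x * G x v / G x x)"
  unfolding psd_kernel_def
proof (intro allI impI)
  fix F and c :: "'a \<Rightarrow> complex"
  assume F: "finite F \<and> F \<subseteq> X"
  then have xF: "x \<notin> F" using assms(2) by auto
  define p where "p = (\<Sum>v\<in>F. c v * G x v)"
  define p' where "p' = (\<Sum>u\<in>F. cnj (c u) * G u x)"
  have p': "p' = cnj p"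
    unfolding p_def p'_def using F psd_kernel_commute[OF assms(1), of x] by (auto intro!: sum.cong)
  have gxx: "cnj (G x x) = G x x"
    using psd_kernel_commute[OF assms(1), of x x] by simp
  define e where "e = (\<lambda>u. if u = x then - p / G x x else c u)"
  have "(\<Sum>u\<in>insert x F. \<Sum>v\<in>insert x F. cnj (e u) * e v * G u v)
     = cnj (e x) * e x * G x x + (\<Sum>v\<in>F. cnj (e x) * e v * G x v) + (\<Sum>u\<in>F. cnj (e u) * e x * G u x)
       + (\<Sum>u\<in>F. \<Sum>v\<in>F. cnj (e u) * e v * G u v)"
    using F xF by (simp add: sum.distrib)
  also have "(\<Sum>v\<in>F. cnj (e x) * e v * G x v) = cnj (e x) * p"
    unfolding p_def sum_distrib_left using xF by (auto intro!: sum.cong simp: e_def)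
  also have "(\<Sum>u\<in>F. cnj (e u) * e x * G u x) = e x * p'"
    unfolding p'_def sum_distrib_left using xF by (auto intro!: sum.cong simp: e_def)
  also have "(\<Sum>u\<in>F. \<Sum>v\<in>F. cnj (e u) * e v * G u v) = (\<Sum>u\<in>F. \<Sum>v\<in>F. cnj (c u) * c v * G u v)"
    using xF by (intro sum.cong) (auto simp: e_def)
  also have "cnj (e x) * e x * G x x + cnj (e x) * p + e x * p' = - (p' * p / G x x)"
    using assms(3) by (simp add: e_def gxx p' field_simps)
  also have "p' * p / G x x = (\<Sum>u\<in>F. \<Sum>v\<in>F. cnj (c u) * c v * (G u x * G x v / G x x))"
    unfolding p_def p'_def sum_product sum_divide_distrib by (intro sum.cong) (auto simp: field_simps)
  finally have "(\<Sum>u\<in>insert x F. \<Sum>v\<in>insert x F. cnj (e u) * e v * G u v)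
     = (\<Sum>u\<in>F. \<Sum>v\<in>F. cnj (c u) * c v * (G u v - G u x * G x v / G x x))"
    by (simp add: sum_subtractf algebra_simps)
  then show "(\<Sum>u\<in>F. \<Sum>v\<in>F. cnj (c u) * c v * (G u v - G u x * G x v / G x x)) \<in> \<real>\<^sub>\<ge>\<^sub>0"
    using assms(1)[unfolded psd_kernel_def, rule_format, of "insert x F" e] F by auto
qed

text \<open>A Cholesky factorization, one point at a time. If \<open>G x x = 0\<close> the whole row
  of \<open>x\<close> vanishes and \<open>x\<close> gets the zero vector; otherwise the Schur
  complement is factored and one coordinate is added.\<close>

lemma psd_kernel_gram_vectors:
  assumes "finite X" "psd_kernel X G"
  shows "\<exists>m W. \<forall>x\<in>X. \<forall>y\<in>X. G x y = (\<Sum>c<(m::nat). W x c * cnj (W y c))"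
  using assms
proof (induction X arbitrary: G rule: finite_induct)
  case (insert x X)
  show ?case
  proof (cases "G x x = 0")
    case True
    obtain m W where W: "\<forall>u\<in>X. \<forall>v\<in>X. G u v = (\<Sum>c<(m::nat). W u c * cnj (W v c))"
      using insert.IH[OF psd_kernel_subset[OF insert.prems]] by blast
    have "G x u = 0" "G u x = 0" if "u \<in> insert x X" for u
      using psd_kernel_zero_row[OF insert.prems, of x u] psd_kernel_commute[OF insert.prems, of x u] that True
      by auto
    then have "\<forall>u\<in>insert x X. \<forall>v\<in>insert x X.
        G u v = (\<Sum>c<m. (if u = x then 0 else W u c) * cnj (if v = x then 0 else W v c))"
      using W insert.hyps(2) by (auto intro!: sum.cong)
    then show ?thesis by (intro exI)
  next
    case False
    define r where "r = sqrt (Re (G x x))"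
    have gxx: "G x x \<in> \<real>\<^sub>\<ge>\<^sub>0" using psd_kernel_diag[OF insert.prems] by simp
    then have rr: "of_real r * of_real r = G x x"
      unfolding r_def by (auto simp: complex_nonneg_Reals_iff complex_eq_iff)
    then have r: "complex_of_real r \<noteq> 0" using False by auto
    obtain m W where W: "\<forall>u\<in>X. \<forall>v\<in>X. G u v - G u x * G x v / G x x = (\<Sum>c<(m::nat). W u c * cnj (W v c))"
      using insert.IH[OF psd_kernel_schur_complement[OF insert.prems insert.hyps(2) False]] by blast
    \<comment> \<open>Coordinate \<open>m\<close> carries the rank-one part that the Schur
      complement splits off. It exhausts the row of \<open>x\<close>, so all other coordinates of
      \<open>x\<close> are 0.\<close>
    define V where "V = (\<lambda>u c. if c = m then G u x / of_real r else if u = x then 0 else W u c)"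
    have V: "(\<Sum>c<Suc m. V u c * cnj (V v c))
        = G u x * cnj (G v x) / G x x + (if u = x \<or> v = x then 0 else \<Sum>c<m. W u c * cnj (W v c))" for u v
      using rr r by (auto simp: V_def field_simps intro!: sum.neutral)
    have cm: "cnj (G v x) = G x v" if "v \<in> insert x X" for v
      using psd_kernel_commute[OF insert.prems, of v x] that by simp
    have "\<forall>u\<in>insert x X. \<forall>v\<in>insert x X. G u v = (\<Sum>c<Suc m. V u c * cnj (V v c))"
    proof (intro ballI)
      fix u v assume uv: "u \<in> insert x X" "v \<in> insert x X"
      show "G u v = (\<Sum>c<Suc m. V u c * cnj (V v c))"
        unfolding V cm[OF uv(2)]
        using uv W[rule_format, of u v] False by (auto simp: algebra_simps)
    qed
    then show ?thesis by (intro exI)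
  qed
qed simp


section \<open>Contractive multipliers and the Pick property\<close>

lemma sum_swap3:
  "(\<Sum>i\<in>I. \<Sum>j\<in>J. \<Sum>a\<in>A. f i j a) = (\<Sum>a\<in>A. \<Sum>i\<in>I. \<Sum>j\<in>J. f i j a)"
proof -
  have "(\<Sum>i\<in>I. \<Sum>j\<in>J. \<Sum>a\<in>A. f i j a) = (\<Sum>i\<in>I. \<Sum>a\<in>A. \<Sum>j\<in>J. f i j a)"
    by (intro sum.cong refl sum.swap)
  also have "\<dots> = (\<Sum>a\<in>A. \<Sum>i\<in>I. \<Sum>j\<in>J. f i j a)" by (rule sum.swap)
  finally show ?thesis .
qed

text \<open>The functions vanishing at \<open>y\<close> form a Hilbert space whose kernel is the
  Schur complement \<open>K\<close>, and multiplication by the first row of \<Phi> preserves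
  vanishing at \<open>y\<close>. The claim is positivity of the kernel attached to a contraction
  between such spaces.\<close>

lemma (in rkhs) multiplier_on_vanishing_subspace:
  assumes mult: "contractive_multiplier D H ip m \<Phi>" "0 < m" and y: "y \<in> D" "k y y \<noteq> 0"
    and x: "\<And>i. i \<in> I \<Longrightarrow> x i \<in> D"
  shows "(\<Sum>i\<in>I. \<Sum>j\<in>I. cnj (v i) * v j * ((1 - (\<Sum>c<m. \<Phi> (x i) 0 c * cnj (\<Phi> (x j) 0 c)))
           * (k (x i) (x j) - k (x i) y * k y (x j) / k y y))) \<in> \<real>\<^sub>\<ge>\<^sub>0"
proof -
  define K where "K = (\<lambda>z w. k z w - k z y * k y w / k y y)"
  define kv where "kv = (\<lambda>w z. kernel_fun D k w z - (k y w / k y y) * kernel_fun D k y z)"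
  have kv: "kv w y = 0" "\<And>z. z \<in> D \<Longrightarrow> kv w z = K z w" if "w \<in> D" for w
    unfolding kv_def K_def using that y by (auto simp: zext_def)
  have kvH: "kv w \<in> H" if "w \<in> D" for w
    unfolding kv_def using that y by (intro diff_mem kernel_mem scale_mem)
  have rep: "ip f (kv w) = f w" if "f \<in> H" "w \<in> D" "f y = 0" for f w
    unfolding kv_def
    using ip_diff_right[OF kernel_mem[OF that(2)] scale_mem[OF kernel_mem[OF y(1)], of "k y w / k y y"] that(1)]
      ip_scale_right[OF kernel_mem[OF y(1)] that(1), of "k y w / k y y"]
    by (simp only: reproducing[symmetric] that y(1) mult_zero_right diff_zero)
  define comb where "comb = (\<lambda>u z. \<Sum>i\<in>I. u i * kv (x i) z)"
  have comb: "comb u \<in> H" "comb u y = 0" for u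
    unfolding comb_def using kv kvH x by (auto intro!: sum_mem sum.neutral)
  have ip_comb: "ip f (comb u) = (\<Sum>i\<in>I. cnj (u i) * f (x i))" if "f \<in> H" "f y = 0" for f u
    unfolding comb_def using that kvH x rep by (subst ip_sum_right) (auto intro!: sum.cong)
  have ip_comb2: "ip (comb u) (comb u) = (\<Sum>i\<in>I. \<Sum>j\<in>I. cnj (u i) * u j * K (x i) (x j))" for u
    unfolding ip_comb[OF comb] by (auto simp: comb_def sum_distrib_left kv x intro!: sum.cong)
  define W where "W = (\<lambda>i c. \<Phi> (x i) 0 c)"
  \<comment> \<open>This tuple is the image of \<open>comb v\<close> under the adjoint of the first
    row of \<Phi>, written out on kernel functions. Applying the row to it again and pairing with
    \<open>comb v\<close> returns its own squared norm \<open>S\<close>.\<close>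
  define F where "F = (\<lambda>b. comb (\<lambda>j. v j * cnj (W j b)))"
  define G where "G = (\<lambda>a. zext D (\<lambda>z. \<Sum>b<m. \<Phi> z a b * F b z))"
  have F: "F b \<in> H" "F b y = 0" for b using comb by (simp_all add: F_def)
  have G: "\<forall>a<m. G a \<in> H" "(\<Sum>a<m. (hnorm ip (G a))\<^sup>2) \<le> (\<Sum>b<m. (hnorm ip (F b))\<^sup>2)"
    using mult(1) F(1) unfolding contractive_multiplier_def G_def by (auto simp: Let_def)
  define S where "S = (\<Sum>b<m. (hnorm ip (F b))\<^sup>2)"
  have S0: "0 \<le> S" by (simp add: S_def sum_nonneg)
  have FF: "of_real S = (\<Sum>b<m. ip (F b) (F b))"
    by (simp add: S_def ip_self F)
  have "ip (G 0) (comb v) = (\<Sum>i\<in>I. cnj (v i) * G 0 (x i))"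
    using G(1) mult(2) y F by (intro ip_comb) (auto simp: G_def zext_def)
  also have "\<dots> = (\<Sum>i\<in>I. \<Sum>b<m. cnj (v i) * W i b * F b (x i))"
    by (intro sum.cong) (auto simp: G_def zext_def x W_def sum_distrib_left mult.assoc)
  also have "\<dots> = (\<Sum>b<m. \<Sum>i\<in>I. cnj (v i) * W i b * F b (x i))" by (rule sum.swap)
  also have "\<dots> = (\<Sum>b<m. ip (F b) (F b))"
    by (subst (3) F_def) (simp add: ip_comb F)
  finally have "of_real S = ip (G 0) (comb v)" using FF by simp
  then have "S = cmod (ip (G 0) (comb v))"
    by (metis S0 norm_of_real abs_of_nonneg)
  also have "\<dots> \<le> hnorm ip (G 0) * hnorm ip (comb v)"
    using G(1) mult(2) comb by (intro Cauchy_Schwarz) auto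
  finally have 1: "S \<le> hnorm ip (G 0) * hnorm ip (comb v)" .
  have "(hnorm ip (G 0))\<^sup>2 \<le> (\<Sum>a<m. (hnorm ip (G a))\<^sup>2)"
    using mult(2) by (intro member_le_sum) auto
  then have "(hnorm ip (G 0))\<^sup>2 \<le> S" using G(2) S_def by simp
  then have "hnorm ip (G 0) \<le> sqrt S" by (rule real_le_rsqrt)
  \<comment> \<open>One factor \<open>sqrt S\<close> cancels, so the adjoint does not increase the
    norm of \<open>comb v\<close>.\<close>
  then have "S \<le> sqrt S * hnorm ip (comb v)"
    using 1 mult_right_mono hnorm_nonneg[OF comb(1)] by (meson order_trans)
  then have "sqrt S * sqrt S \<le> sqrt S * hnorm ip (comb v)" using S0 by simp
  then have "sqrt S \<le> hnorm ip (comb v)"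
    using hnorm_nonneg[OF comb(1), of v] S0
    by (cases "S = 0") (simp_all add: mult_le_cancel_left_pos del: real_sqrt_mult_self)
  then have "S \<le> (hnorm ip (comb v))\<^sup>2"
    by (simp add: S0 sqrt_le_D)
  then have "complex_of_real ((hnorm ip (comb v))\<^sup>2) - of_real S \<in> \<real>\<^sub>\<ge>\<^sub>0"
    by (simp add: complex_nonneg_Reals_iff del: of_real_power)
  also have "of_real ((hnorm ip (comb v))\<^sup>2) - of_real S
     = ip (comb v) (comb v) - (\<Sum>b<m. ip (F b) (F b))"
    using FF ip_self[OF comb(1)] by simp
  also have "(\<Sum>b<m. ip (F b) (F b))
     = (\<Sum>b<m. \<Sum>i\<in>I. \<Sum>j\<in>I. cnj (v i) * v j * (W i b * cnj (W j b)) * K (x i) (x j))"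
    unfolding F_def ip_comb2 by (simp add: ac_simps)
  also have "\<dots> = (\<Sum>i\<in>I. \<Sum>j\<in>I. \<Sum>b<m. cnj (v i) * v j * (W i b * cnj (W j b)) * K (x i) (x j))"
    by (rule sum_swap3[symmetric])
  also have "ip (comb v) (comb v) - \<dots> = (\<Sum>i\<in>I. \<Sum>j\<in>I. cnj (v i) * v j *
      ((1 - (\<Sum>c<m. W i c * cnj (W j c))) * K (x i) (x j)))"
    unfolding ip_comb2 sum_subtractf[symmetric]
    by (intro sum.cong) (simp_all add: sum_distrib_left sum_distrib_right algebra_simps)
  finally show ?thesis by (simp add: W_def K_def)
qed

lemma nonneg_Reals_sum_I:
  "(\<And>i. i \<in> I \<Longrightarrow> f i \<in> \<real>\<^sub>\<ge>\<^sub>0) \<Longrightarrow> sum f I \<in> (\<real>\<^sub>\<ge>\<^sub>0 :: complex set)"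
  by (induction I rule: infinite_finite_induct) auto

lemma sum_sum_cnj_mult: "(\<Sum>i\<in>I. \<Sum>j\<in>I. cnj (u i) * u j) \<in> \<real>\<^sub>\<ge>\<^sub>0"
proof -
  have "(\<Sum>i\<in>I. \<Sum>j\<in>I. cnj (u i) * u j) = cnj (sum u I) * sum u I"
    by (simp add: sum_product)
  also have "\<dots> = of_real ((cmod (sum u I))\<^sup>2)"
    by (metis complex_norm_square mult.commute of_real_power)
  finally show ?thesis by (simp add: complex_nonneg_Reals_iff del: of_real_power)
qed

text \<open>
  Induction on the finite set \<open>X\<close>, simultaneously for all base points. Given \<open>x \<in> X\<close>, the case of
  base point \<open>x\<close> is that of \<open>X - {x}\<close>, as the row of \<open>x\<close> vanishes. Its Gram vectors \<open>W\<close> make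
  \<open>(1 - W\<^sub>i W\<^sub>j\<^sup>*) s(z\<^sub>i, z\<^sub>j)\<close> of rank one, so they extend to a contractive multiplier; this
  multiplier acts on the functions vanishing at \<open>y\<close>, which is the claim for the base point \<open>y\<close>.
\<close>

lemma complete_pick_psd:
  assumes pick: "complete_pick_kernel D s" and nz: "\<And>z w. z \<in> D \<Longrightarrow> w \<in> D \<Longrightarrow> s z w \<noteq> 0"
    and "finite X" "X \<subseteq> D" "y \<in> D"
  shows "psd_kernel X (\<lambda>z w. 1 - s z y * s y w / (s y y * s z w))"
  using assms(3-5)
proof (induction X arbitrary: y rule: finite_induct)
  case empty
  then show ?case by (simp add: psd_kernel_def)
next
  case (insert x0 X')
  define X where "X = insert x0 X'"
  have X: "finite X" "X \<subseteq> D" "x0 \<in> D" using insert X_def by auto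
  obtain H ip where H: "rkhs D s H ip" and ext: "\<forall>N m x W.
           (\<forall>i<N. x i \<in> D) \<and> (\<forall>i<N. contractive_matrix m (W i)) \<and> pick_matrix_psd s N m x W \<longrightarrow>
           (\<exists>\<Phi>. contractive_multiplier D H ip m \<Phi> \<and>
                (\<forall>i<N. \<forall>a<m. \<forall>b<m. \<Phi> (x i) a b = W i a b))"
    using pick unfolding complete_pick_kernel_def by (elim exE conjE)
  interpret rkhs D s H ip by (rule H)
  define G where "G = (\<lambda>z w. 1 - s z x0 * s x0 w / (s x0 x0 * s z w))"
  have "psd_kernel X G"
    unfolding psd_kernel_def
  proof (intro allI impI)
    fix F and c :: "'a \<Rightarrow> complex" assume F: "finite F \<and> F \<subseteq> X"
    have 0: "G x0 z = 0" "G z x0 = 0" if "z \<in> F" for z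
      using that F X nz unfolding G_def by auto
    have "(\<Sum>z\<in>F. \<Sum>w\<in>F. cnj (c z) * c w * G z w) = (\<Sum>z\<in>F-{x0}. \<Sum>w\<in>F-{x0}. cnj (c z) * c w * G z w)"
      using F 0
      by (intro sum.mono_neutral_cong_right ballI) (auto intro!: sum.neutral sum.mono_neutral_right)
    also have "\<dots> \<in> \<real>\<^sub>\<ge>\<^sub>0"
      using insert.IH[OF _ X(3)] X F unfolding psd_kernel_def G_def X_def by auto
    finally show "(\<Sum>z\<in>F. \<Sum>w\<in>F. cnj (c z) * c w * G z w) \<in> \<real>\<^sub>\<ge>\<^sub>0" .
  qed
  from psd_kernel_gram_vectors[OF X(1) this] obtain m0 V
    where V: "\<And>z w. z \<in> X \<Longrightarrow> w \<in> X \<Longrightarrow> G z w = (\<Sum>c<(m0::nat). V z c * cnj (V w c))" by blast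
  \<comment> \<open>The additional index guarantees that row 0 exists even when
    \<open>m0 = 0\<close>.\<close>
  define m where "m = Suc m0"
  define r where "r = sqrt (Re (s x0 x0))"
  have sxx: "s x0 x0 \<in> \<real>\<^sub>\<ge>\<^sub>0"
    using ip_nonneg[OF kernel_mem[OF X(3)]] ip_kernel[OF X(3) X(3)] by simp
  then have rr: "of_real r * of_real r = s x0 x0"
    unfolding r_def by (auto simp: complex_nonneg_Reals_iff complex_eq_iff)
  then have r: "complex_of_real r \<noteq> 0" using nz[OF X(3) X(3)] by auto
  define u where "u = (\<lambda>z. s z x0 / of_real r)"
  have u: "(1 - G z w) * s z w = u z * cnj (u w)" if "z \<in> X" "w \<in> X" for z w
  proof -
    have "cnj (s w x0) = s x0 w" using kernel_commute[of w x0] that X by auto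
    moreover have "s z w \<noteq> 0" using that X nz by auto
    ultimately show ?thesis using rr r by (simp add: G_def u_def field_simps)
  qed
  have u0: "u z \<noteq> 0" if "z \<in> X" for z using that X nz r by (auto simp: u_def)
  obtain x where x: "bij_betw x {0..<card X} X" using ex_bij_betw_nat_finite[OF X(1)] by blast
  have xX: "x i \<in> X" if "i < card X" for i using that x by (auto simp: bij_betw_def)
  have xD: "x i \<in> D" if "i < card X" for i using xX[OF that] X by auto
  \<comment> \<open>The Pick data are square matrices, so the Gram vector of \<open>z\<close>
    becomes the first row of a matrix that is otherwise 0.\<close>
  define W where "W = (\<lambda>z (a::nat) c. if a = 0 \<and> c < m0 then V z c else 0)"
  have WW: "(\<Sum>c<m. W z a c * cnj (W w b c)) = (if a = 0 \<and> b = 0 then G z w else 0)"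
    if "z \<in> X" "w \<in> X" for z w and a b :: nat
    using V[OF that] by (auto simp: m_def W_def)
  have "contractive_matrix m (W (x i))" if "i < card X" for i
    unfolding contractive_matrix_def
  proof
    fix v :: "nat \<Rightarrow> complex"
    \<comment> \<open>Contractivity amounts to \<open>G (x i) (x i)\<close> being at most 1. This
      holds because \<open>(1 - G) * s\<close> is a squared modulus on the diagonal, while
      \<open>s\<close> is positive there.\<close>
    have "u (x i) * cnj (u (x i)) = of_real ((cmod (u (x i)))\<^sup>2)"
      by (metis complex_norm_square of_real_power)
    moreover have "s (x i) (x i) \<in> \<real>\<^sub>\<ge>\<^sub>0"
      using ip_nonneg[OF kernel_mem[OF xD[OF that]]] ip_kernel[OF xD[OF that] xD[OF that]] by simp
    moreover have "s (x i) (x i) \<noteq> 0" using xD[OF that] nz by auto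
    ultimately have "0 \<le> (1 - Re (G (x i) (x i))) * Re (s (x i) (x i))" "0 < Re (s (x i) (x i))"
      using u[OF xX[OF that] xX[OF that]]
      by (auto simp: complex_nonneg_Reals_iff complex_eq_iff)
    then have "0 \<le> Re (1 - G (x i) (x i))"
      by (simp add: zero_le_mult_iff)
    moreover have "G (x i) (x i) = of_real (\<Sum>c<m0. (cmod (V (x i) c))\<^sup>2)"
      using V[OF xX[OF that] xX[OF that]] by (simp only: complex_norm_square[symmetric] of_real_sum)
    ultimately have V1: "(\<Sum>c<m0. (cmod (V (x i) c))\<^sup>2) \<le> 1" by simp
    have "(\<Sum>a<m. (cmod (\<Sum>b<m. W (x i) a b * v b))\<^sup>2) = (cmod (\<Sum>b<m0. V (x i) b * v b))\<^sup>2"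
    proof -
      have "(\<Sum>a<m. (cmod (\<Sum>b<m. W (x i) a b * v b))\<^sup>2) = (\<Sum>a\<in>{0}. (cmod (\<Sum>b<m. W (x i) a b * v b))\<^sup>2)"
        by (intro sum.mono_neutral_right) (auto simp: m_def W_def)
      then show ?thesis by (simp add: m_def W_def)
    qed
    also have "\<dots> \<le> (\<Sum>b<m0. cmod (V (x i) b) * cmod (v b))\<^sup>2"
      by (intro power_mono order_trans[OF norm_sum]) (auto simp: norm_mult)
    also have "\<dots> \<le> (\<Sum>c<m0. (cmod (V (x i) c))\<^sup>2) * (\<Sum>b<m0. (cmod (v b))\<^sup>2)"
      by (rule Cauchy_Schwarz_ineq_sum)
    also have "\<dots> \<le> 1 * (\<Sum>b<m0. (cmod (v b))\<^sup>2)"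
      using V1 by (intro mult_right_mono sum_nonneg) auto
    also have "\<dots> \<le> (\<Sum>b<m. (cmod (v b))\<^sup>2)" by (simp add: m_def)
    finally show "(\<Sum>a<m. (cmod (\<Sum>b<m. W (x i) a b * v b))\<^sup>2) \<le> (\<Sum>b<m. (cmod (v b))\<^sup>2)" .
  qed
  moreover have "pick_matrix_psd s (card X) m x (\<lambda>i. W (x i))"
    unfolding pick_matrix_psd_def
  proof
    fix v :: "nat \<Rightarrow> nat \<Rightarrow> complex"
    let ?N = "card X"
    \<comment> \<open>The form splits over the rows \<open>a\<close>: row 0 yields the rank-one
      kernel of \<open>u\<close>, and every other row yields \<open>s\<close> itself.\<close>
    have "(\<Sum>i<?N. \<Sum>j<?N. \<Sum>a<m. \<Sum>b<m.
           cnj (v i a) * (((if a = b then 1 else 0) - (\<Sum>c<m. W (x i) a c * cnj (W (x j) b c))) * s (x i) (x j))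
             * v j b)
       = (\<Sum>i<?N. \<Sum>j<?N. \<Sum>a<m. cnj (v i a) * ((if a = 0 then 1 - G (x i) (x j) else 1) * s (x i) (x j)) * v j a)"
    proof (intro sum.cong refl)
      fix i j a assume "i \<in> {..<?N}" "j \<in> {..<?N}" "a \<in> {..<m}"
      then show "(\<Sum>b<m. cnj (v i a) * (((if a = b then 1 else 0)
            - (\<Sum>c<m. W (x i) a c * cnj (W (x j) b c))) * s (x i) (x j)) * v j b)
        = cnj (v i a) * ((if a = 0 then 1 - G (x i) (x j) else 1) * s (x i) (x j)) * v j a"
        by (subst sum.remove[of _ a]) (auto simp: WW xX intro!: sum.neutral)
    qed
    also have "\<dots> = (\<Sum>a<m. \<Sum>i<?N. \<Sum>j<?N. cnj (v i a) * ((if a = 0 then 1 - G (x i) (x j) else 1) * s (x i) (x j)) * v j a)"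
      by (rule sum_swap3)
    also have "\<dots> \<in> \<real>\<^sub>\<ge>\<^sub>0"
    proof (rule nonneg_Reals_sum_I)
      fix a assume "a \<in> {..<m}"
      show "(\<Sum>i<?N. \<Sum>j<?N. cnj (v i a) * ((if a = 0 then 1 - G (x i) (x j) else 1) * s (x i) (x j)) * v j a) \<in> \<real>\<^sub>\<ge>\<^sub>0"
      proof (cases "a = 0")
        case True
        have "(\<Sum>i<?N. \<Sum>j<?N. cnj (v i a) * ((if a = 0 then 1 - G (x i) (x j) else 1) * s (x i) (x j)) * v j a)
          = (\<Sum>i<?N. \<Sum>j<?N. cnj (v i 0 * cnj (u (x i))) * (v j 0 * cnj (u (x j))))"
          using True by (intro sum.cong) (auto simp: u xX)
        then show ?thesis using sum_sum_cnj_mult by metis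
      next
        case False
        then show ?thesis
          using kernel_gram[of "{..<?N}" x "\<lambda>i. v i a"] xD by simp
      qed
    qed
    finally show "(\<Sum>i<?N. \<Sum>j<?N. \<Sum>a<m. \<Sum>b<m.
           cnj (v i a) * (((if a = b then 1 else 0) - (\<Sum>c<m. W (x i) a c * cnj (W (x j) b c))) * s (x i) (x j))
             * v j b) \<in> \<real>\<^sub>\<ge>\<^sub>0" .
  qed
  ultimately obtain \<Phi> where \<Phi>: "contractive_multiplier D H ip m \<Phi>"
      "\<forall>i<card X. \<forall>a<m. \<forall>b<m. \<Phi> (x i) a b = W (x i) a b"
    using ext[rule_format, of "card X" x m "\<lambda>i. W (x i)"] xD by blast
  have \<Phi>X: "\<Phi> z 0 c = W z 0 c" if "z \<in> X" "c < m" for z c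
  proof -
    have "z \<in> x ` {0..<card X}" using x that(1) by (simp add: bij_betw_def)
    then obtain i where "i < card X" "z = x i" by auto
    then show ?thesis using \<Phi>(2) that(2) m_def by auto
  qed
  show ?case
    unfolding psd_kernel_def X_def[symmetric]
  proof (intro allI impI)
    fix F and c :: "'a \<Rightarrow> complex" assume F: "finite F \<and> F \<subseteq> X"
    \<comment> \<open>Since \<open>1 - G z w = u z * cnj (u w) / s z w\<close>, the positive kernel
      supplied by the multiplier is the claimed one times \<open>u z * cnj (u w)\<close>. As
      \<open>u\<close> has no zeros on \<open>X\<close>, this factor is absorbed into the
      coefficients.\<close>
    have "(\<Sum>z\<in>F. \<Sum>w\<in>F. cnj (c z) * c w * (1 - s z y * s y w / (s y y * s z w)))
      = (\<Sum>z\<in>F. \<Sum>w\<in>F. cnj (c z / cnj (u z)) * (c w / cnj (u w)) *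
          ((1 - (\<Sum>b<m. \<Phi> z 0 b * cnj (\<Phi> w 0 b))) * (s z w - s z y * s y w / s y y)))"
    proof (intro sum.cong refl)
      fix z w assume zw: "z \<in> F" "w \<in> F"
      then have X': "z \<in> X" "w \<in> X" using F by auto
      have "(\<Sum>b<m. \<Phi> z 0 b * cnj (\<Phi> w 0 b)) = G z w"
        using \<Phi>X WW[of z w 0 0] X' by simp
      moreover have nzw: "s z w \<noteq> 0" using nz X' X(2) by blast
      moreover have "s z w - s z y * s y w / s y y = s z w * (1 - s z y * s y w / (s y y * s z w))"
        using nzw by (simp add: right_diff_distrib)
      moreover have "1 - G z w = u z * cnj (u w) / s z w"
        using u[OF X'] nzw by (simp add: nonzero_eq_divide_eq)
      ultimately show "cnj (c z) * c w * (1 - s z y * s y w / (s y y * s z w))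
         = cnj (c z / cnj (u z)) * (c w / cnj (u w)) *
          ((1 - (\<Sum>b<m. \<Phi> z 0 b * cnj (\<Phi> w 0 b))) * (s z w - s z y * s y w / s y y))"
        using u0[OF X'(1)] u0[OF X'(2)] by simp
    qed
    also have "\<dots> \<in> \<real>\<^sub>\<ge>\<^sub>0"
      using multiplier_on_vanishing_subspace[OF \<Phi>(1), of y F "\<lambda>z. z" "\<lambda>z. c z / cnj (u z)"]
        insert.prems nz[of y y] F X(2) by (auto simp: m_def)
    finally show "(\<Sum>z\<in>F. \<Sum>w\<in>F. cnj (c z) * c w * (1 - s z y * s y w / (s y y * s z w))) \<in> \<real>\<^sub>\<ge>\<^sub>0" .
  qed
qed

section \<open>Power series in several variables\<close>

lemma multi_power_0: "multi_power z (\<lambda>_. 0) = 1"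
  by (simp add: multi_power_def)

lemma multi_power_add: "multi_power z (\<lambda>i. \<alpha> i + \<beta> i) = multi_power z \<alpha> * multi_power z \<beta>"
  by (simp add: multi_power_def power_add prod.distrib)

lemma multi_power_diff:
  fixes \<beta> \<gamma> :: "'n::finite \<Rightarrow> nat"
  assumes "\<beta> \<le> \<gamma>"
  shows "multi_power z \<beta> * multi_power z (\<gamma> - \<beta>) = multi_power z \<gamma>"
proof -
  have "(\<lambda>i. \<beta> i + (\<gamma> - \<beta>) i) = \<gamma>" using assms by (auto simp: le_fun_def)
  then show ?thesis using multi_power_add[of z \<beta> "\<gamma> - \<beta>"] by simp
qed

lemma norm_multi_power: "cmod (multi_power z \<alpha>) = (\<Prod>i\<in>UNIV. cmod (z $ i) ^ \<alpha> i)"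
  by (simp add: multi_power_def prod_norm[symmetric] norm_power)

lemma multi_power_mult: "multi_power (\<chi> i. u $ i * v $ i) \<alpha> = multi_power u \<alpha> * multi_power v \<alpha>"
  by (simp add: multi_power_def power_mult_distrib prod.distrib)

lemma multi_power_const: "multi_power (\<chi> i. c) \<alpha> = c ^ (\<Sum>i\<in>UNIV. \<alpha> i)"
  by (simp add: multi_power_def power_sum)

lemma norm_multi_power_mono:
  assumes "\<And>i. cmod (z $ i) \<le> cmod (w $ i)"
  shows "cmod (multi_power z \<alpha>) \<le> cmod (multi_power w \<alpha>)"
  unfolding norm_multi_power using assms by (intro prod_mono) (auto intro: power_mono)

lemma finite_le_multi_index: "finite {\<beta>. \<beta> \<le> (\<gamma> :: 'n::finite \<Rightarrow> nat)}"
proof -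
  have "{\<beta>. \<beta> \<le> \<gamma>} = PiE UNIV (\<lambda>i. {..\<gamma> i})"
    by (auto simp: le_fun_def PiE_def)
  then show ?thesis by (simp add: finite_PiE)
qed

text \<open>The values lie in a general semiring because both real and complex coefficients are
  convolved.\<close>

definition conv :: "(('n::finite \<Rightarrow> nat) \<Rightarrow> 'a::semiring_0) \<Rightarrow> (('n \<Rightarrow> nat) \<Rightarrow> 'a) \<Rightarrow> ('n \<Rightarrow> nat) \<Rightarrow> 'a" where
  "conv f g \<gamma> = (\<Sum>\<beta>\<in>{\<beta>. \<beta> \<le> \<gamma>}. f \<beta> * g (\<gamma> - \<beta>))"

lemma has_sum_imp_abs_summable:
  fixes f :: "'a \<Rightarrow> complex"
  shows "(f has_sum s) A \<Longrightarrow> (\<lambda>x. norm (f x)) summable_on A"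
  using has_sum_imp_summable summable_on_iff_abs_summable_on_complex[of f A] by auto

lemma has_sum_sum:
  fixes f :: "'a \<Rightarrow> 'b \<Rightarrow> complex"
  assumes "\<And>i. i \<in> I \<Longrightarrow> (f i has_sum s i) A"
  shows "((\<lambda>x. \<Sum>i\<in>I. f i x) has_sum (\<Sum>i\<in>I. s i)) A"
  using assms by (induction I rule: infinite_finite_induct) (auto intro: has_sum_add)

text \<open>Both series converge absolutely, so the double sum over pairs may be regrouped by the
  total index \<gamma>; each group is finite.\<close>

lemma has_sum_conv:
  fixes f g :: "('n::finite \<Rightarrow> nat) \<Rightarrow> complex"
  assumes "(f has_sum S) UNIV" "(g has_sum T) UNIV"
  shows "(conv f g has_sum (S * T)) UNIV"
proof -
  let ?P = "\<lambda>(\<alpha>,\<beta>). f \<alpha> * g \<beta>"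
  have nf: "(\<lambda>\<alpha>. norm (f \<alpha>)) summable_on UNIV" and ng: "(\<lambda>\<alpha>. norm (g \<alpha>)) summable_on UNIV"
    using assms by (auto intro: has_sum_imp_abs_summable)
  have "(\<lambda>p. norm (?P p)) summable_on (UNIV \<times> UNIV)"
  proof (rule summable_on_SigmaI)
    show "((\<lambda>\<beta>. norm (?P (\<alpha>, \<beta>))) has_sum (norm (f \<alpha>) * (\<Sum>\<^sub>\<infinity>\<beta>. norm (g \<beta>)))) UNIV" for \<alpha>
      using ng by (simp add: norm_mult has_sum_cmult_right)
    show "(\<lambda>\<alpha>. norm (f \<alpha>) * (\<Sum>\<^sub>\<infinity>\<beta>. norm (g \<beta>))) summable_on UNIV"
      using nf by (rule summable_on_cmult_left)
  qed auto
  then have sm: "?P summable_on (UNIV \<times> UNIV)" by (rule abs_summable_summable)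
  have "(?P has_sum (S * T)) (UNIV \<times> UNIV)"
    using assms by (intro has_sum_SigmaI[OF _ _ sm, where g = "\<lambda>\<alpha>. f \<alpha> * T"])
      (auto intro: has_sum_cmult_right has_sum_cmult_left)
  then have "((\<lambda>(\<gamma>,\<beta>). f \<beta> * g (\<gamma> - \<beta>)) has_sum (S * T)) (SIGMA \<gamma>:UNIV. {\<beta>. \<beta> \<le> \<gamma>})"
    by (rule has_sum_reindex_bij_witness[where i = "\<lambda>(\<alpha>,\<beta>). ((\<lambda>i. \<alpha> i + \<beta> i), \<alpha>)"
          and j = "\<lambda>(\<gamma>,\<beta>). (\<beta>, \<gamma> - \<beta>)", THEN iffD2, rotated -1])
      (auto simp: le_fun_def fun_eq_iff)
  then show ?thesis
    unfolding conv_def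
    by (rule has_sum_SigmaD) (auto intro!: has_sum_finiteI finite_le_multi_index)
qed

lemma conv_multi_power:
  "conv (\<lambda>\<alpha>. f \<alpha> * multi_power w \<alpha>) (\<lambda>\<alpha>. g \<alpha> * multi_power w \<alpha>) \<gamma> = conv f g \<gamma> * multi_power w \<gamma>"
  unfolding conv_def sum_distrib_right
proof (rule sum.cong[OF refl])
  fix \<beta> assume "\<beta> \<in> {\<beta>. \<beta> \<le> \<gamma>}"
  then have "multi_power w \<gamma> = multi_power w \<beta> * multi_power w (\<gamma> - \<beta>)"
    by (simp add: multi_power_diff)
  then show "f \<beta> * multi_power w \<beta> * (g (\<gamma> - \<beta>) * multi_power w (\<gamma> - \<beta>)) = f \<beta> * g (\<gamma> - \<beta>) * multi_power w \<gamma>"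
    by simp
qed

text \<open>A diagonal term is a single monomial in the coordinatewise product of \<open>z\<close>
  with the conjugate of \<open>w\<close>, which reduces the claim to
  \<open>conv_multi_power\<close>.\<close>

lemma conv_multi_power_mult:
  "conv (\<lambda>\<alpha>. f \<alpha> * multi_power z \<alpha> * cnj (multi_power w \<alpha>)) (\<lambda>\<alpha>. g \<alpha> * multi_power z \<alpha> * cnj (multi_power w \<alpha>)) \<gamma>
    = conv f g \<gamma> * multi_power z \<gamma> * cnj (multi_power w \<gamma>)"
proof -
  define u where "u = (\<chi> i. z $ i * cnj (w $ i))"
  have "multi_power z \<alpha> * cnj (multi_power w \<alpha>) = multi_power u \<alpha>" for \<alpha>
    by (simp add: multi_power_def u_def prod.distrib power_mult_distrib)
  then show ?thesis using conv_multi_power[of f u g \<gamma>] by (simp add: mult.assoc)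
qed

lemma has_sum_conv_power:
  assumes "((\<lambda>\<alpha>. f \<alpha> * multi_power w \<alpha>) has_sum S) UNIV" "((\<lambda>\<alpha>. g \<alpha> * multi_power w \<alpha>) has_sum T) UNIV"
  shows "((\<lambda>\<alpha>. conv f g \<alpha> * multi_power w \<alpha>) has_sum (S * T)) UNIV"
proof -
  have "conv (\<lambda>\<alpha>. f \<alpha> * multi_power w \<alpha>) (\<lambda>\<alpha>. g \<alpha> * multi_power w \<alpha>) = (\<lambda>\<alpha>. conv f g \<alpha> * multi_power w \<alpha>)"
    by (rule ext) (rule conv_multi_power)
  with has_sum_conv[OF assms] show ?thesis by simp
qed

lemma has_sum_conv_diag:
  assumes "((\<lambda>\<alpha>. f \<alpha> * multi_power z \<alpha> * cnj (multi_power w \<alpha>)) has_sum S) UNIV"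
    and "((\<lambda>\<alpha>. g \<alpha> * multi_power z \<alpha> * cnj (multi_power w \<alpha>)) has_sum T) UNIV"
  shows "((\<lambda>\<alpha>. conv f g \<alpha> * multi_power z \<alpha> * cnj (multi_power w \<alpha>)) has_sum (S * T)) UNIV"
proof -
  have "conv (\<lambda>\<alpha>. f \<alpha> * multi_power z \<alpha> * cnj (multi_power w \<alpha>)) (\<lambda>\<alpha>. g \<alpha> * multi_power z \<alpha> * cnj (multi_power w \<alpha>))
      = (\<lambda>\<alpha>. conv f g \<alpha> * multi_power z \<alpha> * cnj (multi_power w \<alpha>))"
    by (rule ext) (rule conv_multi_power_mult)
  with has_sum_conv[OF assms] show ?thesis by simp
qed

lemma has_sum_conv_cnj:
  assumes "((\<lambda>\<alpha>. f \<alpha> * cnj (multi_power w \<alpha>)) has_sum S) UNIV" "((\<lambda>\<alpha>. g \<alpha> * cnj (multi_power w \<alpha>)) has_sum T) UNIV"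
  shows "((\<lambda>\<alpha>. conv f g \<alpha> * cnj (multi_power w \<alpha>)) has_sum (S * T)) UNIV"
  using has_sum_conv_diag[of f "\<chi> i. 1" w S g T] assms by (simp add: multi_power_const)

subsection \<open>Averaging over roots of unity\<close>

definition root_of_unity :: "nat \<Rightarrow> complex" where
  "root_of_unity N = exp (2 * of_real pi * \<i> / of_nat N)"

lemma root_of_unity_power: "root_of_unity N ^ j = exp (2 * of_real pi * \<i> * of_nat j / of_nat N)"
  by (simp add: root_of_unity_def exp_of_nat_mult[symmetric] field_simps)

lemma norm_root_of_unity: "cmod (root_of_unity N) = 1"
  by (simp add: root_of_unity_def norm_exp_eq_Re Re_divide_of_nat)

text \<open>The ratio is an N-th root of unity, so the geometric sum is \<open>N\<close> or 0
  according to whether the ratio is 1.\<close>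

lemma sum_root_of_unity:
  assumes "N > 0"
  shows "(\<Sum>t<N. (cnj (root_of_unity N) ^ a * root_of_unity N ^ b) ^ t) = (if a mod N = b mod N then of_nat N else 0)"
proof -
  let ?w = "root_of_unity N"
  define q where "q = cnj ?w ^ a * ?w ^ b"
  have inv: "cnj ?w ^ a * ?w ^ a = 1"
    by (metis complex_norm_square mult.commute norm_root_of_unity of_real_1 power_mult_distrib power_one)
  have "q = 1 \<longleftrightarrow> ?w ^ a * q = ?w ^ a"
    using norm_root_of_unity[of N] by auto
  also have "?w ^ a * q = ?w ^ b" using inv by (simp add: q_def mult_ac)
  also have "?w ^ b = ?w ^ a \<longleftrightarrow> a mod N = b mod N"
    using assms complex_root_unity_eq[of N b a] by (auto simp: root_of_unity_power)
  finally have q1: "q = 1 \<longleftrightarrow> a mod N = b mod N" .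
  have "?w ^ N = 1" using assms by (simp add: root_of_unity_power)
  then have "q ^ N = 1"
    unfolding q_def power_mult_distrib
    by (metis complex_cnj_one complex_cnj_power mult.commute mult_1 power_mult power_one)
  then show ?thesis
    using q1 by (simp add: q_def[symmetric] sum_gp_strict)
qed

definition torus_index :: "nat \<Rightarrow> ('n::finite \<Rightarrow> nat) set" where
  "torus_index N = PiE UNIV (\<lambda>_. {..<N})"

definition torus_point :: "nat \<Rightarrow> ('n::finite \<Rightarrow> nat) \<Rightarrow> complex ^ 'n" where
  "torus_point N \<theta> = (\<chi> i. root_of_unity N ^ \<theta> i)"

definition torus_rotate :: "nat \<Rightarrow> ('n::finite \<Rightarrow> nat) \<Rightarrow> complex ^ 'n \<Rightarrow> complex ^ 'n" where
  "torus_rotate N \<theta> y = (\<chi> i. torus_point N \<theta> $ i * y $ i)"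

text \<open>A discrete Cauchy integral over the torus through \<open>y\<close>. It isolates the part
  of a power series whose exponents agree with \<alpha> modulo \<open>N\<close>, and it involves
  only finitely many values of \<open>f\<close>.\<close>

definition torus_average :: "nat \<Rightarrow> ('n \<Rightarrow> nat) \<Rightarrow> (complex ^ 'n::finite \<Rightarrow> complex) \<Rightarrow> complex ^ 'n \<Rightarrow> complex" where
  "torus_average N \<alpha> f y =
    (\<Sum>\<theta>\<in>torus_index N. (cnj (multi_power (torus_point N \<theta>) \<alpha>) / of_nat (N ^ CARD('n))) * f (torus_rotate N \<theta> y))"

definition index_cong :: "nat \<Rightarrow> ('n \<Rightarrow> nat) \<Rightarrow> ('n \<Rightarrow> nat) \<Rightarrow> bool" where
  "index_cong N \<alpha> \<beta> \<longleftrightarrow> (\<forall>i. \<alpha> i mod N = \<beta> i mod N)"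

lemma norm_torus_rotate [simp]: "norm (torus_rotate N \<theta> y) = norm y"
  by (simp add: norm_vec_def torus_rotate_def torus_point_def norm_mult norm_power norm_root_of_unity)

text \<open>Orthogonality of characters: the sum over the grid factors into one geometric sum per
  coordinate.\<close>

lemma torus_average_monomial:
  assumes "N > 0"
  shows "torus_average N \<alpha> (\<lambda>y. multi_power y \<beta>) y = (if index_cong N \<alpha> \<beta> then multi_power y \<beta> else 0)"
proof -
  let ?q = "\<lambda>i. cnj (root_of_unity N) ^ \<alpha> i * root_of_unity N ^ \<beta> i"
  have t: "cnj (multi_power (torus_point N \<theta>) \<alpha>) * multi_power (torus_point N \<theta>) \<beta> = (\<Prod>i\<in>UNIV. ?q i ^ \<theta> i)"
    for \<theta> :: "'a \<Rightarrow> nat"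
    by (simp add: multi_power_def torus_point_def prod.distrib[symmetric] power_mult_distrib
        power_mult[symmetric] mult.commute)
  have "torus_average N \<alpha> (\<lambda>y. multi_power y \<beta>) y
      = (\<Sum>\<theta>\<in>torus_index N. \<Prod>i\<in>UNIV. ?q i ^ \<theta> i) * multi_power y \<beta> / of_nat (N ^ CARD('a))"
    unfolding torus_average_def torus_rotate_def multi_power_mult t[symmetric]
    by (simp add: sum_distrib_left sum_divide_distrib mult_ac)
  also have "(\<Sum>\<theta>\<in>torus_index N. \<Prod>i\<in>UNIV. ?q i ^ \<theta> i) = (\<Prod>i\<in>UNIV. \<Sum>t<N. ?q i ^ t)"
    unfolding torus_index_def by (rule prod_sum_PiE[symmetric]) auto
  also have "\<dots> = (\<Prod>i\<in>UNIV. if \<alpha> i mod N = \<beta> i mod N then of_nat N else 0)"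
    using assms by (simp add: sum_root_of_unity)
  also have "\<dots> = (if index_cong N \<alpha> \<beta> then of_nat (N ^ CARD('a)) else 0)"
    by (auto simp: index_cong_def)
  finally show ?thesis using assms by simp
qed

lemma has_sum_torus_average:
  assumes "N > 0"
    and "\<And>\<theta>. \<theta> \<in> torus_index N \<Longrightarrow>
      ((\<lambda>\<beta>. c \<beta> * multi_power (torus_rotate N \<theta> y) \<beta>) has_sum f (torus_rotate N \<theta> y)) UNIV"
  shows "((\<lambda>\<beta>. if index_cong N \<alpha> \<beta> then c \<beta> * multi_power y \<beta> else 0) has_sum torus_average N \<alpha> f y) UNIV"
proof -
  have fin: "finite (torus_index N :: ('a \<Rightarrow> nat) set)"
    unfolding torus_index_def by (intro finite_PiE) auto
  have "((\<lambda>\<beta>. \<Sum>\<theta>\<in>torus_index N. (cnj (multi_power (torus_point N \<theta>) \<alpha>) / of_nat (N ^ CARD('a)))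
      * (c \<beta> * multi_power (torus_rotate N \<theta> y) \<beta>)) has_sum torus_average N \<alpha> f y) UNIV"
    unfolding torus_average_def
    using fin assms(2) by (intro has_sum_sum has_sum_cmult_right) auto
  also have "(\<lambda>\<beta>. \<Sum>\<theta>\<in>torus_index N. (cnj (multi_power (torus_point N \<theta>) \<alpha>) / of_nat (N ^ CARD('a)))
      * (c \<beta> * multi_power (torus_rotate N \<theta> y) \<beta>))
     = (\<lambda>\<beta>. c \<beta> * torus_average N \<alpha> (\<lambda>y. multi_power y \<beta>) y)"
    by (simp add: torus_average_def sum_distrib_left mult_ac)
  also have "\<dots> = (\<lambda>\<beta>. if index_cong N \<alpha> \<beta> then c \<beta> * multi_power y \<beta> else 0)"
    using assms(1) by (auto simp: torus_average_monomial)
  finally show ?thesis .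
qed

text \<open>The weight of the indices that sampling at N-th roots of unity confuses with \<alpha>;
  it bounds the error made when \<open>torus_average\<close> is used to extract the term of index
  \<alpha>.\<close>

definition aliasing :: "nat \<Rightarrow> ('n \<Rightarrow> nat) \<Rightarrow> (('n \<Rightarrow> nat) \<Rightarrow> real) \<Rightarrow> real" where
  "aliasing N \<alpha> c = (\<Sum>\<^sub>\<infinity>\<beta>\<in>UNIV - {\<alpha>}. if index_cong N \<alpha> \<beta> then c \<beta> else 0)"

lemma summable_aliasing:
  fixes c :: "('n \<Rightarrow> nat) \<Rightarrow> real"
  assumes "c summable_on UNIV" "\<And>\<beta>. 0 \<le> c \<beta>"
  shows "(\<lambda>\<beta>. if index_cong N \<alpha> \<beta> then c \<beta> else 0) summable_on A"
  by (rule summable_on_comparison_test[OF summable_on_subset[OF assms(1)]]) (use assms(2) in auto)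

text \<open>A finite set \<open>F\<close> carries all but \<open>e/2\<close> of the mass. Once
  \<open>N\<close> exceeds every entry of \<alpha> and of the members of \<open>F\<close>,
  congruence to \<alpha> modulo \<open>N\<close> means equality within \<open>F\<close>.\<close>

lemma aliasing_tendsto_0:
  fixes c :: "('n::finite \<Rightarrow> nat) \<Rightarrow> real"
  assumes "c summable_on UNIV" "\<And>\<beta>. 0 \<le> c \<beta>"
  shows "(\<lambda>N. aliasing N \<alpha> c) \<longlonglongrightarrow> 0"
proof (rule LIMSEQ_I)
  fix e :: real assume "e > 0"
  then obtain F where F: "finite F" "dist (sum c F) (infsum c UNIV) \<le> e/2"
    using infsum_finite_approximation[OF assms(1), of "e/2"] by auto
  have "infsum c UNIV - sum c F \<le> e/2"
    using F(2) unfolding dist_real_def by linarith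
  then have F': "infsum c (UNIV - F) \<le> e/2"
    using infsum_Diff[OF assms(1), of F] F(1) by simp
  define M where "M = Suc (Max ((\<lambda>(\<beta>,i). \<beta> i) ` (insert \<alpha> F \<times> UNIV)))"
  have M: "\<beta> i < M" if "\<beta> \<in> insert \<alpha> F" for \<beta> i
    unfolding M_def using that F(1)
    by (intro le_imp_less_Suc Max_ge) (auto intro!: image_eqI[of _ _ "(\<beta>, i)"])
  have "\<bar>aliasing N \<alpha> c\<bar> < e" if "N \<ge> M" for N
  proof -
    have nc: "\<not> index_cong N \<alpha> \<beta>" if "\<beta> \<in> F" "\<beta> \<noteq> \<alpha>" for \<beta>
    proof
      assume *: "index_cong N \<alpha> \<beta>"
      have "\<alpha> i = \<beta> i" for i
        using M[of \<alpha> i] M[of \<beta> i] that \<open>N \<ge> M\<close> *[unfolded index_cong_def, rule_format, of i] by simp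
      then show False using that by auto
    qed
    have "aliasing N \<alpha> c \<le> infsum c (UNIV - F)"
      unfolding aliasing_def
      by (rule infsum_mono_neutral)
        (use nc assms in \<open>auto intro: summable_aliasing summable_on_subset\<close>)
    moreover have "0 \<le> aliasing N \<alpha> c"
      unfolding aliasing_def using assms(2) by (intro infsum_nonneg) auto
    ultimately show ?thesis using F' \<open>e > 0\<close> by simp
  qed
  then show "\<exists>no. \<forall>n\<ge>no. norm (aliasing n \<alpha> c - 0) < e" by auto
qed

lemma aliasing_mono:
  fixes c d :: "('n::finite \<Rightarrow> nat) \<Rightarrow> real"
  assumes "d summable_on UNIV" "\<And>\<beta>. 0 \<le> c \<beta>" "\<And>\<beta>. c \<beta> \<le> d \<beta>"
  shows "aliasing N \<alpha> c \<le> aliasing N \<alpha> d"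
proof -
  have d: "0 \<le> d \<beta>" for \<beta> using assms(2,3) order_trans by blast
  have c: "c summable_on UNIV"
    by (rule summable_on_comparison_test[OF assms(1)]) (use assms in auto)
  show ?thesis
    unfolding aliasing_def
    by (rule infsum_mono) (use assms d c in \<open>auto intro: summable_aliasing\<close>)
qed

text \<open>The extra predicate \<open>P\<close> makes room for a second congruence, which arises
  when both arguments of an inner product are averaged.\<close>

lemma norm_diff_le_aliasing:
  fixes g :: "('n::finite \<Rightarrow> nat) \<Rightarrow> complex"
  assumes "(\<lambda>\<beta>. norm (g \<beta>)) summable_on UNIV"
    and "((\<lambda>\<beta>. if index_cong N \<alpha> \<beta> \<and> P \<beta> then g \<beta> else 0) has_sum s) UNIV" and "P \<alpha>"
  shows "norm (s - g \<alpha>) \<le> aliasing N \<alpha> (\<lambda>\<beta>. norm (g \<beta>))"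
proof -
  let ?h = "\<lambda>\<beta>. if index_cong N \<alpha> \<beta> \<and> P \<beta> then g \<beta> else 0"
  have "(?h has_sum (s - sum ?h {\<alpha>})) (UNIV - {\<alpha>})"
    by (intro has_sum_Diff assms has_sum_finiteI) auto
  moreover have "sum ?h {\<alpha>} = g \<alpha>" using assms(3) by (simp add: index_cong_def)
  ultimately have h: "(?h has_sum (s - g \<alpha>)) (UNIV - {\<alpha>})" by simp
  have sm: "(\<lambda>\<beta>. norm (?h \<beta>)) summable_on (UNIV - {\<alpha>})"
    by (rule summable_on_comparison_test[OF summable_on_subset[OF assms(1)]]) auto
  have "norm (s - g \<alpha>) \<le> (\<Sum>\<^sub>\<infinity>\<beta>\<in>UNIV - {\<alpha>}. norm (?h \<beta>))"
    using norm_infsum_bound[OF sm] infsumI[OF h] by simp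
  also have "\<dots> \<le> aliasing N \<alpha> (\<lambda>\<beta>. norm (g \<beta>))"
    unfolding aliasing_def
    by (rule infsum_mono[OF sm]) (use assms(1) in \<open>auto intro: summable_aliasing\<close>)
  finally show ?thesis .
qed

text \<open>Points \<open>(t, ..., t)\<close> with \<open>t > 0\<close> are convenient because no
  monomial vanishes at them and the value of a monomial depends on its degree only. The radius comes
  from bounding the norm by \<open>CARD('n) * t\<close>.\<close>

lemma exists_positive_point_in_ball:
  fixes r :: real
  assumes "r > 0"
  obtains \<rho> where "\<rho> > 0" "\<And>t. 0 \<le> t \<Longrightarrow> t \<le> \<rho> \<Longrightarrow> (\<chi> i. complex_of_real t :: complex ^ 'n::finite) \<in> ball 0 r"
proof
  define \<rho> where "\<rho> = r / (CARD('n) + 1)"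
  show "\<rho> > 0" using assms by (simp add: \<rho>_def)
  fix t assume t: "0 \<le> t" "t \<le> \<rho>"
  have "norm (\<chi> i. complex_of_real t :: complex ^ 'n) \<le> (\<Sum>i\<in>(UNIV::'n set). norm (complex_of_real t))"
    unfolding norm_vec_def by (rule order_trans[OF L2_set_le_sum]) auto
  also have "\<dots> = CARD('n) * t" using t by simp
  also have "\<dots> \<le> CARD('n) * \<rho>" using t by (intro mult_left_mono) auto
  also have "\<dots> < r" using assms by (simp add: \<rho>_def field_simps)
  finally show "(\<chi> i. complex_of_real t :: complex ^ 'n) \<in> ball 0 r" by simp
qed

text \<open>Averaging the zero function gives 0, so each term is bounded by its aliasing error,
  which tends to 0; the monomial can be divided out at a point without zero coordinates.\<close>

lemma power_series_zero:
  fixes c :: "('n::finite \<Rightarrow> nat) \<Rightarrow> complex"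
  assumes "r > 0" and z: "\<And>x. x \<in> ball 0 r \<Longrightarrow> ((\<lambda>\<beta>. c \<beta> * multi_power x \<beta>) has_sum 0) UNIV"
  shows "c \<alpha> = 0"
proof -
  obtain \<rho> where \<rho>: "\<rho> > 0" "\<And>t. 0 \<le> t \<Longrightarrow> t \<le> \<rho> \<Longrightarrow> (\<chi> i. complex_of_real t :: complex ^ 'n) \<in> ball 0 r"
    using exists_positive_point_in_ball[OF assms(1)] by blast
  define x :: "complex ^ 'n" where "x = (\<chi> i. of_real \<rho>)"
  have x: "x \<in> ball 0 r" using \<rho> by (simp add: x_def)
  let ?g = "\<lambda>\<beta>. c \<beta> * multi_power x \<beta>"
  have sm: "(\<lambda>\<beta>. norm (?g \<beta>)) summable_on UNIV"
    using z[OF x] by (rule has_sum_imp_abs_summable)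
  have "norm (?g \<alpha>) \<le> aliasing N \<alpha> (\<lambda>\<beta>. norm (?g \<beta>))" if "N > 0" for N
  proof -
    have "((\<lambda>\<beta>. if index_cong N \<alpha> \<beta> then ?g \<beta> else 0) has_sum torus_average N \<alpha> (\<lambda>_. 0) x) UNIV"
      using that z x by (intro has_sum_torus_average) auto
    from norm_diff_le_aliasing[OF sm, of N \<alpha> "\<lambda>_. True" 0] this show ?thesis
      by (simp add: torus_average_def)
  qed
  then have "norm (?g \<alpha>) \<le> 0"
    by (intro tendsto_lowerbound[OF aliasing_tendsto_0[OF sm, of \<alpha>]])
      (auto intro!: eventually_sequentiallyI[of 1])
  then show ?thesis using \<rho>(1) by (simp add: x_def multi_power_const)
qed

lemma power_series_unique:
  fixes c d :: "('n::finite \<Rightarrow> nat) \<Rightarrow> complex"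
  assumes "r > 0" and "\<And>x. x \<in> ball 0 r \<Longrightarrow> ((\<lambda>\<beta>. c \<beta> * multi_power x \<beta>) has_sum f x) UNIV"
    and "\<And>x. x \<in> ball 0 r \<Longrightarrow> ((\<lambda>\<beta>. d \<beta> * multi_power x \<beta>) has_sum f x) UNIV"
  shows "c = d"
proof
  fix \<alpha>
  have "((\<lambda>\<beta>. (c \<beta> - d \<beta>) * multi_power x \<beta>) has_sum 0) UNIV" if "x \<in> ball 0 r" for x
    using has_sum_add[OF assms(2)[OF that] has_sum_uminusI[OF assms(3)[OF that]]]
    by (simp add: algebra_simps)
  from power_series_zero[OF assms(1) this] show "c \<alpha> = d \<alpha>" by simp
qed

lemma power_series_unique_cnj:
  fixes c d :: "('n::finite \<Rightarrow> nat) \<Rightarrow> complex"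
  assumes "r > 0" and "\<And>x. x \<in> ball 0 r \<Longrightarrow> ((\<lambda>\<beta>. c \<beta> * cnj (multi_power x \<beta>)) has_sum f x) UNIV"
    and "\<And>x. x \<in> ball 0 r \<Longrightarrow> ((\<lambda>\<beta>. d \<beta> * cnj (multi_power x \<beta>)) has_sum f x) UNIV"
  shows "c = d"
proof -
  have "(\<lambda>\<beta>. cnj (c \<beta>)) = (\<lambda>\<beta>. cnj (d \<beta>))"
    using assms(1)
  proof (rule power_series_unique)
    fix x :: "complex ^ 'n" assume x: "x \<in> ball 0 r"
    show "((\<lambda>\<beta>. cnj (c \<beta>) * multi_power x \<beta>) has_sum cnj (f x)) UNIV"
      using assms(2)[OF x] by (subst has_sum_cnj_iff[symmetric]) simp
    show "((\<lambda>\<beta>. cnj (d \<beta>) * multi_power x \<beta>) has_sum cnj (f x)) UNIV"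
      using assms(3)[OF x] by (subst has_sum_cnj_iff[symmetric]) simp
  qed
  then show ?thesis by (simp add: fun_eq_iff)
qed

section \<open>Holomorphic functions of several variables\<close>

lemma norm_vector_smult: "norm (c *s v) = norm c * norm (v :: complex ^ 'n::finite)"
  by (simp add: norm_vec_def norm_mult L2_set_right_distrib)

lemma bounded_linear_smult: "bounded_linear (\<lambda>h. h *s (v :: complex ^ 'n::finite))"
  by (intro linear_conv_bounded_linear[THEN iffD1] linearI)
    (simp_all add: vec_eq_iff algebra_simps)

lemma has_field_derivative_line:
  fixes f :: "complex ^ 'n::finite \<Rightarrow> complex"
  assumes "(f has_derivative f') (at (z + \<zeta> *s v))" "\<And>c v. f' (c *s v) = c * f' v"
  shows "((\<lambda>\<zeta>. f (z + \<zeta> *s v)) has_field_derivative f' v) (at \<zeta>)"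
proof -
  have "((\<lambda>\<zeta>. z + \<zeta> *s v) has_derivative (\<lambda>h. h *s v)) (at \<zeta>)"
    using bounded_linear.has_derivative[OF bounded_linear_smult has_derivative_ident]
    by (auto intro!: derivative_eq_intros)
  from diff_chain_at[OF this assms(1)]
  have "((\<lambda>\<zeta>. f (z + \<zeta> *s v)) has_derivative (\<lambda>h. f' (h *s v))) (at \<zeta>)"
    by (simp add: o_def)
  then show ?thesis
    by (simp add: has_field_derivative_def assms(2) mult.commute[of _ "f' v"])
qed

lemma holomorphic_on_line:
  assumes "holomorphic_Cn D f" "\<And>\<zeta>. \<zeta> \<in> A \<Longrightarrow> z + \<zeta> *s v \<in> D"
  shows "(\<lambda>\<zeta>. f (z + \<zeta> *s v)) holomorphic_on A"
  unfolding holomorphic_on_def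
proof
  fix \<zeta> assume "\<zeta> \<in> A"
  then obtain f' where "(f has_derivative f') (at (z + \<zeta> *s v))" "\<forall>c v. f' (c *s v) = c * f' v"
    using assms unfolding holomorphic_Cn_def by blast
  then show "(\<lambda>\<zeta>. f (z + \<zeta> *s v)) field_differentiable at \<zeta> within A"
    using has_field_derivative_line field_differentiable_at_within field_differentiable_def by blast
qed

lemma holomorphic_Cn_subset: "holomorphic_Cn D f \<Longrightarrow> E \<subseteq> D \<Longrightarrow> holomorphic_Cn E f"
  unfolding holomorphic_Cn_def by blast

text \<open>One-variable continuation along the complex line through \<open>w\<close> and
  \<open>y\<close>. Its intersection with the ball is convex, hence connected.\<close>

lemma holomorphic_Cn_identity_ball:
  assumes f: "holomorphic_Cn (ball c r) f" and g: "holomorphic_Cn (ball c r) g"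
    and w: "w \<in> ball c r" "e > 0" "\<And>x. x \<in> ball w e \<Longrightarrow> x \<in> ball c r \<Longrightarrow> f x = g x"
    and y: "y \<in> ball c r"
  shows "f y = g y"
proof -
  define v where "v = y - w"
  define S where "S = {\<zeta>. w + \<zeta> *s v \<in> ball c r}"
  define T where "T = {\<zeta>. w + \<zeta> *s v \<in> ball w e} \<inter> S"
  have lin: "linear (\<lambda>h. h *s v)" using bounded_linear_smult bounded_linear.linear by blast
  have eq: "{\<zeta>. w + \<zeta> *s v \<in> ball x q} = (\<lambda>h. h *s v) -` ball (x - w) q" for x q
    by (auto simp: dist_norm algebra_simps)
  have op: "open ((\<lambda>h. h *s v) -` ball x q)" for x q
    by (intro open_vimage open_ball linear_continuous_on bounded_linear_smult)
  have "f (w + 1 *s v) = g (w + 1 *s v)"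
  proof (rule analytic_continuation_open[where s = T and s' = S and z = 1
        and f = "\<lambda>\<zeta>. f (w + \<zeta> *s v)" and g = "\<lambda>\<zeta>. g (w + \<zeta> *s v)"])
    show "open S" "open T" unfolding T_def S_def eq by (intro op open_Int)+
    show "connected S" unfolding S_def eq
      by (intro convex_connected convex_linear_vimage lin convex_ball)
    have "0 \<in> T" using w by (simp add: T_def S_def)
    then show "T \<noteq> {}" by blast
    show "T \<subseteq> S" by (simp add: T_def)
    show "(\<lambda>\<zeta>. f (w + \<zeta> *s v)) holomorphic_on S" "(\<lambda>\<zeta>. g (w + \<zeta> *s v)) holomorphic_on S"
      by (auto intro!: holomorphic_on_line[OF f] holomorphic_on_line[OF g] simp: S_def)
    show "f (w + \<zeta> *s v) = g (w + \<zeta> *s v)" if "\<zeta> \<in> T" for \<zeta>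
      using that w by (auto simp: T_def S_def)
    show "1 \<in> S" using y by (simp add: S_def v_def)
  qed
  then show ?thesis by (simp add: v_def)
qed

text \<open>Agreement near a point passes between any two points of a ball inside \<open>D\<close>,
  hence along the connected set \<open>D\<close>.\<close>

lemma holomorphic_Cn_identity:
  assumes D: "open D" "connected D" and f: "holomorphic_Cn D f" and g: "holomorphic_Cn D g"
    and w: "w \<in> D" "e > 0" "\<And>x. x \<in> ball w e \<Longrightarrow> x \<in> D \<Longrightarrow> f x = g x"
    and y: "y \<in> D"
  shows "f y = g y"
proof -
  define P where "P = (\<lambda>x. \<exists>e>0. \<forall>y\<in>ball x e. y \<in> D \<longrightarrow> f y = g y)"
  have "P y"
  proof (rule connected_induction_simple[OF D(2) w(1) y])
    show "P w" using w by (auto simp: P_def)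
    fix a assume "a \<in> D"
    then obtain r where r: "r > 0" "ball a r \<subseteq> D" using D(1) openE by blast
    have step: "P x \<longrightarrow> P z" if xz: "x \<in> ball a r" "z \<in> ball a r" for x z
    proof
      assume "P x"
      then obtain e where e: "e > 0" "\<forall>y\<in>ball x e. y \<in> D \<longrightarrow> f y = g y" by (auto simp: P_def)
      have "f u = g u" if "u \<in> ball a r" for u
        using holomorphic_Cn_identity_ball[OF holomorphic_Cn_subset[OF f r(2)]
            holomorphic_Cn_subset[OF g r(2)] xz(1) e(1) _ that] e(2) r(2) by blast
      moreover obtain d where "d > 0" "ball z d \<subseteq> ball a r" using xz(2) openE[OF open_ball] by blast
      ultimately show "P z" unfolding P_def by blast
    qed
    show "\<exists>T. openin (top_of_set D) T \<and> a \<in> T \<and> (\<forall>x\<in>T. \<forall>y\<in>T. P x \<longrightarrow> P y)"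
      by (intro exI[of _ "ball a r"] conjI ballI step open_subset open_ball r(2)) (simp_all add: r(1))
  qed
  then show ?thesis using y unfolding P_def by auto
qed

lemma holomorphic_Cn_mult:
  assumes "holomorphic_Cn D f" "holomorphic_Cn D g"
  shows "holomorphic_Cn D (\<lambda>z. f z * g z)"
  unfolding holomorphic_Cn_def
proof
  fix z assume "z \<in> D"
  then obtain f' g' where fg: "(f has_derivative f') (at z)" "\<forall>c v. f' (c *s v) = c * f' v"
      "(g has_derivative g') (at z)" "\<forall>c v. g' (c *s v) = c * g' v"
    using assms unfolding holomorphic_Cn_def by meson
  show "\<exists>f'. ((\<lambda>z. f z * g z) has_derivative f') (at z) \<and> (\<forall>c v. f' (c *s v) = c * f' v)"
    by (rule exI, rule conjI[OF has_derivative_mult[OF fg(1,3)]])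
      (use fg(2,4) in \<open>auto simp: algebra_simps\<close>)
qed

lemma holomorphic_Cn_divide:
  assumes "holomorphic_Cn D f" "holomorphic_Cn D g" "\<And>z. z \<in> D \<Longrightarrow> g z \<noteq> 0"
  shows "holomorphic_Cn D (\<lambda>z. f z / g z)"
  unfolding holomorphic_Cn_def
proof
  fix z assume z: "z \<in> D"
  then obtain f' g' where fg: "(f has_derivative f') (at z)" "\<forall>c v. f' (c *s v) = c * f' v"
      "(g has_derivative g') (at z)" "\<forall>c v. g' (c *s v) = c * g' v"
    using assms unfolding holomorphic_Cn_def by meson
  show "\<exists>f'. ((\<lambda>z. f z / g z) has_derivative f') (at z) \<and> (\<forall>c v. f' (c *s v) = c * f' v)"
    by (rule exI, rule conjI[OF has_derivative_divide[OF fg(1,3) assms(3)[OF z]]])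
      (use fg(2,4) in \<open>auto simp: algebra_simps\<close>)
qed

lemma holomorphic_Cn_const: "holomorphic_Cn D (\<lambda>_. c)"
  unfolding holomorphic_Cn_def by (intro ballI exI[of _ "\<lambda>_. 0"]) auto

lemma holomorphic_Cn_nth: "holomorphic_Cn D (\<lambda>z. z $ i)"
  unfolding holomorphic_Cn_def
  by (intro ballI exI[of _ "\<lambda>z. z $ i"] conjI)
    (auto intro: bounded_linear.has_derivative[OF bounded_linear_vec_nth has_derivative_ident])

lemma holomorphic_Cn_add:
  assumes "holomorphic_Cn D f" "holomorphic_Cn D g"
  shows "holomorphic_Cn D (\<lambda>z. f z + g z)"
  unfolding holomorphic_Cn_def
proof
  fix z assume "z \<in> D"
  then obtain f' g' where fg: "(f has_derivative f') (at z)" "\<forall>c v. f' (c *s v) = c * f' v"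
      "(g has_derivative g') (at z)" "\<forall>c v. g' (c *s v) = c * g' v"
    using assms unfolding holomorphic_Cn_def by meson
  show "\<exists>f'. ((\<lambda>z. f z + g z) has_derivative f') (at z) \<and> (\<forall>c v. f' (c *s v) = c * f' v)"
    by (rule exI, rule conjI[OF has_derivative_add[OF fg(1,3)]])
      (use fg(2,4) in \<open>auto simp: algebra_simps\<close>)
qed

lemma holomorphic_Cn_sum:
  "(\<And>i. i \<in> I \<Longrightarrow> holomorphic_Cn D (f i)) \<Longrightarrow> holomorphic_Cn D (\<lambda>z. \<Sum>i\<in>I. f i z)"
  by (induction I rule: infinite_finite_induct) (auto intro: holomorphic_Cn_const holomorphic_Cn_add)

lemma holomorphic_Cn_multi_power: "holomorphic_Cn D (\<lambda>z. multi_power z \<alpha>)"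
proof -
  have pw: "holomorphic_Cn D (\<lambda>z. (z $ i) ^ n)" for i n
    by (induction n) (auto intro: holomorphic_Cn_const holomorphic_Cn_mult holomorphic_Cn_nth)
  have "holomorphic_Cn D (\<lambda>z. \<Prod>i\<in>A. (z $ i) ^ \<alpha> i)" for A
    by (induction A rule: infinite_finite_induct)
      (auto intro: holomorphic_Cn_const holomorphic_Cn_mult pw)
  then show ?thesis unfolding multi_power_def .
qed

lemma holomorphic_Cn_cong:
  assumes "open D" "holomorphic_Cn D f" "\<And>z. z \<in> D \<Longrightarrow> f z = g z"
  shows "holomorphic_Cn D g"
  unfolding holomorphic_Cn_def
proof
  fix z assume z: "z \<in> D"
  then obtain f' where f': "(f has_derivative f') (at z)" "\<forall>c v. f' (c *s v) = c * f' v"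
    using assms unfolding holomorphic_Cn_def by meson
  then show "\<exists>f'. (g has_derivative f') (at z) \<and> (\<forall>c v. f' (c *s v) = c * f' v)"
    using has_derivative_transform_within_open[OF f'(1) assms(1) z assms(3)] by blast
qed

text \<open>Cauchy's inequality on a disc in direction \<open>v\<close>. From a point of the half
  ball a displacement by \<open>r / 4\<close> stays inside the ball of radius \<open>r\<close>,
  whence the constant 4.\<close>

lemma derivative_Cauchy_estimate:
  fixes h :: "complex ^ 'n::finite \<Rightarrow> complex"
  assumes hol: "holomorphic_Cn (ball z r) h" and "r > 0" and x: "x \<in> ball z (r/2)"
    and h': "(h has_derivative h') (at x)" "\<And>c v. h' (c *s v) = c * h' v"
    and bd: "\<And>y. y \<in> ball z r \<Longrightarrow> cmod (h y) \<le> \<epsilon>"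
  shows "cmod (h' v) \<le> 4 * \<epsilon> / r * norm v"
proof (cases "v = 0")
  case True
  then show ?thesis using h'(2)[of 0 v] by simp
next
  case False
  define R where "R = r / 4 / norm v"
  have R: "R > 0" using False assms(2) by (simp add: R_def)
  have inb: "x + \<zeta> *s v \<in> ball z r" if "\<zeta> \<in> cball 0 R" for \<zeta>
  proof -
    have "norm (\<zeta> *s v) \<le> r / 4"
      using that False by (simp add: norm_vector_smult R_def field_simps)
    moreover have "dist z (x + \<zeta> *s v) \<le> dist z x + norm (\<zeta> *s v)"
      using dist_triangle[of z "x + \<zeta> *s v" x] by (simp add: dist_norm)
    ultimately show ?thesis using x assms(2) by simp
  qed
  have hl: "(\<lambda>\<zeta>. h (x + \<zeta> *s v)) holomorphic_on cball 0 R"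
    using holomorphic_on_line[OF hol] inb by blast
  have "cmod ((deriv ^^ 1) (\<lambda>\<zeta>. h (x + \<zeta> *s v)) 0) \<le> fact 1 * \<epsilon> / R ^ 1"
    using R inb bd
    by (intro Cauchy_inequality holomorphic_on_subset[OF hl] holomorphic_on_imp_continuous_on[OF hl]) auto
  moreover have "deriv (\<lambda>\<zeta>. h (x + \<zeta> *s v)) 0 = h' v"
    by (intro DERIV_imp_deriv has_field_derivative_line) (use h' in auto)
  ultimately show ?thesis using False assms(2) by (simp add: R_def field_simps)
qed

text \<open>Weierstrass' theorem: by the Cauchy estimate the derivatives form a uniform Cauchy
  sequence on a half ball, so the limit may be differentiated termwise, and complex homogeneity
  survives the limit.\<close>

lemma holomorphic_Cn_uniform_limit:
  fixes F :: "nat \<Rightarrow> complex ^ 'n::finite \<Rightarrow> complex"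
  assumes hol: "\<And>n. holomorphic_Cn D (F n)"
    and lim: "\<And>z. z \<in> D \<Longrightarrow> \<exists>r>0. ball z r \<subseteq> D \<and> uniform_limit (ball z r) F f sequentially"
  shows "holomorphic_Cn D f"
  unfolding holomorphic_Cn_def
proof
  fix z assume "z \<in> D"
  then obtain r where r: "r > 0" "ball z r \<subseteq> D" "uniform_limit (ball z r) F f sequentially"
    using lim by blast
  define S where "S = ball z (r/2)"
  have S: "S \<subseteq> ball z r" "open S" "convex S" "z \<in> S" using r by (auto simp: S_def)
  have "\<forall>n. \<forall>x\<in>D. \<exists>f'. (F n has_derivative f') (at x) \<and> (\<forall>c v. f' (c *s v) = c * f' v)"
    using hol unfolding holomorphic_Cn_def by blast
  then obtain F' where F': "\<And>n x. x \<in> D \<Longrightarrow> (F n has_derivative F' n x) (at x)"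
      "\<And>n x c v. x \<in> D \<Longrightarrow> F' n x (c *s v) = c * F' n x v" by metis
  have est: "\<exists>N. \<forall>n\<ge>N. \<forall>m\<ge>N. \<forall>x\<in>S. \<forall>v. cmod (F' n x v - F' m x v) \<le> e * norm v" if "e > 0" for e
  proof -
    define \<epsilon> where "\<epsilon> = e * r / 4"
    have "\<epsilon> > 0" using that r by (simp add: \<epsilon>_def)
    then obtain N where N0: "\<And>n y. n \<ge> N \<Longrightarrow> y \<in> ball z r \<Longrightarrow> dist (F n y) (f y) < \<epsilon> / 2"
      using uniform_limitD[OF r(3), of "\<epsilon> / 2"] \<open>\<epsilon> > 0\<close>
      unfolding eventually_sequentially by (meson half_gt_zero)
    have N: "dist (F n y) (F m y) < \<epsilon>" if "n \<ge> N" "m \<ge> N" "y \<in> ball z r" for n m y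
      using N0[of n y] N0[of m y] that dist_triangle_half_l[of "F n y" "f y" \<epsilon> "F m y"]
      by (simp add: dist_commute)
    have "cmod (F' n x v - F' m x v) \<le> e * norm v" if "n \<ge> N" "m \<ge> N" "x \<in> S" for n m x v
    proof -
      have xD: "x \<in> D" using that S r by blast
      have "cmod (F' n x v - F' m x v) \<le> 4 * \<epsilon> / r * norm v"
      proof (rule derivative_Cauchy_estimate[where h = "\<lambda>y. F n y - F m y"])
        show "holomorphic_Cn (ball z r) (\<lambda>y. F n y - F m y)"
          using holomorphic_Cn_add[OF hol holomorphic_Cn_mult[OF holomorphic_Cn_const[of _ "-1"] hol], of n m]
            holomorphic_Cn_subset r(2) by (simp add: algebra_simps) blast
        show "((\<lambda>y. F n y - F m y) has_derivative (\<lambda>v. F' n x v - F' m x v)) (at x)"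
          using F'(1)[OF xD] by (intro has_derivative_diff)
        show "cmod (F n y - F m y) \<le> \<epsilon>" if "y \<in> ball z r" for y
          using N[OF \<open>n \<ge> N\<close> \<open>m \<ge> N\<close> that] by (simp add: dist_norm)
      qed (use r that F'(2)[OF xD] in \<open>auto simp: S_def algebra_simps\<close>)
      then show ?thesis using r by (simp add: \<epsilon>_def)
    qed
    then show ?thesis by blast
  qed
  define g' where "g' = (\<lambda>x v. lim (\<lambda>n. F' n x v))"
  have g': "(\<lambda>n. F' n x v) \<longlonglongrightarrow> g' x v" if "x \<in> S" for x v
  proof -
    have "Cauchy (\<lambda>n. F' n x v)"
    proof (rule CauchyI)
      fix e :: real assume "e > 0"
      then have pos: "0 < e / (norm v + 1)" and lt: "e / (norm v + 1) * norm v < e"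
        using add_nonneg_pos[OF norm_ge_zero[of v] zero_less_one] by (simp_all add: pos_divide_less_eq)
      obtain N where "\<forall>n\<ge>N. \<forall>m\<ge>N. \<forall>x\<in>S. \<forall>v'. cmod (F' n x v' - F' m x v') \<le> e / (norm v + 1) * norm v'"
        using est[OF pos] by blast
      then show "\<exists>M. \<forall>m\<ge>M. \<forall>n\<ge>M. norm (F' m x v - F' n x v) < e"
        using that lt by (meson le_less_trans)
    qed
    then show ?thesis unfolding g'_def by (simp add: Cauchy_convergent_iff convergent_LIMSEQ_iff)
  qed
  have "\<exists>g. \<forall>x\<in>S. (\<lambda>n. F n x) \<longlonglongrightarrow> g x \<and> (g has_derivative g' x) (at x within S)"
  proof (rule has_derivative_sequence[OF S(3) _ _ S(4)])
    show "(F n has_derivative F' n x) (at x within S)" if "x \<in> S" for n x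
      using F'(1) that S r has_derivative_at_withinI by blast
    show "(\<lambda>n. F n z) \<longlonglongrightarrow> f z" using tendsto_uniform_limitI[OF r(3)] r by simp
    fix e :: real assume "e > 0"
    then obtain N where N: "\<forall>n\<ge>N. \<forall>m\<ge>N. \<forall>x\<in>S. \<forall>v. cmod (F' n x v - F' m x v) \<le> e * norm v"
      using est by blast
    have "cmod (F' n x v - g' x v) \<le> e * norm v" if "n \<ge> N" "x \<in> S" for n x v
      using that N
      by (intro tendsto_upperbound[OF tendsto_norm[OF tendsto_diff[OF tendsto_const g'[OF that(2)]]]])
        (auto intro!: eventually_sequentiallyI[of N])
    then show "\<forall>\<^sub>F n in sequentially. \<forall>x\<in>S. \<forall>h. cmod (F' n x h - g' x h) \<le> e * norm h"
      by (auto intro!: eventually_sequentiallyI[of N])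
  qed
  then obtain g where g: "\<And>x. x \<in> S \<Longrightarrow> (\<lambda>n. F n x) \<longlonglongrightarrow> g x"
      "\<And>x. x \<in> S \<Longrightarrow> (g has_derivative g' x) (at x within S)" by blast
  have gf: "g x = f x" if "x \<in> S" for x
    using LIMSEQ_unique[OF g(1)[OF that] tendsto_uniform_limitI[OF r(3) subsetD[OF S(1) that]]] .
  have "(g has_derivative g' z) (at z)"
    using g(2)[OF S(4)] unfolding at_within_open[OF S(4,2)] .
  then have "(f has_derivative g' z) (at z)"
    by (rule has_derivative_transform_within_open[OF _ S(2,4) gf])
  moreover have "g' z (c *s v) = c * g' z v" for c v
    using tendsto_mult_left[OF g'[OF S(4), of v], of c]
    by (intro LIMSEQ_unique[OF g'[OF S(4), of "c *s v"]]) (simp add: F'(2)[OF \<open>z \<in> D\<close>])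
  ultimately show "\<exists>f'. (f has_derivative f') (at z) \<and> (\<forall>c v. f' (c *s v) = c * f' v)" by blast
qed

section \<open>Sequential partial sums and holomorphy of convergent power series\<close>

definition index_box :: "nat \<Rightarrow> ('n::finite \<Rightarrow> nat) set" where
  "index_box n = {\<alpha>. \<forall>i. \<alpha> i \<le> n}"

lemma finite_index_box: "finite (index_box n)"
  using finite_le_multi_index[of "\<lambda>_. n"] by (simp add: index_box_def le_fun_def)

lemma index_box_mono: "m \<le> n \<Longrightarrow> index_box m \<subseteq> index_box n"
  by (auto simp: index_box_def intro: order_trans)

lemma finite_subset_index_box:
  assumes "finite F"
  shows "\<exists>n. F \<subseteq> index_box n"
proof -
  have "\<alpha> i \<le> Max ((\<lambda>(\<alpha>,i). \<alpha> i) ` (F \<times> UNIV))" if "\<alpha> \<in> F" for \<alpha> i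
    using that assms by (intro Max_ge) (auto intro!: image_eqI[of _ _ "(\<alpha>, i)"])
  then show ?thesis by (auto simp: index_box_def)
qed

text \<open>The boxes are cofinal among finite index sets. This turns unordered sums into limits of
  sequences, the form in which completeness of \<open>H\<close> and uniform limits are
  available.\<close>

lemma filterlim_index_box: "filterlim index_box (finite_subsets_at_top UNIV) sequentially"
  unfolding filterlim_finite_subsets_at_top
proof (intro allI impI)
  fix X :: "('a \<Rightarrow> nat) set" assume "finite X \<and> X \<subseteq> UNIV"
  then obtain n where "X \<subseteq> index_box n" using finite_subset_index_box by blast
  then show "\<forall>\<^sub>F y in sequentially. finite (index_box y) \<and> X \<subseteq> index_box y \<and> index_box y \<subseteq> UNIV"
    using index_box_mono finite_index_box by (intro eventually_sequentiallyI[of n]) blast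
qed

lemma has_sum_index_box: "(f has_sum s) UNIV \<Longrightarrow> (\<lambda>n. sum f (index_box n)) \<longlonglongrightarrow> s"
  unfolding has_sum_def using filterlim_compose[OF _ filterlim_index_box] by blast

text \<open>Nonzero coordinates are stretched by \<open>1 + t\<close> and zero coordinates are moved
  to \<open>t\<close>. Absolute convergence at the new point will dominate a power series near
  \<open>z\<close>.\<close>

lemma exists_larger_point:
  fixes z :: "complex ^ 'n::finite"
  assumes "open D" "z \<in> D"
  obtains z' where "z' \<in> D" "\<And>i. cmod (z $ i) < cmod (z' $ i)"
proof -
  obtain r where r: "r > 0" "ball z r \<subseteq> D" using assms openE by blast
  define u :: "complex ^ 'n" where "u = (\<chi> i. if z $ i = 0 then 1 else z $ i)"
  define t where "t = r / (norm u + 1)"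
  have t: "t > 0" using r by (simp add: t_def add_nonneg_pos)
  have "t * (norm u + 1) = r" using add_nonneg_pos[of "norm u" 1] by (simp add: t_def)
  then have "t * norm u < r" using t by (simp add: algebra_simps)
  then have "z + t *\<^sub>R u \<in> D" using r t by (intro subsetD[OF r(2)]) (simp add: dist_norm)
  moreover have "cmod (z $ i) < cmod ((z + t *\<^sub>R u) $ i)" for i
  proof (cases "z $ i = 0")
    case False
    then have "(z + t *\<^sub>R u) $ i = of_real (1 + t) * z $ i"
      by (simp add: u_def distrib_right scaleR_conv_of_real[of t "z $ i"])
    then have "cmod ((z + t *\<^sub>R u) $ i) = (1 + t) * cmod (z $ i)"
      using t by (simp only: norm_mult norm_of_real)
    then show ?thesis using False t by simp
  qed (use t in \<open>simp add: u_def\<close>)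
  ultimately show ?thesis using that by blast
qed

text \<open>Abel's lemma and the M-test: near \<open>z\<close> every coordinate is dominated by that
  of a larger point \<open>z'\<close> of \<open>D\<close>, so the absolutely convergent series at
  \<open>z'\<close> bounds all remainders uniformly.\<close>

lemma power_series_holomorphic:
  fixes c :: "('n::finite \<Rightarrow> nat) \<Rightarrow> complex"
  assumes D: "open D" and sm: "\<And>z. z \<in> D \<Longrightarrow> ((\<lambda>\<alpha>. c \<alpha> * multi_power z \<alpha>) has_sum f z) UNIV"
  shows "holomorphic_Cn D f"
proof (rule holomorphic_Cn_uniform_limit)
  let ?F = "\<lambda>n z. \<Sum>\<alpha>\<in>index_box n. c \<alpha> * multi_power z \<alpha>"
  show "holomorphic_Cn D (?F n)" for n
    by (intro holomorphic_Cn_sum holomorphic_Cn_mult holomorphic_Cn_const holomorphic_Cn_multi_power)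
  fix z assume z: "z \<in> D"
  obtain z' where z': "z' \<in> D" "\<And>i. cmod (z $ i) < cmod (z' $ i)"
    using exists_larger_point[OF D z] by blast
  define U where "U = D \<inter> (\<Inter>i\<in>UNIV. (\<lambda>y. cmod (y $ i)) -` {..<cmod (z' $ i)})"
  have "open U" unfolding U_def
    by (intro open_Int D open_INT ballI open_vimage) (auto intro!: continuous_intros)
  moreover have "z \<in> U" using z z' by (simp add: U_def)
  ultimately obtain r where r: "r > 0" "ball z r \<subseteq> U" using openE by blast
  let ?g = "\<lambda>\<alpha>. cmod (c \<alpha> * multi_power z' \<alpha>)"
  have gs: "?g summable_on UNIV" by (rule has_sum_imp_abs_summable[OF sm[OF z'(1)]])
  have bd: "dist (?F n y) (f y) \<le> infsum ?g UNIV - sum ?g (index_box n)" if "y \<in> ball z r" for n y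
  proof -
    have y: "y \<in> D" "\<And>i. cmod (y $ i) \<le> cmod (z' $ i)"
      using that r(2) by (auto simp: U_def less_imp_le)
    let ?h = "\<lambda>\<alpha>. c \<alpha> * multi_power y \<alpha>"
    have hg: "norm (?h \<alpha>) \<le> ?g \<alpha>" for \<alpha>
      using norm_multi_power_mono[OF y(2)] by (simp add: norm_mult mult_left_mono)
    have "(?h has_sum (f y - ?F n y)) (UNIV - index_box n)"
      by (intro has_sum_Diff sm y has_sum_finiteI finite_index_box) auto
    then have "f y - ?F n y = infsum ?h (UNIV - index_box n)" by (simp add: infsumI)
    also have "norm \<dots> \<le> infsum ?g (UNIV - index_box n)"
    proof (rule order_trans[OF norm_infsum_bound infsum_mono])
      show 1: "(\<lambda>\<alpha>. norm (?h \<alpha>)) summable_on UNIV - index_box n"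
        by (rule summable_on_comparison_test[OF summable_on_subset[OF gs]]) (use hg in auto)
      then show "(\<lambda>\<alpha>. norm (?h \<alpha>)) summable_on UNIV - index_box n" .
      show "?g summable_on UNIV - index_box n" by (rule summable_on_subset[OF gs]) auto
    qed (rule hg)
    also have "\<dots> = infsum ?g UNIV - sum ?g (index_box n)"
      by (subst infsum_Diff[OF gs]) (simp_all add: finite_index_box)
    finally show ?thesis by (simp add: dist_norm norm_minus_commute)
  qed
  have "(\<lambda>n. infsum ?g UNIV - sum ?g (index_box n)) \<longlonglongrightarrow> infsum ?g UNIV - infsum ?g UNIV"
    by (intro tendsto_intros has_sum_index_box has_sum_infsum gs)
  then have t0: "(\<lambda>n. infsum ?g UNIV - sum ?g (index_box n)) \<longlonglongrightarrow> 0" by simp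
  have "uniform_limit (ball z r) ?F f sequentially"
  proof (rule uniform_limitI)
    fix e :: real assume "e > 0"
    with t0 have "\<forall>\<^sub>F n in sequentially. infsum ?g UNIV - sum ?g (index_box n) < e"
      by (rule order_tendstoD)
    then show "\<forall>\<^sub>F n in sequentially. \<forall>x\<in>ball z r. dist (?F n x) (f x) < e"
      by eventually_elim (use bd le_less_trans in blast)
  qed
  then show "\<exists>r>0. ball z r \<subseteq> D \<and> uniform_limit (ball z r) ?F f sequentially"
    using r U_def by blast
qed

section \<open>Diagonal holomorphic kernels\<close>

abbreviation monomial_on :: "(complex ^ 'n::finite) set \<Rightarrow> ('n \<Rightarrow> nat) \<Rightarrow> complex ^ 'n \<Rightarrow> complex" where
  "monomial_on D \<alpha> \<equiv> zext D (\<lambda>z. multi_power z \<alpha>)"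

abbreviation diag_term :: "(('n::finite \<Rightarrow> nat) \<Rightarrow> real) \<Rightarrow> complex ^ 'n \<Rightarrow> complex ^ 'n \<Rightarrow> ('n \<Rightarrow> nat) \<Rightarrow> complex" where
  "diag_term a z w \<alpha> \<equiv> complex_of_real (a \<alpha>) * multi_power z \<alpha> * cnj (multi_power w \<alpha>)"

text \<open>
  The expansion \<open>far\<close> holds on a neighbourhood of the origin that depends on \<open>w\<close>; this weak form can be
  established by analytic continuation, and it suffices to put the monomials into \<open>H\<close>.
\<close>

locale diagonal_germ = rkhs D k H ip
  for D :: "(complex ^ 'n::finite) set" and k H ip +
  fixes a :: "('n \<Rightarrow> nat) \<Rightarrow> real" and r :: real
  assumes open_D: "open D" and r_pos: "r > 0" and ball_D: "ball 0 r \<subseteq> D" and a_pos: "a \<alpha> > 0"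
    and near: "z \<in> ball 0 r \<Longrightarrow> w \<in> ball 0 r \<Longrightarrow> (diag_term a z w has_sum k z w) UNIV"
    and far: "w \<in> D \<Longrightarrow> \<exists>\<delta>>0. \<forall>x\<in>ball 0 \<delta>. (diag_term a w x has_sum k w x) UNIV"
begin

text \<open>
  As \<open>N\<close> grows, \<open>avg_kernel N \<alpha> x\<close> converges in \<open>H\<close> to \<open>a\<^sub>\<alpha> cnj(x\<^sup>\<alpha>) z\<^sup>\<alpha>\<close>: the terms
  \<open>\<beta> \<noteq> \<alpha>\<close> that survive the averaging have some \<open>\<beta>\<^sub>i\<close> at distance at least \<open>N\<close> from \<open>\<alpha>\<^sub>i\<close>.
\<close>

definition avg_kernel :: "nat \<Rightarrow> ('n \<Rightarrow> nat) \<Rightarrow> complex ^ 'n \<Rightarrow> complex ^ 'n \<Rightarrow> complex" where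
  "avg_kernel N \<alpha> x = (\<lambda>z. \<Sum>\<theta>\<in>torus_index N. (multi_power (torus_point N \<theta>) \<alpha> / of_nat (N ^ CARD('n)))
     * kernel_fun D k (torus_rotate N \<theta> x) z)"

lemma rotate_in_ball: "x \<in> ball 0 d \<Longrightarrow> torus_rotate N \<theta> x \<in> ball 0 d"
  by simp

lemma avg_kernel_mem: "x \<in> ball 0 r \<Longrightarrow> avg_kernel N \<alpha> x \<in> H"
  unfolding avg_kernel_def using ball_D rotate_in_ball by (intro sum_mem kernel_mem) blast

lemma ip_avg_kernel:
  assumes "f \<in> H" "x \<in> ball 0 r"
  shows "ip f (avg_kernel N \<alpha> x) = torus_average N \<alpha> f x"
proof -
  have rD: "torus_rotate N \<theta> x \<in> D" for \<theta> using ball_D rotate_in_ball assms(2) by blast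
  show ?thesis
    unfolding avg_kernel_def torus_average_def
    using assms rD kernel_mem by (subst ip_sum_right) (auto simp: reproducing[symmetric])
qed

text \<open>In its second variable the kernel is a power series only after conjugation, so the torus
  average is applied to the conjugate.\<close>

lemma avg_kernel_has_sum:
  assumes "N > 0" "x \<in> ball 0 r" "w \<in> D" "x \<in> ball 0 \<delta>"
    and "\<And>x. x \<in> ball 0 \<delta> \<Longrightarrow> (diag_term a w x has_sum k w x) UNIV"
  shows "((\<lambda>\<beta>. if index_cong N \<alpha> \<beta> then diag_term a w x \<beta> else 0) has_sum avg_kernel N \<alpha> x w) UNIV"
proof -
  have "((\<lambda>\<beta>. of_real (a \<beta>) * cnj (multi_power w \<beta>) * multi_power (torus_rotate N \<theta> x) \<beta>)
      has_sum cnj (k w (torus_rotate N \<theta> x))) UNIV" for \<theta>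
    using assms(5)[OF rotate_in_ball[OF assms(4)]] by (subst has_sum_cnj_iff[symmetric]) (simp add: mult_ac)
  from has_sum_torus_average[OF assms(1), of _ x "\<lambda>x. cnj (k w x)" \<alpha>, OF this]
  have "((\<lambda>\<beta>. cnj (if index_cong N \<alpha> \<beta> then of_real (a \<beta>) * cnj (multi_power w \<beta>) * multi_power x \<beta> else 0))
      has_sum cnj (torus_average N \<alpha> (\<lambda>x. cnj (k w x)) x)) UNIV"
    by (simp only: has_sum_cnj_iff)
  moreover have "cnj (torus_average N \<alpha> (\<lambda>x. cnj (k w x)) x) = avg_kernel N \<alpha> x w"
    using assms(3) by (simp add: torus_average_def avg_kernel_def zext_def)
  moreover have "(\<lambda>\<beta>. cnj (if index_cong N \<alpha> \<beta> then of_real (a \<beta>) * cnj (multi_power w \<beta>) * multi_power x \<beta> else 0))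
      = (\<lambda>\<beta>. if index_cong N \<alpha> \<beta> then diag_term a w x \<beta> else 0)"
    by auto
  ultimately show ?thesis by simp
qed

lemma ip_avg_kernel_avg_kernel:
  assumes "N > 0" "M > 0" "x \<in> ball 0 r" "y \<in> ball 0 r"
  shows "((\<lambda>\<beta>. if index_cong N \<alpha> \<beta> \<and> index_cong M \<alpha> \<beta> then diag_term a y x \<beta> else 0)
    has_sum ip (avg_kernel N \<alpha> x) (avg_kernel M \<alpha> y)) UNIV"
proof -
  have "((\<lambda>\<beta>. (if index_cong N \<alpha> \<beta> then of_real (a \<beta>) * cnj (multi_power x \<beta>) else 0) * multi_power (torus_rotate M \<theta> y) \<beta>)
     has_sum avg_kernel N \<alpha> x (torus_rotate M \<theta> y)) UNIV" for \<theta>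
  proof -
    have y: "torus_rotate M \<theta> y \<in> ball 0 r" by (rule rotate_in_ball[OF assms(4)])
    show ?thesis
      using avg_kernel_has_sum[OF assms(1,3) subsetD[OF ball_D y] assms(3) near[OF y], of \<alpha>]
      by (rule has_sum_cong[THEN iffD1, rotated]) auto
  qed
  from has_sum_torus_average[OF assms(2) this, of \<alpha>]
  show ?thesis
    unfolding ip_avg_kernel[OF avg_kernel_mem[OF assms(3)] assms(4)]
    by (rule has_sum_cong[THEN iffD1, rotated]) auto
qed

context
  fixes \<rho> :: real
  assumes rho: "\<rho> > 0" and in_ball: "\<And>t. 0 \<le> t \<Longrightarrow> t \<le> \<rho> \<Longrightarrow> (\<chi> i. complex_of_real t) \<in> ball (0 :: complex ^ 'n) r"
begin

definition "cpt t = ((\<chi> i. complex_of_real t) :: complex ^ 'n)"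
definition "err N \<alpha> = aliasing N \<alpha> (\<lambda>\<beta>. norm (diag_term a (cpt \<rho>) (cpt \<rho>) \<beta>))"
definition "deg \<alpha> = (\<Sum>i\<in>(UNIV :: 'n set). \<alpha> i :: nat)"

lemma cpt_ball: "0 \<le> t \<Longrightarrow> t \<le> \<rho> \<Longrightarrow> cpt t \<in> ball 0 r"
  unfolding cpt_def by (rule in_ball)

lemma multi_power_cpt: "multi_power (cpt t) \<alpha> = of_real (t ^ deg \<alpha>)"
  by (simp add: cpt_def multi_power_const deg_def)

lemma err_summable: "(\<lambda>\<beta>. norm (diag_term a (cpt \<rho>) (cpt \<rho>) \<beta>)) summable_on UNIV"
  using rho by (intro has_sum_imp_abs_summable[OF near] cpt_ball) auto

lemma err_tendsto: "(\<lambda>n. err (Suc n) \<alpha>) \<longlonglongrightarrow> 0"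
  unfolding err_def using LIMSEQ_Suc[OF aliasing_tendsto_0[OF err_summable]] by simp

text \<open>The congruence modulo \<open>M\<close> only removes further terms, and the series at
  \<open>cpt \<rho>\<close> dominates those at smaller points; so the error depends neither on
  \<open>M\<close> nor on \<open>t\<close> and \<open>u\<close>.\<close>

lemma ip_avg_kernel_approx:
  assumes "N > 0" "M > 0" "0 \<le> t" "t \<le> \<rho>" "0 \<le> u" "u \<le> \<rho>"
  shows "cmod (ip (avg_kernel N \<alpha> (cpt t)) (avg_kernel M \<alpha> (cpt u)) - of_real (a \<alpha> * t ^ deg \<alpha> * u ^ deg \<alpha>)) \<le> err N \<alpha>"
proof -
  have sm: "(\<lambda>\<beta>. norm (diag_term a (cpt u) (cpt t) \<beta>)) summable_on UNIV"
    using assms by (intro has_sum_imp_abs_summable[OF near] cpt_ball)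
  have "cmod (ip (avg_kernel N \<alpha> (cpt t)) (avg_kernel M \<alpha> (cpt u)) - diag_term a (cpt u) (cpt t) \<alpha>)
     \<le> aliasing N \<alpha> (\<lambda>\<beta>. norm (diag_term a (cpt u) (cpt t) \<beta>))"
    by (rule norm_diff_le_aliasing[OF sm ip_avg_kernel_avg_kernel])
      (use assms cpt_ball in \<open>auto simp: index_cong_def\<close>)
  also have "\<dots> \<le> err N \<alpha>"
    unfolding err_def
  proof (rule aliasing_mono[OF err_summable])
    fix \<beta> :: "'n \<Rightarrow> nat"
    have "t ^ deg \<beta> \<le> \<rho> ^ deg \<beta>" "u ^ deg \<beta> \<le> \<rho> ^ deg \<beta>" using assms by (auto intro: power_mono)
    then show "norm (diag_term a (cpt u) (cpt t) \<beta>) \<le> norm (diag_term a (cpt \<rho>) (cpt \<rho>) \<beta>)"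
      using assms rho a_pos[of \<beta>]
      by (simp add: multi_power_cpt norm_mult norm_power) (simp add: mult_mono mult.assoc)
  qed auto
  finally show ?thesis by (simp add: multi_power_cpt mult_ac)
qed

text \<open>Up to the factor \<open>t ^ deg \<alpha>\<close> the averages barely depend on the base
  point or on \<open>N\<close>. The case \<open>t = 1\<close> gives the Cauchy property; the case
  \<open>N = M\<close> compares two base points.\<close>

lemma avg_kernel_dist:
  assumes "N > 0" "M > 0" "0 \<le> t" "t \<le> 1"
  shows "(hnorm ip (\<lambda>z. avg_kernel N \<alpha> (cpt (t * \<rho>)) z - of_real (t ^ deg \<alpha>) * avg_kernel M \<alpha> (cpt \<rho>) z))\<^sup>2
    \<le> 2 * err N \<alpha> + 2 * err M \<alpha>"
proof -
  define s where "s = t ^ deg \<alpha>"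
  have s: "0 \<le> s" "s \<le> 1" using assms by (auto simp: s_def power_le_one)
  have tr: "0 \<le> t * \<rho>" "t * \<rho> \<le> \<rho>" using assms rho by (auto simp: mult_left_le_one_le)
  define f where "f = avg_kernel N \<alpha> (cpt (t * \<rho>))"
  define g where "g = avg_kernel M \<alpha> (cpt \<rho>)"
  have f: "f \<in> H" and g: "g \<in> H"
    unfolding f_def g_def using tr rho by (auto intro!: avg_kernel_mem cpt_ball)
  define h where "h = (\<lambda>z. f z - of_real s * g z)"
  have h: "h \<in> H" unfolding h_def by (intro diff_mem scale_mem f g)
  define L where "L = complex_of_real (a \<alpha> * \<rho> ^ deg \<alpha> * \<rho> ^ deg \<alpha>)"
  have "ip h h = ip f f - of_real s * ip f g - of_real s * ip g f + of_real (s * s) * ip g g"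
    unfolding h_def using f g
    by (simp add: ip_diff ip_diff_right diff_mem scale_mem ip_scale ip_scale_right algebra_simps)
  \<comment> \<open>All inner products are close to multiples of \<open>L\<close>, and the four
    multiples subtracted here cancel.\<close>
  also have "\<dots> = (ip f f - of_real (s * s) * L) - of_real s * (ip f g - of_real s * L)
      - of_real s * (ip g f - of_real s * L) + of_real (s * s) * (ip g g - L)"
    by (simp add: algebra_simps)
  finally have "cmod (ip h h) \<le> cmod (ip f f - of_real (s * s) * L) + cmod (of_real s * (ip f g - of_real s * L))
      + cmod (of_real s * (ip g f - of_real s * L)) + cmod (of_real (s * s) * (ip g g - L))"
    by (metis (no_types, lifting) add_mono norm_triangle_le norm_triangle_le_diff order_refl)
  moreover have "cmod (ip f f - of_real (s * s) * L) \<le> err N \<alpha>"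
    using ip_avg_kernel_approx[OF assms(1,1) tr tr, of \<alpha>]
    by (simp add: f_def L_def s_def power_mult_distrib mult_ac)
  moreover have "cmod (ip f g - of_real s * L) \<le> err N \<alpha>"
    using ip_avg_kernel_approx[OF assms(1,2) tr, of \<rho> \<alpha>] rho
    by (simp add: f_def g_def L_def s_def power_mult_distrib mult_ac)
  moreover have "cmod (ip g f - of_real s * L) \<le> err M \<alpha>"
    using ip_avg_kernel_approx[OF assms(2,1) _ _ tr, of \<rho> \<alpha>] rho
    by (simp add: f_def g_def L_def s_def power_mult_distrib mult_ac)
  moreover have "cmod (ip g g - L) \<le> err M \<alpha>"
    using ip_avg_kernel_approx[OF assms(2,2), of \<rho> \<rho> \<alpha>] rho
    by (simp add: f_def g_def L_def)
  moreover have "cmod (of_real q * x) \<le> y" if "0 \<le> q" "q \<le> 1" "cmod x \<le> y" for q x y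
    using that mult_left_le_one_le[of "cmod x" q] by (simp add: norm_mult)
  ultimately have "cmod (ip h h) \<le> 2 * err N \<alpha> + 2 * err M \<alpha>"
    using s mult_le_one[OF s(2) s(1) s(2)] mult_nonneg_nonneg[OF s(1) s(1)] by (smt (verit))
  then show ?thesis
    using ip_self[OF h] by (simp add: h_def f_def g_def s_def norm_mult norm_power)
qed

text \<open>The averages at \<open>cpt \<rho>\<close> converge in norm, but at a point
  \<open>w\<close> their values are known only for base points so close to 0 that \<open>far\<close>
  applies. The limit is therefore evaluated through averages at a smaller base point and transferred
  by \<open>avg_kernel_dist\<close>.\<close>

lemma monomial_limit:
  shows "monomial_on D \<alpha> \<in> H"
    and "(\<lambda>n. hnorm ip (\<lambda>z. avg_kernel (Suc n) \<alpha> (cpt \<rho>) z - of_real (a \<alpha> * \<rho> ^ deg \<alpha>) * monomial_on D \<alpha> z)) \<longlonglongrightarrow> 0"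
proof -
  define F where "F = (\<lambda>n. avg_kernel (Suc n) \<alpha> (cpt \<rho>))"
  have F: "F n \<in> H" for n unfolding F_def using rho by (intro avg_kernel_mem cpt_ball) auto
  have "\<exists>N. \<forall>m\<ge>N. \<forall>n\<ge>N. hnorm ip (\<lambda>z. F m z - F n z) < e" if "e > 0" for e
  proof -
    have "e\<^sup>2 / 8 > 0" using that by simp
    then obtain N where N: "\<And>n. n \<ge> N \<Longrightarrow> err (Suc n) \<alpha> < e\<^sup>2 / 8"
      using order_tendstoD(2)[OF err_tendsto, of "e\<^sup>2 / 8" \<alpha>] unfolding eventually_sequentially by auto
    have "hnorm ip (\<lambda>z. F m z - F n z) < e" if "m \<ge> N" "n \<ge> N" for m n
    proof -
      have "(hnorm ip (\<lambda>z. F m z - F n z))\<^sup>2 \<le> 2 * err (Suc m) \<alpha> + 2 * err (Suc n) \<alpha>"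
        using avg_kernel_dist[of "Suc m" "Suc n" 1 \<alpha>] by (simp add: F_def)
      also have "\<dots> < e\<^sup>2" using N[OF that(1)] N[OF that(2)] \<open>e > 0\<close> zero_less_power[of e 2] by linarith
      finally show ?thesis using \<open>e > 0\<close> by (simp add: power2_less_imp_less)
    qed
    then show ?thesis by blast
  qed
  then obtain f where f: "f \<in> H" "(\<lambda>n. hnorm ip (\<lambda>z. F n z - f z)) \<longlonglongrightarrow> 0"
    using complete[of F] F by blast
  have fw: "f w = of_real (a \<alpha> * \<rho> ^ deg \<alpha>) * multi_power w \<alpha>" if w: "w \<in> D" for w
  proof -
    obtain \<delta> where \<delta>: "\<delta> > 0" "\<And>x. x \<in> ball 0 \<delta> \<Longrightarrow> (diag_term a w x has_sum k w x) UNIV"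
      using far[OF w] by blast
    obtain \<rho>' where \<rho>': "\<rho>' > 0" "\<And>t. 0 \<le> t \<Longrightarrow> t \<le> \<rho>' \<Longrightarrow> cpt t \<in> ball 0 \<delta>"
      using exists_positive_point_in_ball[OF \<delta>(1)] unfolding cpt_def by metis
    \<comment> \<open>The bound by 1 is what \<open>avg_kernel_dist\<close> requires; the other
      bound puts the base point where the expansion at \<open>w\<close> holds.\<close>
    define t where "t = min 1 (\<rho>' / \<rho>)"
    have t: "0 < t" "t \<le> 1" "t * \<rho> \<le> \<rho>'" using \<rho>' rho by (auto simp: t_def field_simps min_def)
    have tr: "0 \<le> t * \<rho>" "t * \<rho> \<le> \<rho>" using t rho by (auto simp: mult_left_le_one_le)
    define s where "s = t ^ deg \<alpha>"
    have s: "s > 0" using t by (simp add: s_def)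
    define G where "G = (\<lambda>n. avg_kernel (Suc n) \<alpha> (cpt (t * \<rho>)))"
    have G: "G n \<in> H" for n unfolding G_def using tr by (intro avg_kernel_mem cpt_ball) auto
    have "(\<lambda>n. G n w) \<longlonglongrightarrow> diag_term a w (cpt (t * \<rho>)) \<alpha>"
    proof (rule Lim_null[THEN iffD2], rule Lim_null_comparison)
      have xb: "cpt (t * \<rho>) \<in> ball 0 \<delta>" using \<rho>'(2) tr t by simp
      have sm: "(\<lambda>\<beta>. norm (diag_term a w (cpt (t * \<rho>)) \<beta>)) summable_on UNIV"
        using \<delta>(2)[OF xb] by (rule has_sum_imp_abs_summable)
      show "\<forall>\<^sub>F n in sequentially. norm (G n w - diag_term a w (cpt (t * \<rho>)) \<alpha>)
          \<le> aliasing (Suc n) \<alpha> (\<lambda>\<beta>. norm (diag_term a w (cpt (t * \<rho>)) \<beta>))"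
        unfolding G_def
        by (intro always_eventually allI norm_diff_le_aliasing[OF sm, where P = "\<lambda>_. True"])
          (use avg_kernel_has_sum[OF _ cpt_ball[OF tr] w xb \<delta>(2)] in auto)
      show "(\<lambda>n. aliasing (Suc n) \<alpha> (\<lambda>\<beta>. norm (diag_term a w (cpt (t * \<rho>)) \<beta>))) \<longlonglongrightarrow> 0"
        using LIMSEQ_Suc[OF aliasing_tendsto_0[OF sm]] by simp
    qed
    moreover have "(\<lambda>n. G n w - of_real s * F n w) \<longlonglongrightarrow> 0"
    proof -
      define Q where "Q = (\<lambda>n z. G n z - of_real s * F n z)"
      have Q: "Q n \<in> H" for n unfolding Q_def by (intro diff_mem scale_mem F G)
      have "(\<lambda>n. (hnorm ip (Q n))\<^sup>2) \<longlonglongrightarrow> 0"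
      proof (rule tendsto_sandwich[OF _ _ tendsto_const])
        show "\<forall>\<^sub>F n in sequentially. (hnorm ip (Q n))\<^sup>2 \<le> 4 * err (Suc n) \<alpha>"
          using avg_kernel_dist[of "Suc n" "Suc n" t \<alpha> for n] t
          by (intro always_eventually allI) (simp add: Q_def F_def G_def s_def)
        show "(\<lambda>n. 4 * err (Suc n) \<alpha>) \<longlonglongrightarrow> 0"
          using tendsto_mult_right_zero[OF err_tendsto] .
      qed simp
      then have "(\<lambda>n. sqrt ((hnorm ip (Q n))\<^sup>2)) \<longlonglongrightarrow> sqrt 0" by (rule tendsto_real_sqrt)
      then have "(\<lambda>n. hnorm ip (\<lambda>z. Q n z - 0)) \<longlonglongrightarrow> 0" using hnorm_nonneg[OF Q] by simp
      from tendsto_pointwise[OF Q zero_mem this, of w] show ?thesis by (simp add: Q_def)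
    qed
    ultimately have "(\<lambda>n. G n w - (G n w - of_real s * F n w)) \<longlonglongrightarrow> diag_term a w (cpt (t * \<rho>)) \<alpha> - 0"
      by (rule tendsto_diff)
    moreover have "(\<lambda>n. of_real s * F n w) \<longlonglongrightarrow> of_real s * f w"
      by (intro tendsto_mult_left tendsto_pointwise[OF F f])
    ultimately have "of_real s * f w = diag_term a w (cpt (t * \<rho>)) \<alpha>"
      using LIMSEQ_unique by fastforce
    also have "\<dots> = of_real s * (of_real (a \<alpha> * \<rho> ^ deg \<alpha>) * multi_power w \<alpha>)"
      by (simp add: multi_power_cpt s_def power_mult_distrib)
    finally show ?thesis using s by simp
  qed
  define c where "c = complex_of_real (a \<alpha> * \<rho> ^ deg \<alpha>)"
  have c: "c \<noteq> 0" using a_pos[of \<alpha>] rho by (simp add: c_def)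
  have fm: "f z = c * monomial_on D \<alpha> z" for z
    using fw[of z] vanish_off[OF f(1)] by (simp add: zext_def c_def)
  have "monomial_on D \<alpha> = (\<lambda>z. (1 / c) * f z)" using c by (simp add: fm)
  then show "monomial_on D \<alpha> \<in> H" using scale_mem[OF f(1), of "1 / c"] by simp
  show "(\<lambda>n. hnorm ip (\<lambda>z. avg_kernel (Suc n) \<alpha> (cpt \<rho>) z - of_real (a \<alpha> * \<rho> ^ deg \<alpha>) * monomial_on D \<alpha> z)) \<longlonglongrightarrow> 0"
    using f(2) by (simp add: fm F_def c_def)
qed

text \<open>Against an averaged kernel a monomial pairs exactly: its torus average is either itself
  or 0, and it is 0 for all large \<open>N\<close> unless the indices agree. The limit then replaces
  the averaged kernel by a multiple of a monomial.\<close>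

lemma ip_monomial_aux:
  "ip (monomial_on D \<alpha>) (monomial_on D \<beta>) = (if \<alpha> = \<beta> then of_real (1 / a \<alpha>) else 0)"
proof -
  define c where "c = a \<beta> * \<rho> ^ deg \<beta>"
  have c: "c \<noteq> 0" using a_pos[of \<beta>] rho by (simp add: c_def)
  have x: "cpt \<rho> \<in> ball 0 r" using cpt_ball rho by simp
  have cm: "(\<lambda>z. of_real c * monomial_on D \<beta> z) \<in> H" by (intro scale_mem monomial_limit)
  have "(\<lambda>n. ip (avg_kernel (Suc n) \<beta> (cpt \<rho>)) (monomial_on D \<alpha>))
      \<longlonglongrightarrow> ip (\<lambda>z. of_real c * monomial_on D \<beta> z) (monomial_on D \<alpha>)"
    using avg_kernel_mem[OF x] cm monomial_limit(1)
    by (rule tendsto_ip) (use monomial_limit(2)[of \<beta>] in \<open>simp add: c_def\<close>)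
  from tendsto_cnj[OF this] have t1: "(\<lambda>n. ip (monomial_on D \<alpha>) (avg_kernel (Suc n) \<beta> (cpt \<rho>)))
      \<longlonglongrightarrow> ip (monomial_on D \<alpha>) (\<lambda>z. of_real c * monomial_on D \<beta> z)"
    by (simp only: ip_commute[OF avg_kernel_mem[OF x] monomial_limit(1), symmetric] ip_commute[OF cm monomial_limit(1), symmetric])
  have t2: "ip (monomial_on D \<alpha>) (avg_kernel (Suc n) \<beta> (cpt \<rho>))
      = (if index_cong (Suc n) \<beta> \<alpha> then of_real (\<rho> ^ deg \<alpha>) else 0)" for n
  proof -
    have "ip (monomial_on D \<alpha>) (avg_kernel (Suc n) \<beta> (cpt \<rho>)) = torus_average (Suc n) \<beta> (monomial_on D \<alpha>) (cpt \<rho>)"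
      by (rule ip_avg_kernel[OF monomial_limit(1) x])
    also have "\<dots> = torus_average (Suc n) \<beta> (\<lambda>z. multi_power z \<alpha>) (cpt \<rho>)"
      unfolding torus_average_def using subsetD[OF ball_D rotate_in_ball[OF x]]
      by (simp add: zext_def)
    finally show ?thesis by (simp add: torus_average_monomial multi_power_cpt)
  qed
  have t3: "(\<lambda>n. if index_cong (Suc n) \<beta> \<alpha> then complex_of_real (\<rho> ^ deg \<alpha>) else 0)
      \<longlonglongrightarrow> (if \<alpha> = \<beta> then of_real (\<rho> ^ deg \<alpha>) else 0)"
  proof (cases "\<alpha> = \<beta>")
    case False
    then obtain i where i: "\<alpha> i \<noteq> \<beta> i" by auto
    have "\<not> index_cong (Suc n) \<beta> \<alpha>" if "n \<ge> \<alpha> i + \<beta> i" for n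
    proof
      assume "index_cong (Suc n) \<beta> \<alpha>"
      then have "\<beta> i mod Suc n = \<alpha> i mod Suc n" by (simp add: index_cong_def)
      then show False using that i by simp
    qed
    then have "\<forall>\<^sub>F n in sequentially. (if index_cong (Suc n) \<beta> \<alpha> then complex_of_real (\<rho> ^ deg \<alpha>) else 0) = 0"
      by (intro eventually_sequentiallyI[of "\<alpha> i + \<beta> i"]) simp
    from tendsto_eventually[OF this] show ?thesis using False by simp
  qed (simp add: index_cong_def)
  have "ip (monomial_on D \<alpha>) (\<lambda>z. of_real c * monomial_on D \<beta> z) = (if \<alpha> = \<beta> then of_real (\<rho> ^ deg \<alpha>) else 0)"
    using LIMSEQ_unique[OF t1[unfolded t2] t3] .
  then have "of_real c * ip (monomial_on D \<alpha>) (monomial_on D \<beta>) = (if \<alpha> = \<beta> then of_real (\<rho> ^ deg \<alpha>) else 0)"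
    by (simp add: ip_scale_right monomial_limit)
  then show ?thesis
    using c rho by (auto simp: c_def field_simps)
qed

end

lemma monomial_mem: "monomial_on D \<alpha> \<in> H"
  and ip_monomial: "ip (monomial_on D \<alpha>) (monomial_on D \<beta>) = (if \<alpha> = \<beta> then of_real (1 / a \<alpha>) else 0)"
proof -
  obtain \<rho> where \<rho>: "\<rho> > 0" "\<And>t. 0 \<le> t \<Longrightarrow> t \<le> \<rho> \<Longrightarrow> (\<chi> i. complex_of_real t) \<in> ball (0 :: complex ^ 'n) r"
    using exists_positive_point_in_ball[OF r_pos] by blast
  show "monomial_on D \<alpha> \<in> H" by (rule monomial_limit(1)[OF \<rho>])
  show "ip (monomial_on D \<alpha>) (monomial_on D \<beta>) = (if \<alpha> = \<beta> then of_real (1 / a \<alpha>) else 0)"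
    by (rule ip_monomial_aux[OF \<rho>])
qed

lemma ip_monomial_combination:
  assumes "finite F" "finite G"
  shows "ip (\<lambda>z. \<Sum>\<alpha>\<in>F. c \<alpha> * monomial_on D \<alpha> z) (\<lambda>z. \<Sum>\<alpha>\<in>G. d \<alpha> * monomial_on D \<alpha> z)
    = (\<Sum>\<alpha>\<in>F \<inter> G. c \<alpha> * cnj (d \<alpha>) / a \<alpha>)"
proof -
  have "ip (\<lambda>z. \<Sum>\<alpha>\<in>F. c \<alpha> * monomial_on D \<alpha> z) (\<lambda>z. \<Sum>\<alpha>\<in>G. d \<alpha> * monomial_on D \<alpha> z)
      = (\<Sum>\<alpha>\<in>F. c \<alpha> * (\<Sum>\<beta>\<in>G. cnj (d \<beta>) * (if \<alpha> = \<beta> then of_real (1 / a \<alpha>) else 0)))"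
    by (subst ip_sum) (auto intro!: monomial_mem sum_mem sum.cong simp: ip_sum_right monomial_mem ip_monomial)
  also have "\<dots> = (\<Sum>\<alpha>\<in>F. if \<alpha> \<in> G then c \<alpha> * cnj (d \<alpha>) / a \<alpha> else 0)"
    using assms(2) by (intro sum.cong) (auto simp: if_distrib[of "(*) _"] cong: if_cong)
  finally show ?thesis using assms(1) by (simp add: sum.inter_restrict)
qed

text \<open>Here \<open>v\<close> is the projection of the kernel function at \<open>w\<close> to
  the span of finitely many monomials; its squared norm and its value at \<open>w\<close> are the
  same sum. Cauchy-Schwarz bounds that sum at every point of \<open>D\<close>, however far from the
  origin.\<close>

lemma Bessel_kernel:
  assumes "w \<in> D" "finite F"
  shows "(\<Sum>\<alpha>\<in>F. a \<alpha> * (cmod (multi_power w \<alpha>))\<^sup>2) \<le> Re (k w w)"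
proof -
  define v where "v = (\<lambda>z. \<Sum>\<alpha>\<in>F. (of_real (a \<alpha>) * cnj (multi_power w \<alpha>)) * monomial_on D \<alpha> z)"
  have v: "v \<in> H" unfolding v_def by (intro sum_mem monomial_mem)
  define S where "S = (\<Sum>\<alpha>\<in>F. a \<alpha> * (cmod (multi_power w \<alpha>))\<^sup>2)"
  have S0: "0 \<le> S" unfolding S_def using a_pos by (intro sum_nonneg) (simp add: less_imp_le)
  have cc: "cnj x * x = of_real ((cmod x)\<^sup>2)" for x
    by (metis complex_norm_square mult.commute of_real_power)
  have "ip v v = of_real S"
    unfolding v_def ip_monomial_combination[OF assms(2,2)] S_def of_real_sum Int_absorb
  proof (rule sum.cong[OF refl])
    fix \<alpha> assume "\<alpha> \<in> F"
    show "complex_of_real (a \<alpha>) * cnj (multi_power w \<alpha>) * cnj (of_real (a \<alpha>) * cnj (multi_power w \<alpha>)) / of_real (a \<alpha>)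
      = of_real (a \<alpha> * (cmod (multi_power w \<alpha>))\<^sup>2)"
      using a_pos[of \<alpha>] cc[of "multi_power w \<alpha>"] by (simp add: mult_ac)
  qed
  then have nv: "(hnorm ip v)\<^sup>2 = S" using ip_self[OF v] by (metis of_real_eq_iff)
  have "ip v (kernel_fun D k w) = v w" using reproducing[OF v assms(1)] by simp
  also have "v w = of_real S"
    unfolding v_def S_def using assms(1) cc by (simp add: zext_def mult.assoc)
  finally have "S \<le> hnorm ip v * hnorm ip (kernel_fun D k w)"
    using Cauchy_Schwarz[OF v kernel_mem[OF assms(1)]] S0 by simp
  then have "S\<^sup>2 \<le> (hnorm ip v * hnorm ip (kernel_fun D k w))\<^sup>2"
    using S0 by (intro power_mono)
  also have "\<dots> = S * Re (k w w)"
    using ip_self[OF kernel_mem[OF assms(1)]] ip_kernel[OF assms(1,1)] nv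
    by (simp add: power_mult_distrib)
  finally have "S * S \<le> S * Re (k w w)" by (simp add: power2_eq_square)
  moreover have "0 \<le> Re (k w w)"
    using ip_nonneg[OF kernel_mem[OF assms(1)]] ip_kernel[OF assms(1,1)] by (simp add: complex_nonneg_Reals_iff)
  ultimately show ?thesis using S0 unfolding S_def[symmetric] by (cases "S = 0") auto
qed

lemma summable_diag:
  assumes "w \<in> D"
  shows "(\<lambda>\<alpha>. a \<alpha> * (cmod (multi_power w \<alpha>))\<^sup>2) summable_on UNIV"
  using a_pos Bessel_kernel[OF assms]
  by (intro nonneg_bdd_above_summable_on bdd_aboveI2[where M = "Re (k w w)"]) (auto simp: less_imp_le)

lemma summable_diag_term:
  assumes "z \<in> D" "w \<in> D"
  shows "diag_term a z w summable_on UNIV"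
proof -
  have "(\<lambda>\<alpha>. norm (diag_term a z w \<alpha>)) summable_on UNIV"
  proof (rule summable_on_comparison_test[OF summable_on_add[OF summable_diag[OF assms(1)] summable_diag[OF assms(2)]]])
    fix \<alpha>
    have "cmod (multi_power z \<alpha>) * cmod (multi_power w \<alpha>) \<le> (cmod (multi_power z \<alpha>))\<^sup>2 + (cmod (multi_power w \<alpha>))\<^sup>2"
      using sum_squares_bound[of "cmod (multi_power z \<alpha>)" "cmod (multi_power w \<alpha>)"]
        mult_nonneg_nonneg[OF norm_ge_zero[of "multi_power z \<alpha>"] norm_ge_zero[of "multi_power w \<alpha>"]] by linarith
    then show "norm (diag_term a z w \<alpha>) \<le> a \<alpha> * (cmod (multi_power z \<alpha>))\<^sup>2 + a \<alpha> * (cmod (multi_power w \<alpha>))\<^sup>2"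
      using a_pos[of \<alpha>] by (simp add: norm_mult mult.assoc distrib_left[symmetric])
  qed auto
  then show ?thesis by (rule abs_summable_summable)
qed

end

section \<open>Continuation of the expansion to all pairs of points\<close>

lemma mult_cnj_norm: "z * cnj z = (complex_of_real (cmod z))\<^sup>2"
  by (metis complex_norm_square of_real_power)

text \<open>A small \<open>x\<close> compensates for a large first argument: the terms depend on the
  products of coordinates only. So on a whole ball in the first variable both sides are holomorphic
  once \<open>x\<close> is small enough, and they agree near one of its points. The ball for
  \<open>x\<close> shrinks at each stage of the connectedness argument.\<close>

lemma diagonal_far_expansion:
  assumes D: "open D" "connected D" and r: "r > 0" "ball 0 r \<subseteq> D"
    and hol: "\<And>w. w \<in> D \<Longrightarrow> holomorphic_Cn D (\<lambda>z. k z w)"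
    and near: "\<And>z w. z \<in> ball 0 r \<Longrightarrow> w \<in> ball 0 r \<Longrightarrow> (diag_term a z w has_sum k z w) UNIV"
    and w: "w \<in> D"
  shows "\<exists>\<delta>>0. \<forall>x\<in>ball 0 \<delta>. (diag_term a w x has_sum k w (x :: complex ^ 'n::finite)) UNIV"
proof -
  define P where "P = (\<lambda>w. \<exists>e>0. \<exists>\<delta>>0. \<forall>w'\<in>ball w e. \<forall>x\<in>ball 0 \<delta>. (diag_term a w' x has_sum k w' x) UNIV)"
  have "P w"
  proof (rule connected_induction_simple[OF D(2) _ w])
    show "0 \<in> D" using r by auto
    show "P 0" unfolding P_def using r(1) near by blast
    fix c assume "c \<in> D"
    then obtain R where R: "R > 0" "ball c R \<subseteq> D" using D(1) openE by blast
    have step: "P x0 \<longrightarrow> P z0" if xz: "x0 \<in> ball c R" "z0 \<in> ball c R" for x0 z0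
    proof
      assume "P x0"
      then obtain e \<delta> where e: "e > 0" "\<delta> > 0"
        "\<And>w' x. w' \<in> ball x0 e \<Longrightarrow> x \<in> ball 0 \<delta> \<Longrightarrow> (diag_term a w' x has_sum k w' x) UNIV"
        unfolding P_def by blast
      define M where "M = norm c + R"
      have M: "M > 0" using R by (simp add: M_def add_nonneg_pos)
      obtain \<rho> where \<rho>: "\<rho> > 0" "\<And>t. 0 \<le> t \<Longrightarrow> t \<le> \<rho> \<Longrightarrow> (\<chi> i. complex_of_real t) \<in> ball (0 :: complex ^ 'n) r"
        using exists_positive_point_in_ball[OF r(1)] by blast
      define q where "q = (\<chi> i. complex_of_real \<rho> :: complex ^ 'n)"
      have q: "q \<in> ball 0 r" using \<rho> by (simp add: q_def)
      \<comment> \<open>The bound \<open>\<rho> * \<rho> / M\<close> keeps each product of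
        coordinates below \<open>\<rho> * \<rho>\<close>, so the series at the pair
        \<open>(q, q)\<close> dominates; the other two bounds keep the known expansion valid and
        \<open>x\<close> in \<open>D\<close>.\<close>
      define \<delta>' where "\<delta>' = min \<delta> (min r (\<rho> * \<rho> / M))"
      have \<delta>': "\<delta>' > 0" "\<delta>' \<le> \<delta>" "\<delta>' \<le> r" "\<delta>' \<le> \<rho> * \<rho> / M" using e r \<rho> M by (auto simp: \<delta>'_def)
      have main: "(diag_term a w' x has_sum k w' x) UNIV" if w': "w' \<in> ball c R" and x: "x \<in> ball 0 \<delta>'" for w' x
      proof -
        have sm: "diag_term a y x summable_on UNIV" if y: "y \<in> ball c R" for y
        proof (rule abs_summable_summable, rule summable_on_comparison_test[OF has_sum_imp_abs_summable[OF near[OF q q]]])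
          fix \<beta> :: "'n \<Rightarrow> nat"
          have "norm y \<le> M" using y norm_triangle_ineq2[of y c] by (simp add: M_def dist_norm norm_minus_commute)
          then have yi: "cmod (y $ i) \<le> M" for i using Finite_Cartesian_Product.norm_nth_le[of y i] by linarith
          have xi: "cmod (x $ i) \<le> \<rho> * \<rho> / M" for i
            using Finite_Cartesian_Product.norm_nth_le[of x i] x \<delta>' by (simp add: dist_norm)
          have "cmod (y $ i) * cmod (x $ i) \<le> M * (\<rho> * \<rho> / M)" for i
            using M by (intro mult_mono yi xi) auto
          then have yx: "cmod ((\<chi> i. y $ i * x $ i) $ i) \<le> cmod ((\<chi> i. q $ i * q $ i) $ i)" for i
            using M \<rho> by (simp add: norm_mult q_def)
          have "cmod (multi_power y \<beta>) * cmod (multi_power x \<beta>) \<le> cmod (multi_power q \<beta>) * cmod (multi_power q \<beta>)"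
            using norm_multi_power_mono[of "\<chi> i. y $ i * x $ i" "\<chi> i. q $ i * q $ i" \<beta>, OF yx]
            by (simp add: multi_power_mult norm_mult)
          then show "norm (diag_term a y x \<beta>) \<le> norm (diag_term a q q \<beta>)"
            by (simp add: norm_mult mult.assoc mult_left_mono)
        qed auto
        have "infsum (diag_term a w' x) UNIV = k w' x"
        proof (rule holomorphic_Cn_identity_ball[where f = "\<lambda>y. infsum (diag_term a y x) UNIV" and g = "\<lambda>y. k y x"])
          show "holomorphic_Cn (ball c R) (\<lambda>y. infsum (diag_term a y x) UNIV)"
          proof (rule power_series_holomorphic[OF open_ball])
            fix y assume "y \<in> ball c R"
            from has_sum_infsum[OF sm[OF this]]
            show "((\<lambda>\<alpha>. of_real (a \<alpha>) * cnj (multi_power x \<alpha>) * multi_power y \<alpha>) has_sum infsum (diag_term a y x) UNIV) UNIV"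
              by (simp add: mult_ac)
          qed
          have "x \<in> D" using x \<delta>' r by auto
          then show "holomorphic_Cn (ball c R) (\<lambda>y. k y x)"
            using holomorphic_Cn_subset[OF hol R(2)] by blast
          show "infsum (diag_term a y x) UNIV = k y x" if "y \<in> ball x0 e" for y
            using x \<delta>' by (intro infsumI e(3) that) auto
        qed (fact xz(1) e(1) w')+
        then show ?thesis using has_sum_infsum[OF sm[OF w']] by simp
      qed
      obtain d where "d > 0" "ball z0 d \<subseteq> ball c R" using xz(2) openE[OF open_ball] by blast
      then show "P z0" unfolding P_def using main \<delta>'(1) by blast
    qed
    show "\<exists>T. openin (top_of_set D) T \<and> c \<in> T \<and> (\<forall>x\<in>T. \<forall>y\<in>T. P x \<longrightarrow> P y)"
      by (intro exI[of _ "ball c R"] conjI ballI step open_subset open_ball R(2)) (simp_all add: R(1))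
  qed
  then show ?thesis unfolding P_def by (meson centre_in_ball)
qed

text \<open>Continuation in \<open>w\<close> for fixed \<open>z\<close>: the series converges at
  every \<open>w\<close> by the Bessel bound, so its conjugate is holomorphic in \<open>w\<close>,
  and near the origin it represents the kernel.\<close>

proposition diagonal_expansion_global:
  fixes D :: "(complex ^ 'n::finite) set"
  assumes "domain_Cn D" "holomorphic_kernel D k" "rkhs D k H ip" "diagonal_expansion D k a"
  shows "\<And>z w. z \<in> D \<Longrightarrow> w \<in> D \<Longrightarrow> (diag_term a z w has_sum k z w) UNIV"
proof -
  have D: "open D" "connected D" using assms(1) by (auto simp: domain_Cn_def)
  obtain r where a: "\<And>\<alpha>. a \<alpha> > 0" and r: "r > 0" "ball 0 r \<subseteq> D"
    and near: "\<And>z w. z \<in> ball 0 r \<Longrightarrow> w \<in> ball 0 r \<Longrightarrow> (diag_term a z w has_sum k z w) UNIV"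
    using assms(4) unfolding diagonal_expansion_def by blast
  have hol: "holomorphic_Cn D (\<lambda>z. k z w)" "holomorphic_Cn D (\<lambda>z. cnj (k w z))" if "w \<in> D" for w
    using assms(2) that unfolding holomorphic_kernel_def by blast+
  have far: "\<exists>\<delta>>0. \<forall>x\<in>ball 0 \<delta>. (diag_term a w x has_sum k w x) UNIV" if "w \<in> D" for w
    using diagonal_far_expansion[OF D r hol(1) near that] by blast
  interpret diagonal_germ D k H ip a r
    by (intro diagonal_germ.intro assms(3) diagonal_germ_axioms.intro D r a near far)
  fix z w assume z: "z \<in> D" and w: "w \<in> D"
  obtain \<delta> where \<delta>: "\<delta> > 0" "\<And>x. x \<in> ball 0 \<delta> \<Longrightarrow> (diag_term a z x has_sum k z x) UNIV"
    using far[OF z] by blast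
  have "cnj (infsum (diag_term a z w) UNIV) = cnj (k z w)"
  proof (rule holomorphic_Cn_identity[OF D, where f = "\<lambda>w. cnj (infsum (diag_term a z w) UNIV)" and g = "\<lambda>w. cnj (k z w)"])
    show "holomorphic_Cn D (\<lambda>w. cnj (infsum (diag_term a z w) UNIV))"
    proof (rule power_series_holomorphic[OF D(1)])
      fix y assume "y \<in> D"
      from has_sum_infsum[OF summable_diag_term[OF z this]]
      show "((\<lambda>\<alpha>. of_real (a \<alpha>) * cnj (multi_power z \<alpha>) * multi_power y \<alpha>)
          has_sum cnj (infsum (diag_term a z y) UNIV)) UNIV"
        by (subst has_sum_cnj_iff[symmetric]) (simp add: mult_ac)
    qed
    show "holomorphic_Cn D (\<lambda>w. cnj (k z w))" by (rule hol(2)[OF z])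
    show "0 \<in> D" using r by auto
    show "cnj (infsum (diag_term a z x) UNIV) = cnj (k z x)" if "x \<in> ball 0 \<delta>" for x
      using \<delta>(2)[OF that] by (simp add: infsumI)
  qed (fact \<delta>(1) w)+
  then have "infsum (diag_term a z w) UNIV = k z w" by simp
  then show "(diag_term a z w has_sum k z w) UNIV"
    using has_sum_infsum[OF summable_diag_term[OF z w]] by simp
qed

section \<open>Taylor expansion and convergence in the Hilbert space\<close>

locale diagonal_rkhs = rkhs D k H ip
  for D :: "(complex ^ 'n::finite) set" and k H ip +
  fixes a :: "('n \<Rightarrow> nat) \<Rightarrow> real" and r :: real
  assumes open_dom: "open D" and radius: "r > 0" "ball 0 r \<subseteq> D" and coeff_pos: "a \<alpha> > 0"
    and expansion: "z \<in> D \<Longrightarrow> w \<in> D \<Longrightarrow> (diag_term a z w has_sum k z w) UNIV"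
begin

sublocale diagonal_germ D k H ip a r
proof unfold_locales
  show "\<exists>\<delta>>0. \<forall>x\<in>ball 0 \<delta>. (diag_term a w x has_sum k w x) UNIV" if "w \<in> D" for w
    using radius expansion that by blast
  show "(diag_term a z w has_sum k z w) UNIV" if "z \<in> ball 0 r" "w \<in> ball 0 r" for z w
    by (intro expansion subsetD[OF radius(2)] that)
qed (fact open_dom radius coeff_pos)+

text \<open>The Fourier coefficient for the orthogonal monomials, whose squared norms are
  \<open>1 / a \<alpha>\<close>; by \<open>has_sum_coef\<close> it is also the Taylor
  coefficient.\<close>

definition coef :: "(complex ^ 'n \<Rightarrow> complex) \<Rightarrow> ('n \<Rightarrow> nat) \<Rightarrow> complex" where
  "coef f \<alpha> = of_real (a \<alpha>) * ip f (monomial_on D \<alpha>)"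

lemma ip_monomial_eq_coef: "ip f (monomial_on D \<alpha>) = coef f \<alpha> / of_real (a \<alpha>)"
  using a_pos[of \<alpha>] by (simp add: coef_def)

lemma partial_sum_mem: "(\<lambda>z. \<Sum>\<alpha>\<in>F. c \<alpha> * monomial_on D \<alpha> z) \<in> H"
  by (intro sum_mem monomial_mem)

lemma hnorm_partial_sum:
  assumes "finite F"
  shows "(hnorm ip (\<lambda>z. \<Sum>\<alpha>\<in>F. c \<alpha> * monomial_on D \<alpha> z))\<^sup>2 = (\<Sum>\<alpha>\<in>F. (cmod (c \<alpha>))\<^sup>2 / a \<alpha>)"
proof -
  have "complex_of_real ((hnorm ip (\<lambda>z. \<Sum>\<alpha>\<in>F. c \<alpha> * monomial_on D \<alpha> z))\<^sup>2) = (\<Sum>\<alpha>\<in>F. c \<alpha> * cnj (c \<alpha>) / a \<alpha>)"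
    unfolding ip_self[OF partial_sum_mem, symmetric] using ip_monomial_combination[OF assms assms] by simp
  also have "\<dots> = of_real (\<Sum>\<alpha>\<in>F. (cmod (c \<alpha>))\<^sup>2 / a \<alpha>)"
    by (simp add: mult_cnj_norm)
  finally show ?thesis by (simp only: of_real_eq_iff)
qed

lemma Bessel_identity:
  assumes "f \<in> H" "finite F"
  shows "(hnorm ip (\<lambda>z. f z - (\<Sum>\<alpha>\<in>F. coef f \<alpha> * monomial_on D \<alpha> z)))\<^sup>2
    = (hnorm ip f)\<^sup>2 - (\<Sum>\<alpha>\<in>F. (cmod (coef f \<alpha>))\<^sup>2 / a \<alpha>)"
proof -
  let ?s = "\<lambda>z. \<Sum>\<alpha>\<in>F. coef f \<alpha> * monomial_on D \<alpha> z"
  have s: "?s \<in> H" by (rule partial_sum_mem)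
  have fs: "ip f ?s = of_real (\<Sum>\<alpha>\<in>F. (cmod (coef f \<alpha>))\<^sup>2 / a \<alpha>)"
    using assms by (subst ip_sum_right)
      (auto simp: monomial_mem ip_monomial_eq_coef mult_cnj_norm mult.commute[of "cnj _"] intro!: sum.cong)
  have "ip (\<lambda>z. f z - ?s z) (\<lambda>z. f z - ?s z) = ip f f - ip f ?s - cnj (ip f ?s) + ip ?s ?s"
    using assms s ip_commute[OF assms(1) s]
    by (simp add: ip_diff ip_diff_right diff_mem)
  then have "complex_of_real ((hnorm ip (\<lambda>z. f z - ?s z))\<^sup>2)
      = of_real ((hnorm ip f)\<^sup>2 - (\<Sum>\<alpha>\<in>F. (cmod (coef f \<alpha>))\<^sup>2 / a \<alpha>))"
    unfolding ip_self[OF diff_mem[OF assms(1) s]] ip_self[OF assms(1)] ip_self[OF s] hnorm_partial_sum[OF assms(2)] fs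
    by simp
  then show ?thesis by (simp only: of_real_eq_iff)
qed

lemma coef_summable:
  assumes "f \<in> H"
  shows "(\<lambda>\<alpha>. (cmod (coef f \<alpha>))\<^sup>2 / a \<alpha>) summable_on UNIV"
proof (intro nonneg_bdd_above_summable_on bdd_aboveI2[where M = "(hnorm ip f)\<^sup>2"])
  fix F assume "F \<in> {F. F \<subseteq> UNIV \<and> finite (F :: ('n \<Rightarrow> nat) set)}"
  then show "(\<Sum>\<alpha>\<in>F. (cmod (coef f \<alpha>))\<^sup>2 / a \<alpha>) \<le> (hnorm ip f)\<^sup>2"
    using Bessel_identity[OF assms, of F] zero_le_power2[of "hnorm ip (\<lambda>z. f z - (\<Sum>\<alpha>\<in>F. coef f \<alpha> * monomial_on D \<alpha> z))"]
    by simp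
qed (use a_pos in \<open>simp add: less_imp_le\<close>)

lemma coef_kernel: "w \<in> D \<Longrightarrow> coef (kernel_fun D k w) \<alpha> = of_real (a \<alpha>) * cnj (multi_power w \<alpha>)"
  using ip_commute[OF monomial_mem kernel_mem] reproducing[OF monomial_mem, of w \<alpha>]
  by (simp add: coef_def zext_def)

text \<open>The expansion at the pair \<open>(w, w)\<close> is Parseval's equality for the kernel
  function at \<open>w\<close>, so Bessel's identity sends the remainders to 0.\<close>

lemma kernel_partial_sums:
  assumes "w \<in> D"
  shows "((\<lambda>F. hnorm ip (\<lambda>z. kernel_fun D k w z - (\<Sum>\<alpha>\<in>F. coef (kernel_fun D k w) \<alpha> * monomial_on D \<alpha> z))) \<longlongrightarrow> 0)
     (finite_subsets_at_top UNIV)"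
proof -
  let ?h = "\<lambda>F z. kernel_fun D k w z - (\<Sum>\<alpha>\<in>F. coef (kernel_fun D k w) \<alpha> * monomial_on D \<alpha> z)"
  have hH: "?h F \<in> H" for F by (intro diff_mem kernel_mem assms partial_sum_mem)
  have kw: "complex_of_real ((hnorm ip (kernel_fun D k w))\<^sup>2) = k w w"
    using ip_self[OF kernel_mem[OF assms]] ip_kernel[OF assms assms] by simp
  have dt: "diag_term a w w = (\<lambda>\<alpha>. of_real (a \<alpha> * (cmod (multi_power w \<alpha>))\<^sup>2))"
    by (simp add: mult_cnj_norm mult.assoc)
  have "((\<lambda>\<alpha>. complex_of_real (a \<alpha> * (cmod (multi_power w \<alpha>))\<^sup>2)) has_sum of_real ((hnorm ip (kernel_fun D k w))\<^sup>2)) UNIV"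
    using expansion[OF assms assms] unfolding kw dt .
  then have hs: "((\<lambda>\<alpha>. a \<alpha> * (cmod (multi_power w \<alpha>))\<^sup>2) has_sum (hnorm ip (kernel_fun D k w))\<^sup>2) UNIV"
    by (simp only: has_sum_of_real_iff)
  have "\<forall>\<^sub>F F in finite_subsets_at_top UNIV. (hnorm ip (kernel_fun D k w))\<^sup>2 - (\<Sum>\<alpha>\<in>F. a \<alpha> * (cmod (multi_power w \<alpha>))\<^sup>2)
      = (hnorm ip (?h F))\<^sup>2"
  proof (rule eventually_finite_subsets_at_top_weakI)
    fix F :: "('n \<Rightarrow> nat) set" assume "finite F"
    moreover have "(cmod (coef (kernel_fun D k w) \<alpha>))\<^sup>2 / a \<alpha> = a \<alpha> * (cmod (multi_power w \<alpha>))\<^sup>2" for \<alpha>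
      using a_pos[of \<alpha>] by (simp add: coef_kernel assms norm_mult power2_eq_square)
    ultimately show "(hnorm ip (kernel_fun D k w))\<^sup>2 - (\<Sum>\<alpha>\<in>F. a \<alpha> * (cmod (multi_power w \<alpha>))\<^sup>2) = (hnorm ip (?h F))\<^sup>2"
      using Bessel_identity[OF kernel_mem[OF assms], of F] by simp
  qed
  moreover have "((\<lambda>F. (hnorm ip (kernel_fun D k w))\<^sup>2 - (\<Sum>\<alpha>\<in>F. a \<alpha> * (cmod (multi_power w \<alpha>))\<^sup>2)) \<longlongrightarrow> 0) (finite_subsets_at_top UNIV)"
    using tendsto_diff[OF tendsto_const hs[unfolded has_sum_def], of "(hnorm ip (kernel_fun D k w))\<^sup>2"] by simp
  ultimately have "((\<lambda>F. (hnorm ip (?h F))\<^sup>2) \<longlongrightarrow> 0) (finite_subsets_at_top UNIV)"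
    by (rule Lim_transform_eventually[rotated])
  then have "((\<lambda>F. sqrt ((hnorm ip (?h F))\<^sup>2)) \<longlongrightarrow> sqrt 0) (finite_subsets_at_top UNIV)"
    by (rule tendsto_real_sqrt)
  then show ?thesis using hnorm_nonneg[OF hH] by simp
qed

text \<open>Pairing \<open>f\<close> with the partial sums of the kernel function at
  \<open>w\<close> gives the partial sums of its Taylor series; by reproduction they converge to
  \<open>f w\<close>.\<close>

lemma has_sum_coef:
  assumes f: "f \<in> H" and w: "w \<in> D"
  shows "((\<lambda>\<alpha>. coef f \<alpha> * multi_power w \<alpha>) has_sum f w) UNIV"
proof -
  let ?s = "\<lambda>F z. \<Sum>\<alpha>\<in>F. coef (kernel_fun D k w) \<alpha> * monomial_on D \<alpha> z"
  have "((\<lambda>F. hnorm ip (\<lambda>z. ?s F z - kernel_fun D k w z)) \<longlongrightarrow> 0) (finite_subsets_at_top UNIV)"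
  proof -
    have "hnorm ip (\<lambda>z. ?s F z - kernel_fun D k w z) = hnorm ip (\<lambda>z. kernel_fun D k w z - ?s F z)" for F
    proof -
      have m: "(\<lambda>z. kernel_fun D k w z - ?s F z) \<in> H" by (intro diff_mem kernel_mem w partial_sum_mem)
      have "ip (\<lambda>z. (-1) * (kernel_fun D k w z - ?s F z)) (\<lambda>z. (-1) * (kernel_fun D k w z - ?s F z))
          = ip (\<lambda>z. kernel_fun D k w z - ?s F z) (\<lambda>z. kernel_fun D k w z - ?s F z)"
        by (simp only: ip_scale[OF m scale_mem[OF m]] ip_scale_right[OF m m]) simp
      then show ?thesis by (simp add: hnorm_def)
    qed
    then show ?thesis using kernel_partial_sums[OF w] by simp
  qed
  from tendsto_cnj[OF tendsto_ip[OF partial_sum_mem kernel_mem[OF w] f this]]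
  have "((\<lambda>F. ip f (?s F)) \<longlongrightarrow> f w) (finite_subsets_at_top UNIV)"
    by (simp only: ip_commute[OF partial_sum_mem f, symmetric] ip_commute[OF kernel_mem[OF w] f, symmetric]
        reproducing[OF f w, symmetric])
  moreover have "ip f (?s F) = (\<Sum>\<alpha>\<in>F. coef f \<alpha> * multi_power w \<alpha>)" for F
    using f by (subst ip_sum_right)
      (auto simp: monomial_mem coef_kernel[OF w] coef_def[of f] mult_ac intro!: sum.cong)
  ultimately show ?thesis by (simp add: has_sum_def)
qed

lemma holomorphic_mem: "f \<in> H \<Longrightarrow> holomorphic_Cn D f"
  using power_series_holomorphic[OF open_D has_sum_coef] by blast

lemma coef_unique:
  assumes "f \<in> H" "\<And>w. w \<in> ball 0 r \<Longrightarrow> ((\<lambda>\<alpha>. c \<alpha> * multi_power w \<alpha>) has_sum f w) UNIV"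
  shows "coef f = c"
  using r_pos has_sum_coef[OF assms(1) subsetD[OF ball_D]] assms(2) by (rule power_series_unique)

text \<open>By orthogonality the squared distance of two box sums is a difference of partial sums of
  the given numerical series.\<close>

lemma Riesz_Fischer:
  assumes "(\<lambda>\<alpha>. (cmod (c \<alpha>))\<^sup>2 / a \<alpha>) summable_on UNIV"
  shows "\<exists>g\<in>H. (\<lambda>n. hnorm ip (\<lambda>z. (\<Sum>\<alpha>\<in>index_box n. c \<alpha> * monomial_on D \<alpha> z) - g z)) \<longlonglongrightarrow> 0"
proof (rule complete)
  let ?t = "\<lambda>n. \<Sum>\<alpha>\<in>index_box n. (cmod (c \<alpha>))\<^sup>2 / a \<alpha>"
  let ?s = "\<lambda>n z. \<Sum>\<alpha>\<in>index_box n. c \<alpha> * monomial_on D \<alpha> z"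
  show "?s n \<in> H" for n by (rule partial_sum_mem)
  have le: "(hnorm ip (\<lambda>z. ?s m z - ?s n z))\<^sup>2 \<le> \<bar>?t m - ?t n\<bar>" for m n
  proof -
    have *: "(hnorm ip (\<lambda>z. ?s m z - ?s n z))\<^sup>2 = ?t m - ?t n"
            "(hnorm ip (\<lambda>z. ?s n z - ?s m z))\<^sup>2 = ?t m - ?t n" if "n \<le> m" for m n
    proof -
      have sub: "index_box n \<subseteq> (index_box m :: ('n \<Rightarrow> nat) set)" using index_box_mono[OF that] .
      have d: "?s m z - ?s n z = (\<Sum>\<alpha>\<in>index_box m - index_box n. c \<alpha> * monomial_on D \<alpha> z)"
              "?s n z - ?s m z = (\<Sum>\<alpha>\<in>index_box m - index_box n. (- c \<alpha>) * monomial_on D \<alpha> z)" for z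
        using sum_diff[OF finite_index_box sub, of "\<lambda>\<alpha>. c \<alpha> * monomial_on D \<alpha> z"] by (simp_all add: sum_negf)
      have fin: "finite (index_box m - index_box n :: ('n \<Rightarrow> nat) set)" using finite_index_box by blast
      show "(hnorm ip (\<lambda>z. ?s m z - ?s n z))\<^sup>2 = ?t m - ?t n"
        unfolding d hnorm_partial_sum[OF fin] using sum_diff[OF finite_index_box sub] by simp
      show "(hnorm ip (\<lambda>z. ?s n z - ?s m z))\<^sup>2 = ?t m - ?t n"
        unfolding d hnorm_partial_sum[OF fin] norm_minus_cancel using sum_diff[OF finite_index_box sub] by simp
    qed
    show ?thesis using *(1)[of n m] *(2)[of m n] by (cases "n \<le> m") auto
  qed
  fix e :: real assume "e > 0"
  have "Cauchy ?t"
    using has_sum_index_box[OF has_sum_infsum[OF assms]] LIMSEQ_imp_Cauchy by blast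
  then obtain N where N: "\<And>m n. m \<ge> N \<Longrightarrow> n \<ge> N \<Longrightarrow> \<bar>?t m - ?t n\<bar> < e\<^sup>2"
    using CauchyD[OF _ zero_less_power[OF \<open>e > 0\<close>], of ?t 2] unfolding real_norm_def by blast
  have "hnorm ip (\<lambda>z. ?s m z - ?s n z) < e" if "m \<ge> N" "n \<ge> N" for m n
    using le[of m n] N[OF that] \<open>e > 0\<close> by (intro power2_less_imp_less[of _ e]) auto
  then show "\<exists>N. \<forall>m\<ge>N. \<forall>n\<ge>N. hnorm ip (\<lambda>z. ?s m z - ?s n z) < e" by blast
qed

lemma Riesz_Fischer_limit:
  assumes "g \<in> H" "(\<lambda>n. hnorm ip (\<lambda>z. (\<Sum>\<alpha>\<in>index_box n. c \<alpha> * monomial_on D \<alpha> z) - g z)) \<longlonglongrightarrow> 0"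
    and "w \<in> D" "((\<lambda>\<alpha>. c \<alpha> * multi_power w \<alpha>) has_sum s) UNIV"
  shows "g w = s"
proof -
  have "(\<lambda>n. \<Sum>\<alpha>\<in>index_box n. c \<alpha> * monomial_on D \<alpha> w) \<longlonglongrightarrow> g w"
    by (rule tendsto_pointwise[OF partial_sum_mem assms(1,2)])
  then show ?thesis
    using LIMSEQ_unique has_sum_index_box[OF assms(4)] assms(3) by (simp add: zext_def) blast
qed

lemma power_series_mem:
  assumes "(\<lambda>\<alpha>. (cmod (c \<alpha>))\<^sup>2 / a \<alpha>) summable_on UNIV"
    and "\<And>w. w \<in> D \<Longrightarrow> ((\<lambda>\<alpha>. c \<alpha> * multi_power w \<alpha>) has_sum f w) UNIV"
  shows "zext D f \<in> H"
proof -
  obtain g where g: "g \<in> H" "(\<lambda>n. hnorm ip (\<lambda>z. (\<Sum>\<alpha>\<in>index_box n. c \<alpha> * monomial_on D \<alpha> z) - g z)) \<longlonglongrightarrow> 0"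
    using Riesz_Fischer[OF assms(1)] by blast
  have "g = zext D f"
    using Riesz_Fischer_limit[OF g _ assms(2)] vanish_off[OF g(1)] by (auto simp: zext_def)
  then show ?thesis using g(1) by simp
qed

text \<open>The monomials span a dense subspace, so a bounded functional may be applied term by term
  to the Taylor series.\<close>

lemma functional_has_sum:
  assumes add: "\<And>f g. f \<in> H \<Longrightarrow> g \<in> H \<Longrightarrow> \<Lambda> (\<lambda>z. f z + g z) = \<Lambda> f + \<Lambda> g"
    and scale: "\<And>f c. f \<in> H \<Longrightarrow> \<Lambda> (\<lambda>z. c * f z) = c * \<Lambda> f"
    and bound: "\<And>f. f \<in> H \<Longrightarrow> cmod (\<Lambda> f) \<le> C * hnorm ip f"
    and f: "f \<in> H"
  shows "((\<lambda>\<alpha>. coef f \<alpha> * \<Lambda> (monomial_on D \<alpha>)) has_sum \<Lambda> f) UNIV"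
proof -
  let ?s = "\<lambda>F z. \<Sum>\<alpha>\<in>F. coef f \<alpha> * monomial_on D \<alpha> z"
  let ?h = "\<lambda>F z. f z - ?s F z"
  have h: "?h F \<in> H" for F by (intro diff_mem f partial_sum_mem)
  have \<Lambda>0: "\<Lambda> (\<lambda>_. 0) = 0" using scale[OF zero_mem, of 0] by simp
  have \<Lambda>s: "\<Lambda> (?s F) = (\<Sum>\<alpha>\<in>F. coef f \<alpha> * \<Lambda> (monomial_on D \<alpha>))" for F
  proof (induction F rule: infinite_finite_induct)
    case (insert \<alpha> F)
    then show ?case
      using add[OF scale_mem[OF monomial_mem, of "coef f \<alpha>" \<alpha>] partial_sum_mem[of "coef f" F]]
        scale[OF monomial_mem, of "coef f \<alpha>" \<alpha>] by simp
  qed (simp_all add: \<Lambda>0)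
  have \<Lambda>h: "\<Lambda> (?h F) = \<Lambda> f - \<Lambda> (?s F)" for F
    using add[OF f scale_mem[OF partial_sum_mem, of "-1" "coef f" F]] scale[OF partial_sum_mem, of "-1" "coef f" F]
    by simp
  obtain g where g: "g \<in> H" "(\<lambda>n. hnorm ip (\<lambda>z. ?s (index_box n) z - g z)) \<longlonglongrightarrow> 0"
    using Riesz_Fischer[OF coef_summable[OF f]] by blast
  \<comment> \<open>Norm convergence implies pointwise convergence, and pointwise the series sums to
    \<open>f\<close>.\<close>
  have "g = f"
    using Riesz_Fischer_limit[OF g _ has_sum_coef[OF f]] vanish_off[OF f] vanish_off[OF g(1)] by (metis ext)
  with g(2) have lim: "(\<lambda>n. hnorm ip (\<lambda>z. ?s (index_box n) z - f z)) \<longlonglongrightarrow> 0" by simp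
  have sym: "hnorm ip (\<lambda>z. ?s F z - f z) = hnorm ip (?h F)" for F
  proof -
    have "ip (\<lambda>z. (-1) * ?h F z) (\<lambda>z. (-1) * ?h F z) = ip (?h F) (?h F)"
      by (simp only: ip_scale[OF h scale_mem[OF h]] ip_scale_right[OF h h]) simp
    then show ?thesis by (simp add: hnorm_def)
  qed
  have C: "cmod (\<Lambda> q) \<le> \<bar>C\<bar> * hnorm ip q" if "q \<in> H" for q
    using bound[OF that] mult_right_mono[OF abs_ge_self[of C] hnorm_nonneg[OF that]] by linarith
  show ?thesis
    unfolding has_sum_def
  proof (rule tendstoI)
    fix e :: real assume e: "e > 0"
    have "(\<lambda>n. \<bar>C\<bar> * hnorm ip (?h (index_box n))) \<longlonglongrightarrow> 0"
      using tendsto_mult_right_zero[OF lim] by (simp add: sym)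
    from order_tendstoD(2)[OF this e] obtain n where n: "\<bar>C\<bar> * hnorm ip (?h (index_box n)) < e"
      unfolding eventually_sequentially by blast
    have "dist (\<Sum>\<alpha>\<in>F. coef f \<alpha> * \<Lambda> (monomial_on D \<alpha>)) (\<Lambda> f) < e" if F: "finite F" "index_box n \<subseteq> F" for F
    proof -
      \<comment> \<open>By Bessel's identity remainders get smaller as \<open>F\<close> grows, which
        extends the limit from boxes to all finite sets.\<close>
      have "(\<Sum>\<alpha>\<in>index_box n. (cmod (coef f \<alpha>))\<^sup>2 / a \<alpha>) \<le> (\<Sum>\<alpha>\<in>F. (cmod (coef f \<alpha>))\<^sup>2 / a \<alpha>)"
        using F a_pos by (intro sum_mono2) (auto simp: less_imp_le)
      then have "(hnorm ip (?h F))\<^sup>2 \<le> (hnorm ip (?h (index_box n)))\<^sup>2"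
        using Bessel_identity[OF f F(1)] Bessel_identity[OF f finite_index_box, of n] by linarith
      then have "hnorm ip (?h F) \<le> hnorm ip (?h (index_box n))"
        using hnorm_nonneg[OF h] power2_le_imp_le by blast
      then have "\<bar>C\<bar> * hnorm ip (?h F) < e" using n mult_left_mono[of _ _ "\<bar>C\<bar>"] by (meson abs_ge_zero le_less_trans)
      then show ?thesis
        using C[OF h, of F] \<Lambda>h[of F] \<Lambda>s[of F] by (simp add: dist_norm norm_minus_commute)
    qed
    then show "\<forall>\<^sub>F F in finite_subsets_at_top UNIV. dist (\<Sum>\<alpha>\<in>F. coef f \<alpha> * \<Lambda> (monomial_on D \<alpha>)) (\<Lambda> f) < e"
      unfolding eventually_finite_subsets_at_top using finite_index_box by blast
  qed
qed

end

section \<open>Multiplicativity on monomials\<close>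

definition unit_index :: "'n \<Rightarrow> 'n \<Rightarrow> nat" where
  "unit_index i = (\<lambda>j. if j = i then 1 else 0)"

lemma multi_power_unit: "multi_power z (unit_index i) = z $ i"
  by (simp add: multi_power_def unit_index_def if_distrib[of "(^) _"] cong: if_cong)

lemma unit_index_nonzero: "unit_index i \<noteq> (\<lambda>_. 0)"
  by (auto simp: unit_index_def fun_eq_iff)

lemma unit_index_le_nonzero: "unit_index i \<le> \<gamma> \<Longrightarrow> \<gamma> \<noteq> (\<lambda>_. 0)"
  by (auto simp: unit_index_def le_fun_def dest: spec[of _ i])

lemma exists_unit_index_le:
  assumes "\<gamma> \<noteq> (\<lambda>_. 0)"
  shows "\<exists>i. unit_index i \<le> \<gamma>"
proof -
  obtain i where "\<gamma> i \<noteq> 0" using assms by auto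
  then have "unit_index i \<le> \<gamma>" by (auto simp: unit_index_def le_fun_def)
  then show ?thesis by blast
qed

lemma sum_multi_index_less:
  fixes \<beta> \<gamma> :: "'n::finite \<Rightarrow> nat"
  assumes "\<beta> \<le> \<gamma>" "\<beta> \<noteq> \<gamma>"
  shows "sum \<beta> UNIV < sum \<gamma> UNIV"
proof -
  obtain i where "\<beta> i \<noteq> \<gamma> i" using assms(2) by auto
  then have "\<beta> i < \<gamma> i" using assms(1) by (simp add: le_fun_def order_less_le)
  then show ?thesis using assms(1) by (intro sum_strict_mono_ex1) (auto simp: le_fun_def)
qed

lemma multi_index_induct [case_names less]:
  fixes \<gamma> :: "'n::finite \<Rightarrow> nat"
  assumes "\<And>\<gamma>. (\<And>\<beta>. \<beta> \<le> \<gamma> \<Longrightarrow> \<beta> \<noteq> \<gamma> \<Longrightarrow> P \<beta>) \<Longrightarrow> P \<gamma>"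
  shows "P \<gamma>"
proof (induction \<gamma> rule: measure_induct_rule[where f = "\<lambda>\<gamma>. sum \<gamma> UNIV"])
  case (less \<gamma>)
  show ?case by (rule assms) (rule less[OF sum_multi_index_less])
qed

text \<open>Index 0 is the normalization and a unit index is the definition of \<mu>, so the
  inductive step is asked only strictly above a unit index. This is where the coefficient relations
  are nondegenerate.\<close>

lemma multi_power_from_step:
  fixes \<gamma> :: "'n::finite \<Rightarrow> nat"
  assumes "l (\<lambda>_. 0) = 1" "\<And>i. l (unit_index i) = \<mu> $ i"
    and step: "\<And>\<gamma> i. (\<And>\<beta>. \<beta> \<le> \<gamma> \<Longrightarrow> \<beta> \<noteq> \<gamma> \<Longrightarrow> l \<beta> = multi_power \<mu> \<beta>) \<Longrightarrow> unit_index i \<le> \<gamma> \<Longrightarrow> unit_index i \<noteq> \<gamma>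
      \<Longrightarrow> l \<gamma> = multi_power \<mu> \<gamma>"
  shows "l \<gamma> = multi_power \<mu> \<gamma>"
proof (induction \<gamma> rule: multi_index_induct)
  case (less \<gamma>)
  show ?case
  proof (cases "\<gamma> = (\<lambda>_. 0)")
    case False
    then obtain i where i: "unit_index i \<le> \<gamma>" using exists_unit_index_le by blast
    show ?thesis
    proof (cases "unit_index i = \<gamma>")
      case True
      then show ?thesis using assms(2) multi_power_unit by metis
    next
      case False
      show ?thesis by (rule step[OF less.IH i False])
    qed
  qed (simp add: assms(1) multi_power_0)
qed

lemma diff_neq_index:
  fixes \<beta> \<gamma> :: "'n \<Rightarrow> nat"
  assumes "\<beta> \<le> \<gamma>" "\<beta> \<noteq> (\<lambda>_. 0)"
  shows "\<gamma> - \<beta> \<le> \<gamma>" "\<gamma> - \<beta> \<noteq> \<gamma>"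
proof -
  show "\<gamma> - \<beta> \<le> \<gamma>" by (auto simp: le_fun_def)
  obtain i where "\<beta> i \<noteq> 0" using assms(2) by auto
  moreover have "\<beta> i \<le> \<gamma> i" using assms(1) by (simp add: le_fun_def)
  ultimately have "(\<gamma> - \<beta>) i \<noteq> \<gamma> i" by simp
  then show "\<gamma> - \<beta> \<noteq> \<gamma>" by metis
qed

lemma diff_zero_index: "\<gamma> - (\<lambda>_. 0) = (\<gamma> :: 'n \<Rightarrow> nat)"
  by (simp add: fun_eq_iff)

lemma diff_self_index: "\<gamma> - \<gamma> = (\<lambda>_. 0 :: nat)"
  by (simp add: fun_eq_iff)

text \<open>In the difference of both sides the extreme terms cancel since \<open>l\<close> is 1 at
  index 0. By induction every other term is a positive multiple of
  \<open>l \<gamma> - multi_power \<mu> \<gamma>\<close>, and the unit index below \<gamma> provides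
  at least one such term.\<close>

lemma multi_power_of_square_relation:
  fixes a :: "('n::finite \<Rightarrow> nat) \<Rightarrow> real" and l :: "('n \<Rightarrow> nat) \<Rightarrow> complex"
  assumes a: "\<And>\<alpha>. a \<alpha> > 0" and l0: "l (\<lambda>_. 0) = 1" and l1: "\<And>i. l (unit_index i) = \<mu> $ i"
    and rel: "\<And>\<gamma>. conv (\<lambda>\<alpha>. of_real (a \<alpha>)) (\<lambda>\<alpha>. of_real (a \<alpha>)) \<gamma> * l \<gamma>
        = conv (\<lambda>\<alpha>. of_real (a \<alpha>) * l \<alpha>) (\<lambda>\<alpha>. of_real (a \<alpha>) * l \<alpha>) \<gamma>"
  shows "l \<gamma> = multi_power \<mu> \<gamma>"
  using l0 l1
proof (rule multi_power_from_step)
  fix \<gamma> i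
  assume IH: "\<And>\<beta>. \<beta> \<le> \<gamma> \<Longrightarrow> \<beta> \<noteq> \<gamma> \<Longrightarrow> l \<beta> = multi_power \<mu> \<beta>"
    and i: "unit_index i \<le> \<gamma>" "unit_index i \<noteq> \<gamma>"
  define M where "M = {\<beta>. \<beta> \<le> \<gamma>} - {\<lambda>_. 0, \<gamma>}"
  have fin: "finite M" unfolding M_def using finite_le_multi_index by blast
  have "0 = (\<Sum>\<beta>\<in>{\<beta>. \<beta> \<le> \<gamma>}. of_real (a \<beta> * a (\<gamma> - \<beta>)) * (l \<gamma> - l \<beta> * l (\<gamma> - \<beta>)))"
    using rel[of \<gamma>] by (simp add: conv_def sum_distrib_left sum_subtractf algebra_simps)
  also have "\<dots> = (\<Sum>\<beta>\<in>M. of_real (a \<beta> * a (\<gamma> - \<beta>)) * (l \<gamma> - l \<beta> * l (\<gamma> - \<beta>)))"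
    unfolding M_def using finite_le_multi_index l0
    by (intro sum.mono_neutral_right) (auto simp: diff_zero_index diff_self_index)
  also have "\<dots> = (\<Sum>\<beta>\<in>M. of_real (a \<beta> * a (\<gamma> - \<beta>)) * (l \<gamma> - multi_power \<mu> \<gamma>))"
  proof (rule sum.cong[OF refl])
    fix \<beta> assume "\<beta> \<in> M"
    then have "\<beta> \<le> \<gamma>" "\<beta> \<noteq> (\<lambda>_. 0)" "\<beta> \<noteq> \<gamma>" by (auto simp: M_def)
    then have "l \<beta> * l (\<gamma> - \<beta>) = multi_power \<mu> \<gamma>"
      using IH diff_neq_index multi_power_diff by metis
    then show "of_real (a \<beta> * a (\<gamma> - \<beta>)) * (l \<gamma> - l \<beta> * l (\<gamma> - \<beta>)) = of_real (a \<beta> * a (\<gamma> - \<beta>)) * (l \<gamma> - multi_power \<mu> \<gamma>)"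
      by simp
  qed
  also have "\<dots> = of_real (\<Sum>\<beta>\<in>M. a \<beta> * a (\<gamma> - \<beta>)) * (l \<gamma> - multi_power \<mu> \<gamma>)"
    by (simp add: sum_distrib_right)
  finally have 0: "of_real (\<Sum>\<beta>\<in>M. a \<beta> * a (\<gamma> - \<beta>)) * (l \<gamma> - multi_power \<mu> \<gamma>) = 0" ..
  have "(\<Sum>\<beta>\<in>M. a \<beta> * a (\<gamma> - \<beta>)) > 0"
  proof (rule sum_pos[OF fin])
    have "unit_index i \<in> M" using i unit_index_nonzero by (simp add: M_def)
    then show "M \<noteq> {}" by blast
  qed (simp add: a)
  then have "complex_of_real (\<Sum>\<beta>\<in>M. a \<beta> * a (\<gamma> - \<beta>)) \<noteq> 0"
    by (simp only: of_real_eq_0_iff)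
  then show "l \<gamma> = multi_power \<mu> \<gamma>" using 0 by (simp only: mult_eq_0_iff right_minus_eq simp_thms)
qed

lemma conv_split:
  fixes \<gamma> :: "'n::finite \<Rightarrow> nat"
  assumes "\<gamma> \<noteq> (\<lambda>_. 0)"
  shows "conv f g \<gamma> = f (\<lambda>_. 0) * g \<gamma> + f \<gamma> * g (\<lambda>_. 0) + (\<Sum>\<beta>\<in>{\<beta>. \<beta> \<le> \<gamma>} - {\<lambda>_. 0, \<gamma>}. f \<beta> * g (\<gamma> - \<beta>))"
proof -
  have "{\<beta>. \<beta> \<le> \<gamma>} = insert (\<lambda>_. 0) (insert \<gamma> ({\<beta>. \<beta> \<le> \<gamma>} - {\<lambda>_. 0, \<gamma>}))"
    by (auto simp: le_fun_def)
  then have "conv f g \<gamma> = (\<Sum>\<beta>\<in>insert (\<lambda>_. 0) (insert \<gamma> ({\<beta>. \<beta> \<le> \<gamma>} - {\<lambda>_. 0, \<gamma>})). f \<beta> * g (\<gamma> - \<beta>))"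
    by (simp only: conv_def)
  also have "\<dots> = f (\<lambda>_. 0) * g \<gamma> + f \<gamma> * g (\<lambda>_. 0) + (\<Sum>\<beta>\<in>{\<beta>. \<beta> \<le> \<gamma>} - {\<lambda>_. 0, \<gamma>}. f \<beta> * g (\<gamma> - \<beta>))"
    using assms finite_le_multi_index[of \<gamma>] by (simp add: diff_zero_index diff_self_index add.assoc)
  finally show ?thesis .
qed

lemma conv_zero:
  fixes f :: "('n::finite \<Rightarrow> nat) \<Rightarrow> 'a::semiring_0"
  shows "conv f g (\<lambda>_. 0) = f (\<lambda>_. 0) * g (\<lambda>_. 0)"
proof -
  have "{\<beta>. \<beta> \<le> (\<lambda>_::'n. 0 :: nat)} = {\<lambda>_. 0}" by (auto simp: le_fun_def)
  then show ?thesis by (simp add: conv_def diff_self_index)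
qed

text \<open>
  The coefficient of degree \<open>\<gamma>\<close> of the product of the series weighted by \<open>l\<close>: only those products in which a
  single factor contributes all of \<open>\<gamma>\<close> see \<open>l \<gamma>\<close>; the rest is determined by lower degrees.
\<close>

lemma product_coefficients:
  fixes A :: "('n::finite \<Rightarrow> nat) \<Rightarrow> complex" and C :: "'p \<Rightarrow> ('n \<Rightarrow> nat) \<Rightarrow> complex"
  assumes A0: "A (\<lambda>_. 0) = 1" and C0: "\<And>j. C j (\<lambda>_. 0) = 1" and l0: "l (\<lambda>_. 0) = 1"
    and Al: "\<And>w. w \<in> B \<Longrightarrow> ((\<lambda>\<gamma>. A \<gamma> * l \<gamma> * cnj (multi_power w \<gamma>)) has_sum P w) UNIV"
    and Cl: "\<And>j w. w \<in> B \<Longrightarrow> ((\<lambda>\<gamma>. C j \<gamma> * l \<gamma> * cnj (multi_power w \<gamma>)) has_sum Q j w) UNIV"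
    and Az: "\<And>z w. z \<in> B \<Longrightarrow> w \<in> B \<Longrightarrow> ((\<lambda>\<gamma>. A \<gamma> * multi_power z \<gamma> * cnj (multi_power w \<gamma>)) has_sum P' z w) UNIV"
    and Cz: "\<And>j z w. z \<in> B \<Longrightarrow> w \<in> B \<Longrightarrow> ((\<lambda>\<gamma>. C j \<gamma> * multi_power z \<gamma> * cnj (multi_power w \<gamma>)) has_sum Q' j z w) UNIV"
    and "finite J"
  shows "\<exists>U V. U (\<lambda>_. 0) = 1 \<and> V (\<lambda>_. 0) = 1 \<and>
      (\<forall>w\<in>B. ((\<lambda>\<gamma>. U \<gamma> * cnj (multi_power w \<gamma>)) has_sum (P w * (\<Prod>j\<in>J. Q j w))) UNIV) \<and>
      (\<forall>z\<in>B. \<forall>w\<in>B. ((\<lambda>\<gamma>. V \<gamma> * multi_power z \<gamma> * cnj (multi_power w \<gamma>)) has_sum (P' z w * (\<Prod>j\<in>J. Q' j z w))) UNIV) \<and>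
      (\<forall>\<gamma> \<mu>. (\<forall>\<beta>. \<beta> \<le> \<gamma> \<longrightarrow> \<beta> \<noteq> \<gamma> \<longrightarrow> l \<beta> = multi_power \<mu> \<beta>) \<longrightarrow>
         U \<gamma> = V \<gamma> * multi_power \<mu> \<gamma> + (l \<gamma> - multi_power \<mu> \<gamma>) * (A \<gamma> + (\<Sum>j\<in>J. C j \<gamma>)))"
  using \<open>finite J\<close>
proof (induction J rule: finite_induct)
  case empty
  show ?case
    by (rule exI[of _ "\<lambda>\<gamma>. A \<gamma> * l \<gamma>"], rule exI[of _ A])
      (use A0 l0 Al Az in \<open>auto simp: algebra_simps\<close>)
next
  case (insert j J)
  then obtain U V where U0: "U (\<lambda>_. 0) = 1" and V0: "V (\<lambda>_. 0) = 1"
    and Us: "\<And>w. w \<in> B \<Longrightarrow> ((\<lambda>\<gamma>. U \<gamma> * cnj (multi_power w \<gamma>)) has_sum (P w * (\<Prod>j\<in>J. Q j w))) UNIV"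
    and Vs: "\<And>z w. z \<in> B \<Longrightarrow> w \<in> B \<Longrightarrow>
        ((\<lambda>\<gamma>. V \<gamma> * multi_power z \<gamma> * cnj (multi_power w \<gamma>)) has_sum (P' z w * (\<Prod>j\<in>J. Q' j z w))) UNIV"
    and UV: "\<And>\<gamma> \<mu>. (\<And>\<beta>. \<beta> \<le> \<gamma> \<Longrightarrow> \<beta> \<noteq> \<gamma> \<Longrightarrow> l \<beta> = multi_power \<mu> \<beta>) \<Longrightarrow>
         U \<gamma> = V \<gamma> * multi_power \<mu> \<gamma> + (l \<gamma> - multi_power \<mu> \<gamma>) * (A \<gamma> + (\<Sum>j\<in>J. C j \<gamma>))"
    by blast
  define U' where "U' = conv U (\<lambda>\<gamma>. C j \<gamma> * l \<gamma>)"
  define V' where "V' = conv V (C j)"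
  have "U' (\<lambda>_. 0) = 1" "V' (\<lambda>_. 0) = 1"
    unfolding U'_def V'_def conv_zero by (simp_all add: U0 V0 C0 l0)
  moreover have "((\<lambda>\<gamma>. U' \<gamma> * cnj (multi_power w \<gamma>)) has_sum (P w * (\<Prod>j\<in>insert j J. Q j w))) UNIV" if "w \<in> B" for w
    using has_sum_conv_cnj[OF Us[OF that] Cl[OF that, of j]] insert.hyps
    by (simp add: U'_def mult_ac)
  moreover have "((\<lambda>\<gamma>. V' \<gamma> * multi_power z \<gamma> * cnj (multi_power w \<gamma>)) has_sum (P' z w * (\<Prod>j\<in>insert j J. Q' j z w))) UNIV"
    if "z \<in> B" "w \<in> B" for z w
    using has_sum_conv_diag[OF Vs[OF that] Cz[OF that, of j]] insert.hyps
    by (simp add: V'_def mult_ac)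
  moreover have "U' \<gamma> = V' \<gamma> * multi_power \<mu> \<gamma> + (l \<gamma> - multi_power \<mu> \<gamma>) * (A \<gamma> + (\<Sum>j\<in>insert j J. C j \<gamma>))"
    if IH: "\<And>\<beta>. \<beta> \<le> \<gamma> \<Longrightarrow> \<beta> \<noteq> \<gamma> \<Longrightarrow> l \<beta> = multi_power \<mu> \<beta>" for \<gamma> \<mu>
  proof (cases "\<gamma> = (\<lambda>_. 0)")
    case True
    then show ?thesis
      unfolding U'_def V'_def by (simp add: conv_zero U0 V0 C0 l0 multi_power_0)
  next
    case False
    let ?M = "{\<beta>. \<beta> \<le> \<gamma>} - {\<lambda>_. 0, \<gamma>}"
    have "(\<Sum>\<beta>\<in>?M. U \<beta> * (C j (\<gamma> - \<beta>) * l (\<gamma> - \<beta>))) = (\<Sum>\<beta>\<in>?M. V \<beta> * C j (\<gamma> - \<beta>)) * multi_power \<mu> \<gamma>"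
      unfolding sum_distrib_right
    proof (rule sum.cong[OF refl])
      fix \<beta> assume "\<beta> \<in> ?M"
      then have \<beta>: "\<beta> \<le> \<gamma>" "\<beta> \<noteq> (\<lambda>_. 0)" "\<beta> \<noteq> \<gamma>" by auto
      \<comment> \<open>Below \<gamma> the correction term in \<open>UV\<close> vanishes.\<close>
      have "l \<beta>' = multi_power \<mu> \<beta>'" if "\<beta>' \<le> \<beta>" for \<beta>'
        using IH[of \<beta>'] that \<beta> by (metis order_antisym order_trans)
      then have "U \<beta> = V \<beta> * multi_power \<mu> \<beta>" using UV[of \<beta> \<mu>] by simp
      moreover have "l (\<gamma> - \<beta>) = multi_power \<mu> (\<gamma> - \<beta>)" using IH diff_neq_index[OF \<beta>(1,2)] by blast
      ultimately show "U \<beta> * (C j (\<gamma> - \<beta>) * l (\<gamma> - \<beta>)) = V \<beta> * C j (\<gamma> - \<beta>) * multi_power \<mu> \<gamma>"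
        using multi_power_diff[OF \<beta>(1), of \<mu>] by (simp add: mult_ac)
    qed
    then show ?thesis
      unfolding U'_def V'_def conv_split[OF False] using UV[OF IH] insert.hyps
      by (simp add: U0 V0 C0 l0 algebra_simps)
  qed
  ultimately show ?case by blast
qed

text \<open>Both products are identically 1, so \<open>U\<close> and \<open>V\<close> vanish at
  every nonzero index. What remains of the formula in \<open>product_coefficients\<close> is a
  product with the nonzero factor from \<open>ne\<close>.\<close>

lemma multi_power_of_product_relation:
  fixes A :: "('n::finite \<Rightarrow> nat) \<Rightarrow> complex" and C :: "'p::finite \<Rightarrow> ('n \<Rightarrow> nat) \<Rightarrow> complex"
  assumes A0: "A (\<lambda>_. 0) = 1" and C0: "\<And>j. C j (\<lambda>_. 0) = 1" and l0: "l (\<lambda>_. 0) = 1"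
    and l1: "\<And>i. l (unit_index i) = \<mu> $ i" and d: "d > 0"
    and Al: "\<And>w. w \<in> ball 0 d \<Longrightarrow> ((\<lambda>\<gamma>. A \<gamma> * l \<gamma> * cnj (multi_power w \<gamma>)) has_sum P w) UNIV"
    and Cl: "\<And>j w. w \<in> ball 0 d \<Longrightarrow> ((\<lambda>\<gamma>. C j \<gamma> * l \<gamma> * cnj (multi_power w \<gamma>)) has_sum Q j w) UNIV"
    and Az: "\<And>z w. z \<in> ball 0 d \<Longrightarrow> w \<in> ball 0 d \<Longrightarrow> ((\<lambda>\<gamma>. A \<gamma> * multi_power z \<gamma> * cnj (multi_power w \<gamma>)) has_sum P' z w) UNIV"
    and Cz: "\<And>j z w. z \<in> ball 0 d \<Longrightarrow> w \<in> ball 0 d \<Longrightarrow> ((\<lambda>\<gamma>. C j \<gamma> * multi_power z \<gamma> * cnj (multi_power w \<gamma>)) has_sum Q' j z w) UNIV"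
    and PQ: "\<And>w. w \<in> ball 0 d \<Longrightarrow> P w * (\<Prod>j\<in>UNIV. Q j w) = 1"
    and PQ': "\<And>z w. z \<in> ball 0 d \<Longrightarrow> w \<in> ball 0 d \<Longrightarrow> P' z w * (\<Prod>j\<in>UNIV. Q' j z w) = 1"
    and ne: "\<And>\<gamma> i. unit_index i \<le> \<gamma> \<Longrightarrow> unit_index i \<noteq> \<gamma> \<Longrightarrow> A \<gamma> + (\<Sum>j\<in>UNIV. C j \<gamma>) \<noteq> 0"
  shows "l \<gamma> = multi_power \<mu> \<gamma>"
proof -
  have "\<exists>U V. U (\<lambda>_. 0) = 1 \<and> V (\<lambda>_. 0) = 1 \<and>
      (\<forall>w\<in>ball 0 d. ((\<lambda>\<gamma>. U \<gamma> * cnj (multi_power w \<gamma>)) has_sum (P w * (\<Prod>j\<in>UNIV. Q j w))) UNIV) \<and>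
      (\<forall>z\<in>ball 0 d. \<forall>w\<in>ball 0 d. ((\<lambda>\<gamma>. V \<gamma> * multi_power z \<gamma> * cnj (multi_power w \<gamma>)) has_sum (P' z w * (\<Prod>j\<in>UNIV. Q' j z w))) UNIV) \<and>
      (\<forall>\<gamma> \<mu>. (\<forall>\<beta>. \<beta> \<le> \<gamma> \<longrightarrow> \<beta> \<noteq> \<gamma> \<longrightarrow> l \<beta> = multi_power \<mu> \<beta>) \<longrightarrow>
         U \<gamma> = V \<gamma> * multi_power \<mu> \<gamma> + (l \<gamma> - multi_power \<mu> \<gamma>) * (A \<gamma> + (\<Sum>j\<in>UNIV. C j \<gamma>)))"
    using A0 C0 l0 Al Cl Az Cz finite by (rule product_coefficients)
  then obtain U V where
    Us': "\<forall>w\<in>ball 0 d. ((\<lambda>\<gamma>. U \<gamma> * cnj (multi_power w \<gamma>)) has_sum (P w * (\<Prod>j\<in>UNIV. Q j w))) UNIV"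
    and Vs': "\<forall>z\<in>ball 0 d. \<forall>w\<in>ball 0 d.
        ((\<lambda>\<gamma>. V \<gamma> * multi_power z \<gamma> * cnj (multi_power w \<gamma>)) has_sum (P' z w * (\<Prod>j\<in>UNIV. Q' j z w))) UNIV"
    and UV': "\<forall>\<gamma> \<mu>. (\<forall>\<beta>. \<beta> \<le> \<gamma> \<longrightarrow> \<beta> \<noteq> \<gamma> \<longrightarrow> l \<beta> = multi_power \<mu> \<beta>) \<longrightarrow>
         U \<gamma> = V \<gamma> * multi_power \<mu> \<gamma> + (l \<gamma> - multi_power \<mu> \<gamma>) * (A \<gamma> + (\<Sum>j\<in>UNIV. C j \<gamma>))"
    by (elim exE conjE)
  have Us: "((\<lambda>\<gamma>. U \<gamma> * cnj (multi_power w \<gamma>)) has_sum 1) UNIV" if "w \<in> ball 0 d" for w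
    using Us'[rule_format, OF that] unfolding PQ[OF that] .
  have Vs: "((\<lambda>\<gamma>. V \<gamma> * multi_power z \<gamma> * cnj (multi_power w \<gamma>)) has_sum 1) UNIV"
    if "z \<in> ball 0 d" "w \<in> ball 0 d" for z w
    using Vs'[rule_format, OF that] unfolding PQ'[OF that] .
  let ?\<delta> = "\<lambda>\<gamma>::'n \<Rightarrow> nat. if \<gamma> = (\<lambda>_. 0) then 1 else 0 :: complex"
  have delta: "((\<lambda>\<gamma>. ?\<delta> \<gamma> * cnj (multi_power w \<gamma>)) has_sum 1) UNIV" for w
    by (rule has_sum_finite_neutralI[of "{\<lambda>_. 0}"]) (auto simp: multi_power_0)
  have U: "U = ?\<delta>"
    using d Us delta by (rule power_series_unique_cnj)
  have V: "V \<gamma> = 0" if "\<gamma> \<noteq> (\<lambda>_. 0)" for \<gamma>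
  proof -
    \<comment> \<open>At a point without zero coordinates the monomial in \<open>z\<close> can be
      divided out.\<close>
    obtain \<rho> where \<rho>: "\<rho> > 0" "\<And>t. 0 \<le> t \<Longrightarrow> t \<le> \<rho> \<Longrightarrow> (\<chi> i. complex_of_real t :: complex ^ 'n) \<in> ball 0 d"
      using exists_positive_point_in_ball[OF d] by blast
    define z where "z = (\<chi> i. complex_of_real \<rho> :: complex ^ 'n)"
    have "z \<in> ball 0 d" using \<rho> by (simp add: z_def)
    from power_series_unique_cnj[OF d Vs[OF this] delta]
    have "V \<gamma> * multi_power z \<gamma> = 0" using that by (auto simp: fun_eq_iff)
    then show ?thesis using \<rho>(1) by (simp add: z_def multi_power_const)
  qed
  show ?thesis
  proof (rule multi_power_from_step[of l \<mu>, OF l0 l1])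
    fix \<gamma> i
    assume IH: "\<And>\<beta>. \<beta> \<le> \<gamma> \<Longrightarrow> \<beta> \<noteq> \<gamma> \<Longrightarrow> l \<beta> = multi_power \<mu> \<beta>" and i: "unit_index i \<le> \<gamma>" "unit_index i \<noteq> \<gamma>"
    have "\<gamma> \<noteq> (\<lambda>_. 0)" by (rule unit_index_le_nonzero[OF i(1)])
    then show "l \<gamma> = multi_power \<mu> \<gamma>" using UV'[rule_format, of \<gamma> \<mu>] IH U V ne[OF i] by simp
  qed
qed

section \<open>Weighted composition operators\<close>

lemma weighted_composition_necessary:
  assumes "weighted_composition_operator D H ip T"
  obtains \<phi> where "\<And>z. z \<in> D \<Longrightarrow> \<phi> z \<in> D" "\<And>f z. f \<in> H \<Longrightarrow> z \<in> D \<Longrightarrow> T f z = T (one_on D) z * f (\<phi> z)"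
  using assms unfolding weighted_composition_operator_def holomorphic_self_map_def by blast

context diagonal_rkhs
begin

lemma one_on_eq_monomial: "one_on D = monomial_on D (\<lambda>_. 0)"
  by (simp add: zext_def multi_power_0)

text \<open>The point \<mu> is not known to lie in \<open>D\<close>. The Taylor series nevertheless
  converge there, since termwise application of \<Lambda> produces exactly these series;
  multiplicativity is then the Cauchy product.\<close>

lemma functional_multiplicative:
  assumes add: "\<And>f g. f \<in> H \<Longrightarrow> g \<in> H \<Longrightarrow> \<Lambda> (\<lambda>z. f z + g z) = \<Lambda> f + \<Lambda> g"
    and scale: "\<And>f c. f \<in> H \<Longrightarrow> \<Lambda> (\<lambda>z. c * f z) = c * \<Lambda> f"
    and bound: "\<And>f. f \<in> H \<Longrightarrow> cmod (\<Lambda> f) \<le> C * hnorm ip f"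
    and mono: "\<And>\<gamma>. \<Lambda> (monomial_on D \<gamma>) = multi_power \<mu> \<gamma>"
  shows "multiplicative_functional H \<Lambda>"
  unfolding multiplicative_functional_def
proof (intro conjI ballI allI impI)
  fix f g assume f: "f \<in> H" and g: "g \<in> H" and fg: "(\<lambda>z. f z * g z) \<in> H"
  have hs: "((\<lambda>\<alpha>. coef f \<alpha> * multi_power \<mu> \<alpha>) has_sum \<Lambda> f) UNIV" if "f \<in> H" for f
  proof -
    have "((\<lambda>\<alpha>. coef f \<alpha> * \<Lambda> (monomial_on D \<alpha>)) has_sum \<Lambda> f) UNIV"
      using add scale bound that by (rule functional_has_sum)
    then show ?thesis unfolding mono .
  qed
  have "coef (\<lambda>z. f z * g z) = conv (coef f) (coef g)"
  proof (rule coef_unique[OF fg])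
    fix w :: "complex ^ 'n" assume "w \<in> ball 0 r"
    then have w: "w \<in> D" using ball_D by blast
    show "((\<lambda>\<alpha>. conv (coef f) (coef g) \<alpha> * multi_power w \<alpha>) has_sum (f w * g w)) UNIV"
      by (rule has_sum_conv_power[OF has_sum_coef[OF f w] has_sum_coef[OF g w]])
  qed
  then have "((\<lambda>\<gamma>. conv (coef f) (coef g) \<gamma> * multi_power \<mu> \<gamma>) has_sum \<Lambda> (\<lambda>z. f z * g z)) UNIV"
    using hs[OF fg] by simp
  moreover have "((\<lambda>\<gamma>. conv (coef f) (coef g) \<gamma> * multi_power \<mu> \<gamma>) has_sum (\<Lambda> f * \<Lambda> g)) UNIV"
    by (rule has_sum_conv_power[OF hs[OF f] hs[OF g]])
  ultimately show "\<Lambda> (\<lambda>z. f z * g z) = \<Lambda> f * \<Lambda> g" by (rule has_sum_unique)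
qed (use add scale in auto)

definition quotient_functional :: "((complex ^ 'n \<Rightarrow> complex) \<Rightarrow> complex ^ 'n \<Rightarrow> complex) \<Rightarrow> complex ^ 'n
    \<Rightarrow> (complex ^ 'n \<Rightarrow> complex) \<Rightarrow> complex" where
  "quotient_functional T z f = T f z / T (one_on D) z"

lemma
  assumes T: "bounded_operator H ip T" and z: "z \<in> D"
  shows quotient_functional_add:
      "\<And>f g. f \<in> H \<Longrightarrow> g \<in> H \<Longrightarrow> quotient_functional T z (\<lambda>z. f z + g z) = quotient_functional T z f + quotient_functional T z g"
    and quotient_functional_scale:
      "\<And>f c. f \<in> H \<Longrightarrow> quotient_functional T z (\<lambda>z. c * f z) = c * quotient_functional T z f"
    and quotient_functional_bounded:
      "\<exists>C. \<forall>f\<in>H. cmod (quotient_functional T z f) \<le> C * hnorm ip f"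
proof -
  show "quotient_functional T z (\<lambda>z. f z + g z) = quotient_functional T z f + quotient_functional T z g"
    if "f \<in> H" "g \<in> H" for f g
    using T that by (simp add: bounded_operator_def quotient_functional_def add_divide_distrib)
  show "quotient_functional T z (\<lambda>z. c * f z) = c * quotient_functional T z f" if "f \<in> H" for f c
    using T that by (simp add: bounded_operator_def quotient_functional_def)
  obtain B where B: "\<And>f. f \<in> H \<Longrightarrow> hnorm ip (T f) \<le> B * hnorm ip f" and TH: "\<And>f. f \<in> H \<Longrightarrow> T f \<in> H"
    using T unfolding bounded_operator_def by blast
  define K where "K = hnorm ip (kernel_fun D k z)"
  have K: "0 \<le> K" unfolding K_def by (rule hnorm_nonneg[OF kernel_mem[OF z]])
  have "cmod (quotient_functional T z f) \<le> (B * K / cmod (T (one_on D) z)) * hnorm ip f" if "f \<in> H" for f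
  proof -
    have "cmod (T f z) \<le> hnorm ip (T f) * K"
      using Cauchy_Schwarz[OF TH[OF that] kernel_mem[OF z]] reproducing[OF TH[OF that] z] by (simp add: K_def)
    also have "\<dots> \<le> (B * hnorm ip f) * K" using B[OF that] K by (rule mult_right_mono)
    finally have "cmod (T f z) / cmod (T (one_on D) z) \<le> (B * hnorm ip f) * K / cmod (T (one_on D) z)"
      by (rule divide_right_mono) simp
    then show ?thesis by (simp add: quotient_functional_def norm_divide mult_ac)
  qed
  then show "\<exists>C. \<forall>f\<in>H. cmod (quotient_functional T z f) \<le> C * hnorm ip f" by blast
qed

lemma quotient_functional_has_sum:
  assumes T: "bounded_operator H ip T" and z: "z \<in> D" and f: "f \<in> H"
  shows "((\<lambda>\<alpha>. coef f \<alpha> * quotient_functional T z (monomial_on D \<alpha>)) has_sum quotient_functional T z f) UNIV"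
proof -
  obtain C where "\<And>f. f \<in> H \<Longrightarrow> cmod (quotient_functional T z f) \<le> C * hnorm ip f"
    using quotient_functional_bounded[OF T z] by blast
  from functional_has_sum[OF quotient_functional_add[OF T z] quotient_functional_scale[OF T z] this f]
  show ?thesis .
qed

proposition weighted_composition_sufficient:
  assumes T: "bounded_operator H ip T" and nz: "\<And>z. z \<in> D \<Longrightarrow> T (one_on D) z \<noteq> 0"
    and eval: "multiplicative_functionals_are_evaluations D H"
    and mono: "\<And>z \<gamma>. z \<in> D \<Longrightarrow> quotient_functional T z (monomial_on D \<gamma>)
        = multi_power (\<chi> i. quotient_functional T z (monomial_on D (unit_index i))) \<gamma>"
  shows "weighted_composition_operator D H ip T"
proof -
  have one: "one_on D \<in> H" unfolding one_on_eq_monomial by (rule monomial_mem)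
  have "\<exists>x\<in>D. \<forall>f\<in>H. quotient_functional T z f = f x" if z: "z \<in> D" for z
  proof -
    obtain C where "\<And>f. f \<in> H \<Longrightarrow> cmod (quotient_functional T z f) \<le> C * hnorm ip f"
      using quotient_functional_bounded[OF T z] by blast
    from functional_multiplicative[OF quotient_functional_add[OF T z] quotient_functional_scale[OF T z] this mono[OF z]]
    have "multiplicative_functional H (quotient_functional T z)" .
    moreover have "quotient_functional T z (one_on D) \<noteq> 0" using nz[OF z] by (simp add: quotient_functional_def)
    ultimately show ?thesis using eval one unfolding multiplicative_functionals_are_evaluations_def by blast
  qed
  then obtain \<phi> where \<phi>: "\<And>z. z \<in> D \<Longrightarrow> \<phi> z \<in> D"
    "\<And>z f. z \<in> D \<Longrightarrow> f \<in> H \<Longrightarrow> quotient_functional T z f = f (\<phi> z)" by metis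
  have TH: "\<And>f. f \<in> H \<Longrightarrow> T f \<in> H" using T unfolding bounded_operator_def by blast
  have "holomorphic_Cn D (\<lambda>z. \<phi> z $ i)" for i
  proof (rule holomorphic_Cn_cong[OF open_D])
    show "holomorphic_Cn D (\<lambda>z. T (monomial_on D (unit_index i)) z / T (one_on D) z)"
      by (intro holomorphic_Cn_divide holomorphic_mem TH monomial_mem one nz)
    show "T (monomial_on D (unit_index i)) z / T (one_on D) z = \<phi> z $ i" if "z \<in> D" for z
      using \<phi>(2)[OF that monomial_mem[of "unit_index i"]] \<phi>(1)[OF that]
      by (simp add: quotient_functional_def zext_def multi_power_unit)
  qed
  then have "holomorphic_self_map D \<phi>" using \<phi>(1) by (simp add: holomorphic_self_map_def)
  moreover have "\<forall>f\<in>H. \<forall>z\<in>D. T f z = T (one_on D) z * f (\<phi> z)"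
    using \<phi>(2) nz by (auto simp: quotient_functional_def field_simps)
  ultimately show ?thesis
    using T one unfolding weighted_composition_operator_def by blast
qed

theorem weighted_composition_iff_square:
  assumes T: "bounded_operator H ip T" and nz: "\<And>z. z \<in> D \<Longrightarrow> T (one_on D) z \<noteq> 0"
    and eval: "multiplicative_functionals_are_evaluations D H"
    and sq: "\<And>w. w \<in> D \<Longrightarrow> zext D (\<lambda>z. (k z w)\<^sup>2) \<in> H"
  shows "weighted_composition_operator D H ip T \<longleftrightarrow>
    (\<forall>w\<in>D. \<forall>z\<in>D. T (zext D (\<lambda>z. (k z w)\<^sup>2)) z * T (one_on D) z = (T (kernel_fun D k w) z)\<^sup>2)"
proof
  assume "weighted_composition_operator D H ip T"
  then obtain \<phi> where \<phi>: "\<And>z. z \<in> D \<Longrightarrow> \<phi> z \<in> D" "\<And>f z. f \<in> H \<Longrightarrow> z \<in> D \<Longrightarrow> T f z = T (one_on D) z * f (\<phi> z)"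
    using weighted_composition_necessary by blast
  show "\<forall>w\<in>D. \<forall>z\<in>D. T (zext D (\<lambda>z. (k z w)\<^sup>2)) z * T (one_on D) z = (T (kernel_fun D k w) z)\<^sup>2"
  proof (intro ballI)
    fix w z assume w: "w \<in> D" and z: "z \<in> D"
    show "T (zext D (\<lambda>z. (k z w)\<^sup>2)) z * T (one_on D) z = (T (kernel_fun D k w) z)\<^sup>2"
      unfolding \<phi>(2)[OF sq[OF w] z] \<phi>(2)[OF kernel_mem[OF w] z] using \<phi>(1)[OF z]
      by (simp add: zext_def power2_eq_square)
  qed
next
  assume rel: "\<forall>w\<in>D. \<forall>z\<in>D. T (zext D (\<lambda>z. (k z w)\<^sup>2)) z * T (one_on D) z = (T (kernel_fun D k w) z)\<^sup>2"
  show "weighted_composition_operator D H ip T"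
  proof (rule weighted_composition_sufficient[OF T nz eval])
    fix z \<gamma> assume z: "z \<in> D"
    let ?L = "quotient_functional T z"
    define l where "l = (\<lambda>\<alpha>. ?L (monomial_on D \<alpha>))"
    let ?a = "\<lambda>\<alpha>. complex_of_real (a \<alpha>)"
    have Lk: "((\<lambda>\<alpha>. ?a \<alpha> * l \<alpha> * cnj (multi_power w \<alpha>)) has_sum ?L (kernel_fun D k w)) UNIV" if "w \<in> D" for w
      using quotient_functional_has_sum[OF T z kernel_mem[OF that]] by (simp add: coef_kernel[OF that] l_def mult_ac)
    have Lk2: "((\<lambda>\<alpha>. (conv ?a ?a \<alpha> * l \<alpha>) * cnj (multi_power w \<alpha>)) has_sum (?L (kernel_fun D k w))\<^sup>2) UNIV"
      if w: "w \<in> D" for w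
    proof -
      have "coef (zext D (\<lambda>z. (k z w)\<^sup>2)) = (\<lambda>\<alpha>. conv ?a ?a \<alpha> * cnj (multi_power w \<alpha>))"
      proof (rule coef_unique[OF sq[OF w]])
        fix y :: "complex ^ 'n" assume "y \<in> ball 0 r"
        then have y: "y \<in> D" using ball_D by blast
        from has_sum_conv_diag[OF expansion[OF y w] expansion[OF y w]]
        show "((\<lambda>\<alpha>. conv ?a ?a \<alpha> * cnj (multi_power w \<alpha>) * multi_power y \<alpha>) has_sum zext D (\<lambda>z. (k z w)\<^sup>2) y) UNIV"
          using y by (simp add: zext_def power2_eq_square mult_ac)
      qed
      with quotient_functional_has_sum[OF T z sq[OF w]]
      have "((\<lambda>\<alpha>. (conv ?a ?a \<alpha> * l \<alpha>) * cnj (multi_power w \<alpha>)) has_sum ?L (zext D (\<lambda>z. (k z w)\<^sup>2))) UNIV"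
        by (simp add: l_def mult_ac)
      moreover have "?L (zext D (\<lambda>z. (k z w)\<^sup>2)) = (?L (kernel_fun D k w))\<^sup>2"
        using rel[rule_format, OF w z] nz[OF z]
        by (simp add: quotient_functional_def power2_eq_square field_simps)
      ultimately show ?thesis by simp
    qed
    \<comment> \<open>Both sides are coefficients of one function of \<open>w\<close>: the square of
      the functional at the kernel function, expanded once through the squared kernel and once as a
      Cauchy product.\<close>
    have rel': "(\<lambda>\<gamma>. conv ?a ?a \<gamma> * l \<gamma>) = conv (\<lambda>\<alpha>. ?a \<alpha> * l \<alpha>) (\<lambda>\<alpha>. ?a \<alpha> * l \<alpha>)"
    proof (rule power_series_unique_cnj[OF r_pos, where f = "\<lambda>w. (?L (kernel_fun D k w))\<^sup>2"])
      fix w :: "complex ^ 'n" assume "w \<in> ball 0 r"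
      then have w: "w \<in> D" using ball_D by blast
      show "((\<lambda>\<beta>. (conv ?a ?a \<beta> * l \<beta>) * cnj (multi_power w \<beta>)) has_sum (?L (kernel_fun D k w))\<^sup>2) UNIV"
        by (rule Lk2[OF w])
      show "((\<lambda>\<beta>. conv (\<lambda>\<alpha>. ?a \<alpha> * l \<alpha>) (\<lambda>\<alpha>. ?a \<alpha> * l \<alpha>) \<beta> * cnj (multi_power w \<beta>)) has_sum (?L (kernel_fun D k w))\<^sup>2) UNIV"
        unfolding power2_eq_square by (rule has_sum_conv_cnj[OF Lk[OF w] Lk[OF w]])
    qed
    have "l \<gamma> = multi_power (\<chi> i. l (unit_index i)) \<gamma>"
    proof (rule multi_power_of_square_relation[where a = a, OF a_pos])
      show "l (\<lambda>_. 0) = 1"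
        using nz[OF z] by (simp add: l_def quotient_functional_def one_on_eq_monomial[symmetric])
    qed (use rel' in \<open>simp_all add: fun_eq_iff\<close>)
    then show "?L (monomial_on D \<gamma>) = multi_power (\<chi> i. ?L (monomial_on D (unit_index i))) \<gamma>"
      by (simp add: l_def)
  qed
qed

text \<open>The common form of the Schur and the tensor case: the factors enter only through
  functions on \<open>D\<close> and the coefficients \<open>b j\<close> of
  \<open>1 - 1 / S j\<close>.\<close>

theorem weighted_composition_iff_product:
  fixes S :: "'p::finite \<Rightarrow> complex ^ 'n \<Rightarrow> complex ^ 'n \<Rightarrow> complex" and b :: "'p \<Rightarrow> ('n \<Rightarrow> nat) \<Rightarrow> real"
  assumes T: "bounded_operator H ip T" and nz: "\<And>z. z \<in> D \<Longrightarrow> T (one_on D) z \<noteq> 0"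
    and eval: "multiplicative_functionals_are_evaluations D H"
    and a0: "a (\<lambda>_. 0) = 1" and b0: "\<And>j. b j (\<lambda>_. 0) = 0"
    and b: "\<And>j \<gamma>. 0 \<le> b j \<gamma>" "\<And>j \<gamma>. b j \<gamma> \<le> a \<gamma>"
    and ba: "\<And>\<gamma> i. unit_index i \<le> \<gamma> \<Longrightarrow> unit_index i \<noteq> \<gamma> \<Longrightarrow> (\<Sum>j\<in>UNIV. b j \<gamma>) < a \<gamma>"
    and bS: "\<And>j z w. z \<in> D \<Longrightarrow> w \<in> D \<Longrightarrow> (diag_term (b j) z w has_sum (1 - 1 / S j z w)) UNIV"
    and kS: "\<And>z w. z \<in> D \<Longrightarrow> w \<in> D \<Longrightarrow> k z w * (\<Prod>j\<in>UNIV. 1 / S j z w) = 1"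
  shows "weighted_composition_operator D H ip T \<longleftrightarrow>
    (\<forall>w\<in>D. \<forall>z\<in>D. T (kernel_fun D k w) z * (\<Prod>j\<in>UNIV. T (zext D (\<lambda>z. 1 / S j z w)) z) = (T (one_on D) z) ^ (CARD('p) + 1))"
proof -
  \<comment> \<open>These are the coefficients of \<open>1 / S j\<close>.\<close>
  define C where "C = (\<lambda>j \<gamma>. complex_of_real ((if \<gamma> = (\<lambda>_. 0) then 1 else 0) - b j \<gamma>))"
  have C_sum: "((\<lambda>\<gamma>. C j \<gamma> * multi_power z \<gamma> * cnj (multi_power w \<gamma>)) has_sum (1 / S j z w)) UNIV"
    if "z \<in> D" "w \<in> D" for j z w
  proof -
    have "((\<lambda>\<gamma>. (if \<gamma> = (\<lambda>_. 0) then 1 else 0) * multi_power z \<gamma> * cnj (multi_power w \<gamma>)) has_sum 1) UNIV"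
      by (rule has_sum_finite_neutralI[of "{\<lambda>_. 0}"]) (auto simp: multi_power_0)
    from has_sum_add[OF this has_sum_uminusI[OF bS[OF that, of j]]]
    have "((\<lambda>\<gamma>. (if \<gamma> = (\<lambda>_. 0) then 1 else 0) * multi_power z \<gamma> * cnj (multi_power w \<gamma>) + - diag_term (b j) z w \<gamma>)
        has_sum (1 / S j z w)) UNIV" by simp
    moreover have "(if \<gamma> = (\<lambda>_. 0) then 1 else 0) * multi_power z \<gamma> * cnj (multi_power w \<gamma>) + - diag_term (b j) z w \<gamma>
        = C j \<gamma> * multi_power z \<gamma> * cnj (multi_power w \<gamma>)" for \<gamma>
      by (simp add: C_def algebra_simps)
    ultimately show ?thesis by simp
  qed
  have S_mem: "zext D (\<lambda>z. 1 / S j z w) \<in> H" if w: "w \<in> D" for j w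
  proof (rule power_series_mem[where c = "\<lambda>\<gamma>. C j \<gamma> * cnj (multi_power w \<gamma>)"])
    show "((\<lambda>\<gamma>. C j \<gamma> * cnj (multi_power w \<gamma>) * multi_power z \<gamma>) has_sum (1 / S j z w)) UNIV" if "z \<in> D" for z
      using C_sum[OF that w, of j] by (simp add: mult_ac)
    show "(\<lambda>\<gamma>. (cmod (C j \<gamma> * cnj (multi_power w \<gamma>)))\<^sup>2 / a \<gamma>) summable_on UNIV"
    proof (rule summable_on_comparison_test[OF summable_diag[OF w]])
      fix \<gamma> :: "'n \<Rightarrow> nat"
      \<comment> \<open>Hence the norm series of \<open>1 / S j\<close> at \<open>w\<close> is
        dominated by the expansion of the kernel at the pair \<open>(w, w)\<close>.\<close>
      have "cmod (C j \<gamma>) \<le> a \<gamma>" unfolding C_def norm_of_real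
        using a0 b0 b[of j \<gamma>] by auto
      then have "(cmod (C j \<gamma>))\<^sup>2 \<le> (a \<gamma>)\<^sup>2" by (intro power_mono) auto
      then have "(cmod (C j \<gamma>))\<^sup>2 / a \<gamma> \<le> a \<gamma>"
        using a_pos[of \<gamma>] by (simp add: power2_eq_square divide_le_eq)
      then have "(cmod (C j \<gamma>))\<^sup>2 / a \<gamma> * (cmod (multi_power w \<gamma>))\<^sup>2 \<le> a \<gamma> * (cmod (multi_power w \<gamma>))\<^sup>2"
        by (rule mult_right_mono) simp
      then show "(cmod (C j \<gamma> * cnj (multi_power w \<gamma>)))\<^sup>2 / a \<gamma> \<le> a \<gamma> * (cmod (multi_power w \<gamma>))\<^sup>2"
        by (simp add: norm_mult power_mult_distrib)
    qed (use a_pos in \<open>simp add: less_imp_le\<close>)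
  qed
  show ?thesis
  proof
    assume "weighted_composition_operator D H ip T"
    then obtain \<phi> where \<phi>: "\<And>z. z \<in> D \<Longrightarrow> \<phi> z \<in> D" "\<And>f z. f \<in> H \<Longrightarrow> z \<in> D \<Longrightarrow> T f z = T (one_on D) z * f (\<phi> z)"
      using weighted_composition_necessary by blast
    show "\<forall>w\<in>D. \<forall>z\<in>D. T (kernel_fun D k w) z * (\<Prod>j\<in>UNIV. T (zext D (\<lambda>z. 1 / S j z w)) z) = (T (one_on D) z) ^ (CARD('p) + 1)"
    proof (intro ballI)
      fix w z assume w: "w \<in> D" and z: "z \<in> D"
      have "(\<Prod>j\<in>UNIV. T (zext D (\<lambda>z. 1 / S j z w)) z) = (\<Prod>j\<in>UNIV. T (one_on D) z * (1 / S j (\<phi> z) w))"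
      proof (rule prod.cong[OF refl])
        fix j :: 'p
        show "T (zext D (\<lambda>z. 1 / S j z w)) z = T (one_on D) z * (1 / S j (\<phi> z) w)"
          using \<phi>(2)[OF S_mem[OF w, of j] z] \<phi>(1)[OF z] by (simp only: zext_def if_True)
      qed
      \<comment> \<open>Each of the \<open>CARD('p) + 1\<close> factors contributes
        \<open>T (one_on D) z\<close> once; the remaining values at \<open>\<phi> z\<close> multiply
        to 1 by \<open>kS\<close>.\<close>
      then have "T (kernel_fun D k w) z * (\<Prod>j\<in>UNIV. T (zext D (\<lambda>z. 1 / S j z w)) z)
          = (T (one_on D) z) ^ (CARD('p) + 1) * (k (\<phi> z) w * (\<Prod>j\<in>UNIV. 1 / S j (\<phi> z) w))"
        using \<phi>(2)[OF kernel_mem[OF w] z] \<phi>(1)[OF z] by (simp only: prod.distrib prod_constant zext_def if_True) (simp add: mult_ac)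
      then show "T (kernel_fun D k w) z * (\<Prod>j\<in>UNIV. T (zext D (\<lambda>z. 1 / S j z w)) z) = (T (one_on D) z) ^ (CARD('p) + 1)"
        using kS[OF \<phi>(1)[OF z] w] by (simp only: mult_1_right)
    qed
  next
    assume rel: "\<forall>w\<in>D. \<forall>z\<in>D. T (kernel_fun D k w) z * (\<Prod>j\<in>UNIV. T (zext D (\<lambda>z. 1 / S j z w)) z) = (T (one_on D) z) ^ (CARD('p) + 1)"
    show "weighted_composition_operator D H ip T"
    proof (rule weighted_composition_sufficient[OF T nz eval])
      fix z \<gamma> assume z: "z \<in> D"
      let ?L = "quotient_functional T z"
      define l where "l = (\<lambda>\<alpha>. ?L (monomial_on D \<alpha>))"
      have wD: "w \<in> D" if "w \<in> ball 0 r" for w using that ball_D by blast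
      have "l \<gamma> = multi_power (\<chi> i. l (unit_index i)) \<gamma>"
      proof (rule multi_power_of_product_relation[where A = "\<lambda>\<gamma>. of_real (a \<gamma>)" and C = C and d = r
            and P = "\<lambda>w. ?L (kernel_fun D k w)" and Q = "\<lambda>j w. ?L (zext D (\<lambda>z. 1 / S j z w))"
            and P' = k and Q' = "\<lambda>j z w. 1 / S j z w"])
        show "l (\<lambda>_. 0) = 1"
          using nz[OF z] by (simp add: l_def quotient_functional_def one_on_eq_monomial[symmetric])
        show "of_real (a \<gamma>) + (\<Sum>j\<in>UNIV. C j \<gamma>) \<noteq> 0" if "unit_index i \<le> \<gamma>" "unit_index i \<noteq> \<gamma>" for \<gamma> i
        proof -
          have "\<gamma> \<noteq> (\<lambda>_. 0)" by (rule unit_index_le_nonzero[OF that(1)])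
          then have "of_real (a \<gamma>) + (\<Sum>j\<in>UNIV. C j \<gamma>) = complex_of_real (a \<gamma> - (\<Sum>j\<in>UNIV. b j \<gamma>))"
            by (simp add: C_def sum_negf)
          then show ?thesis using ba[OF that] by (simp only: of_real_eq_0_iff)
        qed
        fix w :: "complex ^ 'n" assume "w \<in> ball 0 r"
        then have w: "w \<in> D" by (rule wD)
        show "((\<lambda>\<gamma>. of_real (a \<gamma>) * l \<gamma> * cnj (multi_power w \<gamma>)) has_sum ?L (kernel_fun D k w)) UNIV"
          using quotient_functional_has_sum[OF T z kernel_mem[OF w]] by (simp add: coef_kernel[OF w] l_def mult_ac)
        show "((\<lambda>\<gamma>. C j \<gamma> * l \<gamma> * cnj (multi_power w \<gamma>)) has_sum ?L (zext D (\<lambda>z. 1 / S j z w))) UNIV" for j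
        proof -
          have "coef (zext D (\<lambda>z. 1 / S j z w)) = (\<lambda>\<gamma>. C j \<gamma> * cnj (multi_power w \<gamma>))"
          proof (rule coef_unique[OF S_mem[OF w]])
            fix y :: "complex ^ 'n" assume "y \<in> ball 0 r"
            then have y: "y \<in> D" by (rule wD)
            show "((\<lambda>\<gamma>. C j \<gamma> * cnj (multi_power w \<gamma>) * multi_power y \<gamma>) has_sum zext D (\<lambda>z. 1 / S j z w) y) UNIV"
              using C_sum[OF y w, of j] y by (simp add: zext_def mult_ac)
          qed
          then show ?thesis
            using quotient_functional_has_sum[OF T z S_mem[OF w, of j]] by (simp add: l_def mult_ac)
        qed
        \<comment> \<open>This is the hypothesis divided by the full power of
          \<open>T (one_on D) z\<close>.\<close>
        show "?L (kernel_fun D k w) * (\<Prod>j\<in>UNIV. ?L (zext D (\<lambda>z. 1 / S j z w))) = 1"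
          using rel[rule_format, OF w z] nz[OF z]
          by (simp add: quotient_functional_def prod_dividef power_add)
      qed (use a0 b0 r_pos wD expansion C_sum kS in \<open>auto simp: C_def\<close>)
      then show "?L (monomial_on D \<gamma>) = multi_power (\<chi> i. ?L (monomial_on D (unit_index i))) \<gamma>"
        by (simp add: l_def)
    qed
  qed
qed

end

section \<open>The reciprocal of a diagonal complete Pick kernel\<close>

text \<open>The coefficients of \<open>1 - 1/s\<close> when \<open>s\<close> has the coefficients \<open>a\<close> and \<open>a\<^sub>0 = 1\<close>.\<close>

context
  notes sum.cong [fundef_cong]
begin

function inv_coef :: "(('n::finite \<Rightarrow> nat) \<Rightarrow> real) \<Rightarrow> ('n \<Rightarrow> nat) \<Rightarrow> real" where
  "inv_coef a \<gamma> = (if \<gamma> = (\<lambda>_. 0) then 0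
     else a \<gamma> - (\<Sum>\<beta>\<in>{\<beta>. \<beta> \<le> \<gamma> \<and> \<beta> \<noteq> \<gamma>}. inv_coef a \<beta> * a (\<gamma> - \<beta>)))"
  by auto
termination
  by (relation "Wellfounded.measure (\<lambda>(a, \<gamma>). sum \<gamma> UNIV)") (auto intro: sum_multi_index_less)

end

declare inv_coef.simps [simp del]

lemma inv_coef_0: "inv_coef a (\<lambda>_. 0) = 0"
  by (simp add: inv_coef.simps)

text \<open>The identity \<open>(1 - 1/s) * s = s - 1\<close>, read on coefficients.\<close>

lemma conv_inv_coef:
  assumes "a (\<lambda>_. 0) = 1"
  shows "conv (inv_coef a) a \<gamma> = (if \<gamma> = (\<lambda>_. 0) then 0 else a \<gamma>)"
proof (cases "\<gamma> = (\<lambda>_. 0)")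
  case False
  have "{\<beta>. \<beta> \<le> \<gamma> \<and> \<beta> \<noteq> \<gamma>} = insert (\<lambda>_. 0) ({\<beta>. \<beta> \<le> \<gamma>} - {\<lambda>_. 0, \<gamma>})"
    using False by (auto simp: le_fun_def)
  then have "(\<Sum>\<beta>\<in>{\<beta>. \<beta> \<le> \<gamma> \<and> \<beta> \<noteq> \<gamma>}. inv_coef a \<beta> * a (\<gamma> - \<beta>))
      = (\<Sum>\<beta>\<in>{\<beta>. \<beta> \<le> \<gamma>} - {\<lambda>_. 0, \<gamma>}. inv_coef a \<beta> * a (\<gamma> - \<beta>))"
    using finite_le_multi_index[of \<gamma>] by (simp add: inv_coef_0)
  then show ?thesis
    using False conv_split[OF False, of "inv_coef a" a] inv_coef.simps[of a \<gamma>] assms by (simp add: inv_coef_0)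
qed (simp add: conv_zero inv_coef_0)

text \<open>Summability is a hypothesis because it comes from two sources: a crude estimate near the
  origin, and domination by the series of \<open>s\<close> once the coefficients are known to be
  nonnegative.\<close>

lemma has_sum_inv_coef:
  assumes a0: "a (\<lambda>_. 0) = 1" and s: "(diag_term a z w has_sum s) UNIV" "s \<noteq> 0"
    and sm: "diag_term (inv_coef a) z w summable_on UNIV"
  shows "(diag_term (inv_coef a) z w has_sum (1 - 1 / s)) UNIV"
proof -
  let ?B = "infsum (diag_term (inv_coef a) z w) UNIV"
  have B: "(diag_term (inv_coef a) z w has_sum ?B) UNIV" using sm by (rule has_sum_infsum)
  have "conv (\<lambda>\<alpha>. complex_of_real (inv_coef a \<alpha>)) (\<lambda>\<alpha>. complex_of_real (a \<alpha>)) \<gamma> = of_real (conv (inv_coef a) a \<gamma>)" for \<gamma>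
    by (simp add: conv_def)
  then have "((\<lambda>\<gamma>. complex_of_real (if \<gamma> = (\<lambda>_. 0) then 0 else a \<gamma>) * multi_power z \<gamma> * cnj (multi_power w \<gamma>))
      has_sum (?B * s)) UNIV"
    using has_sum_conv_diag[OF B s(1)] by (simp add: conv_inv_coef[of a, OF a0])
  moreover have "((\<lambda>\<gamma>. complex_of_real (if \<gamma> = (\<lambda>_. 0) then 0 else a \<gamma>) * multi_power z \<gamma> * cnj (multi_power w \<gamma>))
      has_sum (s - 1)) UNIV"
  proof -
    have "((\<lambda>\<gamma>. if \<gamma> = (\<lambda>_. 0) then - 1 else 0 :: complex) has_sum (- 1)) UNIV"
      by (rule has_sum_finite_neutralI[of "{\<lambda>_. 0}"]) auto
    from has_sum_add[OF s(1) this]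
    have "((\<lambda>\<gamma>. diag_term a z w \<gamma> + (if \<gamma> = (\<lambda>_. 0) then - 1 else 0)) has_sum (s - 1)) UNIV" by simp
    moreover have "diag_term a z w \<gamma> + (if \<gamma> = (\<lambda>_. 0) then - 1 else 0)
        = complex_of_real (if \<gamma> = (\<lambda>_. 0) then 0 else a \<gamma>) * multi_power z \<gamma> * cnj (multi_power w \<gamma>)" for \<gamma>
      by (simp add: a0 multi_power_0)
    ultimately show ?thesis by simp
  qed
  ultimately have "?B * s = s - 1" by (rule has_sum_unique)
  then have "?B = 1 - 1 / s" using s(2) by (simp add: field_simps)
  then show ?thesis using B by simp
qed

lemma norm_diag_term_le_power:
  assumes "\<And>i. cmod (z $ i) * cmod (w $ i) \<le> t"
  shows "norm (diag_term b z w \<gamma>) \<le> \<bar>b \<gamma>\<bar> * t ^ sum \<gamma> UNIV"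
proof -
  have t: "0 \<le> t" using assms[of undefined] by (meson mult_nonneg_nonneg norm_ge_zero order_trans)
  have "cmod ((\<chi> i. z $ i * w $ i) $ i) \<le> cmod ((\<chi> i. complex_of_real t) $ i)" for i
    using assms t by (simp add: norm_mult)
  from norm_multi_power_mono[OF this, of \<gamma>]
  have "cmod (multi_power z \<gamma>) * cmod (multi_power w \<gamma>) \<le> t ^ sum \<gamma> UNIV"
    using t by (simp add: multi_power_mult norm_mult multi_power_const norm_power)
  then show ?thesis by (simp add: norm_mult mult.assoc mult_left_mono)
qed

text \<open>Summing the recursion over a box bounds the total \<open>E\<close> of the weighted
  absolute values by \<open>1/2 + E/2\<close>, hence by 1. Finite boxes make the subtraction of
  \<open>E/2\<close> legitimate.\<close>

lemma inv_coef_sum_bound: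
  fixes a :: "('n::finite \<Rightarrow> nat) \<Rightarrow> real"
  assumes a: "\<And>\<alpha>. 0 \<le> a \<alpha>" and t: "0 \<le> t"
    and half: "\<And>n. (\<Sum>\<gamma>\<in>index_box n - {\<lambda>_. 0}. a \<gamma> * t ^ sum \<gamma> UNIV) \<le> 1 / 2"
  shows "(\<Sum>\<gamma>\<in>index_box n. \<bar>inv_coef a \<gamma>\<bar> * t ^ sum \<gamma> UNIV) \<le> 1"
proof -
  define c where "c = (\<lambda>\<gamma>. a \<gamma> * t ^ sum \<gamma> UNIV)"
  define e where "e = (\<lambda>\<gamma>. \<bar>inv_coef a \<gamma>\<bar> * t ^ sum \<gamma> UNIV)"
  have c0: "0 \<le> c \<gamma>" and e0: "0 \<le> e \<gamma>" for \<gamma> using a t by (auto simp: c_def e_def)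
  let ?X = "index_box n :: ('n \<Rightarrow> nat) set"
  let ?P = "\<lambda>\<gamma>. {\<beta>. \<beta> \<le> \<gamma> \<and> \<beta> \<noteq> \<gamma>}"
  have finP: "finite (?P \<gamma>)" for \<gamma> :: "'n \<Rightarrow> nat"
    by (rule finite_subset[OF _ finite_le_multi_index[of \<gamma>]]) auto
  have rec: "e \<gamma> \<le> (if \<gamma> = (\<lambda>_. 0) then 0 else c \<gamma>) + (\<Sum>\<beta>\<in>?P \<gamma>. e \<beta> * c (\<gamma> - \<beta>))" for \<gamma>
  proof (cases "\<gamma> = (\<lambda>_. 0)")
    case True
    then have "e \<gamma> = 0" by (simp add: e_def inv_coef_0)
    moreover have "0 \<le> (\<Sum>\<beta>\<in>?P \<gamma>. e \<beta> * c (\<gamma> - \<beta>))"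
      by (intro sum_nonneg mult_nonneg_nonneg c0 e0)
    ultimately show ?thesis using c0[of \<gamma>] by simp
  next
    case False
    have "\<bar>inv_coef a \<gamma>\<bar> \<le> a \<gamma> + (\<Sum>\<beta>\<in>?P \<gamma>. \<bar>inv_coef a \<beta>\<bar> * a (\<gamma> - \<beta>))"
    proof -
      have "\<bar>inv_coef a \<gamma>\<bar> \<le> \<bar>a \<gamma>\<bar> + \<bar>\<Sum>\<beta>\<in>?P \<gamma>. inv_coef a \<beta> * a (\<gamma> - \<beta>)\<bar>"
        using False inv_coef.simps[of a \<gamma>] abs_triangle_ineq4 by simp
      also have "\<bar>\<Sum>\<beta>\<in>?P \<gamma>. inv_coef a \<beta> * a (\<gamma> - \<beta>)\<bar> \<le> (\<Sum>\<beta>\<in>?P \<gamma>. \<bar>inv_coef a \<beta> * a (\<gamma> - \<beta>)\<bar>)" by (rule sum_abs)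
      finally show ?thesis using a by (simp add: abs_mult)
    qed
    then have "e \<gamma> \<le> (a \<gamma> + (\<Sum>\<beta>\<in>?P \<gamma>. \<bar>inv_coef a \<beta>\<bar> * a (\<gamma> - \<beta>))) * t ^ sum \<gamma> UNIV"
      unfolding e_def using t by (intro mult_right_mono) auto
    also have "\<dots> = c \<gamma> + (\<Sum>\<beta>\<in>?P \<gamma>. e \<beta> * c (\<gamma> - \<beta>))"
      unfolding distrib_right sum_distrib_right
    proof (intro arg_cong2[where f = "(+)"] sum.cong refl)
      fix \<beta> assume "\<beta> \<in> ?P \<gamma>"
      then have "\<beta> \<le> \<gamma>" by simp
      then have "sum \<gamma> UNIV = sum \<beta> UNIV + sum (\<gamma> - \<beta>) UNIV"
        by (simp add: sum.distrib[symmetric] le_fun_def)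
      then show "\<bar>inv_coef a \<beta>\<bar> * a (\<gamma> - \<beta>) * t ^ sum \<gamma> UNIV = e \<beta> * c (\<gamma> - \<beta>)"
        by (simp add: e_def c_def power_add)
    qed (simp add: c_def)
    finally show ?thesis using False by simp
  qed
  have "sum e ?X \<le> (\<Sum>\<gamma>\<in>?X. if \<gamma> = (\<lambda>_. 0) then 0 else c \<gamma>) + (\<Sum>\<gamma>\<in>?X. \<Sum>\<beta>\<in>?P \<gamma>. e \<beta> * c (\<gamma> - \<beta>))"
    unfolding sum.distrib[symmetric] by (intro sum_mono rec)
  moreover have "(\<Sum>\<gamma>\<in>?X. if \<gamma> = (\<lambda>_. 0) then 0 else c \<gamma>) = sum c (?X - {\<lambda>_. 0})"
    using finite_index_box by (intro sum.mono_neutral_cong_right) auto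
  moreover have "(\<Sum>\<gamma>\<in>?X. \<Sum>\<beta>\<in>?P \<gamma>. e \<beta> * c (\<gamma> - \<beta>)) \<le> sum e ?X * sum c (?X - {\<lambda>_. 0})"
  proof -
    \<comment> \<open>The pair \<open>(\<beta>, \<gamma> - \<beta>)\<close> determines
      \<open>(\<gamma>, \<beta>)\<close>, both entries lie in the box and the second is nonzero; so
      the double sum is part of the full product of sums.\<close>
    let ?h = "\<lambda>(\<gamma>, \<beta>). (\<beta>, \<gamma> - \<beta> :: 'n \<Rightarrow> nat)"
    have "(\<Sum>\<gamma>\<in>?X. \<Sum>\<beta>\<in>?P \<gamma>. e \<beta> * c (\<gamma> - \<beta>)) = (\<Sum>p\<in>Sigma ?X ?P. (\<lambda>(\<beta>, \<delta>). e \<beta> * c \<delta>) (?h p))"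
      using finite_index_box finP by (subst sum.Sigma) (auto intro!: sum.cong)
    also have "\<dots> = (\<Sum>q\<in>?h ` Sigma ?X ?P. (\<lambda>(\<beta>, \<delta>). e \<beta> * c \<delta>) q)"
    proof (subst sum.reindex)
      show "inj_on ?h (Sigma ?X ?P)"
      proof (rule inj_onI)
        fix p q assume *: "p \<in> Sigma ?X ?P" "q \<in> Sigma ?X ?P" "?h p = ?h q"
        obtain \<gamma> \<beta> \<gamma>' \<beta>' where pq: "p = (\<gamma>, \<beta>)" "q = (\<gamma>', \<beta>')" by (metis surj_pair)
        have "\<beta> = \<beta>'" "\<gamma> - \<beta> = \<gamma>' - \<beta>" "\<beta> \<le> \<gamma>" "\<beta> \<le> \<gamma>'" using * pq by auto
        moreover have "\<gamma> i = \<gamma>' i" for i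
          using fun_cong[OF \<open>\<gamma> - \<beta> = \<gamma>' - \<beta>\<close>, of i] le_funD[OF \<open>\<beta> \<le> \<gamma>\<close>, of i] le_funD[OF \<open>\<beta> \<le> \<gamma>'\<close>, of i] by simp
        ultimately show "p = q" using pq by auto
      qed
    qed (simp add: comp_def)
    also have "\<dots> \<le> (\<Sum>q\<in>?X \<times> (?X - {\<lambda>_. 0}). (\<lambda>(\<beta>, \<delta>). e \<beta> * c \<delta>) q)"
    proof (rule sum_mono2)
      show "finite (?X \<times> (?X - {\<lambda>_. 0}))" using finite_index_box by blast
      show "?h ` Sigma ?X ?P \<subseteq> ?X \<times> (?X - {\<lambda>_. 0})"
      proof clarify
        fix \<gamma> \<beta> :: "'n \<Rightarrow> nat" assume *: "\<gamma> \<in> ?X" "\<beta> \<le> \<gamma>" "\<beta> \<noteq> \<gamma>"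
        have "\<beta> i \<le> n" for i using le_funD[OF *(2), of i] *(1) by (auto simp: index_box_def intro: order_trans)
        moreover have "(\<gamma> - \<beta>) i \<le> n" for i using *(1) by (auto simp: index_box_def intro: diff_le_self[THEN order_trans])
        moreover have "\<gamma> - \<beta> \<noteq> (\<lambda>_. 0)"
        proof
          assume **: "\<gamma> - \<beta> = (\<lambda>_. 0)"
          have "\<gamma> i = \<beta> i" for i using fun_cong[OF **, of i] le_funD[OF *(2), of i] by simp
          then show False using *(3) by auto
        qed
        ultimately show "\<beta> \<in> ?X \<and> \<gamma> - \<beta> \<in> ?X - {\<lambda>_. 0}" by (simp add: index_box_def)
      qed
    qed (auto simp: c0 e0)
    also have "\<dots> = sum e ?X * sum c (?X - {\<lambda>_. 0})"
      by (simp add: sum_product sum.cartesian_product)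
    finally show ?thesis .
  qed
  moreover have "sum c (?X - {\<lambda>_. 0}) \<le> 1 / 2" unfolding c_def by (rule half)
  moreover have "sum e ?X * sum c (?X - {\<lambda>_. 0}) \<le> sum e ?X * (1 / 2)"
    using calculation(4) e0 by (intro mult_left_mono sum_nonneg) auto
  ultimately have "sum e ?X \<le> 1" by linarith
  then show ?thesis by (simp add: e_def)
qed

text \<open>Convergence before any sign of the coefficients is available; the signs will be deduced
  from this series.\<close>

lemma inv_coef_summable_near_0:
  fixes a :: "('n::finite \<Rightarrow> nat) \<Rightarrow> real"
  assumes a: "\<And>\<alpha>. 0 \<le> a \<alpha>" and r: "r > 0"
    and sm: "\<And>z. z \<in> ball 0 r \<Longrightarrow> diag_term a z z summable_on UNIV"
  shows "\<exists>d>0. \<forall>z\<in>ball 0 d. \<forall>w\<in>ball 0 d. diag_term (inv_coef a) z w summable_on UNIV"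
proof -
  obtain \<rho> where \<rho>: "\<rho> > 0" "\<And>t. 0 \<le> t \<Longrightarrow> t \<le> \<rho> \<Longrightarrow> (\<chi> i. complex_of_real t :: complex ^ 'n) \<in> ball 0 r"
    using exists_positive_point_in_ball[OF r] by blast
  define A where "A = (\<lambda>\<gamma>. a \<gamma> * (\<rho>\<^sup>2) ^ sum \<gamma> (UNIV :: 'n set))"
  have A0: "0 \<le> A \<gamma>" for \<gamma> using a by (simp add: A_def)
  have "(\<chi> i. complex_of_real \<rho> :: complex ^ 'n) \<in> ball 0 r" using \<rho> by simp
  from sm[OF this] have "(\<lambda>\<gamma>. complex_of_real (A \<gamma>)) summable_on UNIV"
    by (simp add: multi_power_const A_def power2_eq_square power_mult_distrib mult.assoc)
  from summable_on_Re[OF this] have As: "A summable_on UNIV" by simp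
  define S where "S = infsum A UNIV"
  have S: "0 \<le> S" unfolding S_def using A0 by (intro infsum_nonneg)
  \<comment> \<open>Every nonzero index contributes at least one factor \<open>q\<close>, so
    rescaling shrinks the sum off 0 to at most \<open>q * S\<close>, which is at most 1/2. Adding 1
    to \<open>S\<close> keeps \<open>q\<close> well defined and below 1.\<close>
  define q where "q = 1 / (2 * (S + 1))"
  have q: "0 < q" "q \<le> 1" "q * S \<le> 1 / 2" using S by (auto simp: q_def field_simps)
  define t where "t = q * \<rho>\<^sup>2"
  have t: "t > 0" using q \<rho> by (simp add: t_def)
  have half: "(\<Sum>\<gamma>\<in>index_box n - {\<lambda>_. 0}. a \<gamma> * t ^ sum \<gamma> UNIV) \<le> 1 / 2" for n
  proof -
    have "(\<Sum>\<gamma>\<in>index_box n - {\<lambda>_. 0}. a \<gamma> * t ^ sum \<gamma> UNIV) \<le> (\<Sum>\<gamma>\<in>index_box n - {\<lambda>_. 0}. q * A \<gamma>)"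
    proof (rule sum_mono)
      fix \<gamma> :: "'n \<Rightarrow> nat" assume "\<gamma> \<in> index_box n - {\<lambda>_. 0}"
      then obtain i where "\<gamma> i \<noteq> 0" by auto
      then have "1 \<le> sum \<gamma> UNIV" using member_le_sum[of i UNIV \<gamma>] by simp
      then have "q ^ sum \<gamma> UNIV \<le> q ^ 1" using q by (intro power_decreasing) auto
      then have "q ^ sum \<gamma> UNIV * A \<gamma> \<le> q * A \<gamma>" using A0 by (intro mult_right_mono) auto
      then show "a \<gamma> * t ^ sum \<gamma> UNIV \<le> q * A \<gamma>" by (simp add: t_def A_def power_mult_distrib mult_ac)
    qed
    also have "\<dots> \<le> q * S"
      unfolding sum_distrib_left[symmetric] S_def using A0 q finite_index_box
      by (intro mult_left_mono finite_sum_le_infsum As) auto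
    finally show ?thesis using q by simp
  qed
  let ?e = "\<lambda>\<gamma>. \<bar>inv_coef a \<gamma>\<bar> * t ^ sum \<gamma> UNIV"
  have es: "?e summable_on UNIV"
  proof (intro nonneg_bdd_above_summable_on bdd_aboveI2[where M = 1])
    fix F :: "('n \<Rightarrow> nat) set" assume "F \<in> {F. F \<subseteq> UNIV \<and> finite F}"
    then obtain n where "F \<subseteq> index_box n" using finite_subset_index_box by blast
    then have "sum ?e F \<le> sum ?e (index_box n)"
      using t finite_index_box by (intro sum_mono2) auto
    also have "\<dots> \<le> 1" using inv_coef_sum_bound[OF a _ half] t by simp
    finally show "sum ?e F \<le> 1" .
  qed (use t in auto)
  have "diag_term (inv_coef a) z w summable_on UNIV" if "z \<in> ball 0 (sqrt t)" "w \<in> ball 0 (sqrt t)" for z w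
  proof (rule abs_summable_summable, rule summable_on_comparison_test[OF es])
    fix \<gamma> :: "'n \<Rightarrow> nat"
    have "cmod (z $ i) * cmod (w $ i) \<le> sqrt t * sqrt t" for i
      using that Finite_Cartesian_Product.norm_nth_le[of z i] Finite_Cartesian_Product.norm_nth_le[of w i] t
      by (intro mult_mono) auto
    then show "norm (diag_term (inv_coef a) z w \<gamma>) \<le> ?e \<gamma>"
      using t by (intro norm_diag_term_le_power) simp
  qed auto
  then show ?thesis using t by (intro exI[of _ "sqrt t"]) auto
qed

text \<open>The points of the family may repeat, unlike in \<open>psd_kernel\<close>; Gram vectors
  make the form a sum of squared moduli in any case.\<close>

lemma psd_kernel_family:
  assumes "psd_kernel X G" "finite I" "\<And>i. i \<in> I \<Longrightarrow> x i \<in> X"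
  shows "(\<Sum>i\<in>I. \<Sum>j\<in>I. cnj (v i) * v j * G (x i) (x j)) \<in> \<real>\<^sub>\<ge>\<^sub>0"
proof -
  have "psd_kernel (x ` I) G" by (rule psd_kernel_subset[OF assms(1)]) (use assms(3) in auto)
  from psd_kernel_gram_vectors[OF _ this] assms(2) obtain m W
    where W: "\<And>z w. z \<in> x ` I \<Longrightarrow> w \<in> x ` I \<Longrightarrow> G z w = (\<Sum>c<(m::nat). W z c * cnj (W w c))" by blast
  have "(\<Sum>i\<in>I. \<Sum>j\<in>I. cnj (v i) * v j * G (x i) (x j))
      = (\<Sum>i\<in>I. \<Sum>j\<in>I. \<Sum>c<m. cnj (v i * cnj (W (x i) c)) * (v j * cnj (W (x j) c)))"
    by (intro sum.cong refl) (simp add: W sum_distrib_left mult_ac)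
  also have "\<dots> = (\<Sum>c<m. \<Sum>i\<in>I. \<Sum>j\<in>I. cnj (v i * cnj (W (x i) c)) * (v j * cnj (W (x j) c)))"
    by (rule sum_swap3)
  also have "\<dots> \<in> \<real>\<^sub>\<ge>\<^sub>0" by (intro nonneg_Reals_sum_I sum_sum_cnj_mult)
  finally show ?thesis .
qed

text \<open>Averaging in both variables yields a value of the quadratic form of \<open>G\<close>,
  hence a nonnegative number. As \<open>N\<close> grows it tends to \<open>b \<alpha>\<close> times
  a positive squared modulus.\<close>

lemma psd_kernel_diag_coef_nonneg:
  fixes b :: "('n::finite \<Rightarrow> nat) \<Rightarrow> real"
  assumes psd: "psd_kernel D G" and d: "d > 0" "ball 0 d \<subseteq> D"
    and G: "\<And>z w. z \<in> ball 0 d \<Longrightarrow> w \<in> ball 0 d \<Longrightarrow> (diag_term b z w has_sum G z w) UNIV"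
  shows "0 \<le> b \<alpha>"
proof -
  obtain \<rho> where \<rho>: "\<rho> > 0" "\<And>t. 0 \<le> t \<Longrightarrow> t \<le> \<rho> \<Longrightarrow> (\<chi> i. complex_of_real t :: complex ^ 'n) \<in> ball 0 d"
    using exists_positive_point_in_ball[OF d(1)] by blast
  define x where "x = (\<chi> i. complex_of_real \<rho> :: complex ^ 'n)"
  have x: "x \<in> ball 0 d" using \<rho> by (simp add: x_def)
  have rot: "torus_rotate N \<theta> y \<in> ball 0 d" if "y \<in> ball 0 d" for N \<theta> and y :: "complex ^ 'n" using that by simp
  define s where "s = (\<lambda>N. torus_average N \<alpha> (\<lambda>y. cnj (torus_average N \<alpha> (\<lambda>y'. cnj (G y y')) x)) x)"
  have sm: "(\<lambda>\<beta>. norm (diag_term b x x \<beta>)) summable_on UNIV" by (rule has_sum_imp_abs_summable[OF G[OF x x]])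
  have s_sum: "((\<lambda>\<beta>. if index_cong N \<alpha> \<beta> \<and> True then diag_term b x x \<beta> else 0) has_sum s N) UNIV" if "N > 0" for N
  proof -
    have inner: "((\<lambda>\<beta>. (if index_cong N \<alpha> \<beta> then of_real (b \<beta>) * cnj (multi_power x \<beta>) else 0) * multi_power y \<beta>)
        has_sum cnj (torus_average N \<alpha> (\<lambda>y'. cnj (G y y')) x)) UNIV" if y: "y \<in> ball 0 d" for y
    proof -
      have "((\<lambda>\<beta>. of_real (b \<beta>) * cnj (multi_power y \<beta>) * multi_power (torus_rotate N \<theta> x) \<beta>)
          has_sum cnj (G y (torus_rotate N \<theta> x))) UNIV" for \<theta>
        using G[OF y rot[OF x]] by (subst has_sum_cnj_iff[symmetric]) (simp add: mult_ac)
      from has_sum_torus_average[OF \<open>N > 0\<close>, of _ x "\<lambda>y'. cnj (G y y')" \<alpha>, OF this]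
      have "((\<lambda>\<beta>. if index_cong N \<alpha> \<beta> then of_real (b \<beta>) * cnj (multi_power y \<beta>) * multi_power x \<beta> else 0)
          has_sum torus_average N \<alpha> (\<lambda>y'. cnj (G y y')) x) UNIV" .
      then have "((\<lambda>\<beta>. cnj (if index_cong N \<alpha> \<beta> then of_real (b \<beta>) * cnj (multi_power y \<beta>) * multi_power x \<beta> else 0))
          has_sum cnj (torus_average N \<alpha> (\<lambda>y'. cnj (G y y')) x)) UNIV" by (simp only: has_sum_cnj_iff)
      moreover have "cnj (if index_cong N \<alpha> \<beta> then of_real (b \<beta>) * cnj (multi_power y \<beta>) * multi_power x \<beta> else 0)
          = (if index_cong N \<alpha> \<beta> then of_real (b \<beta>) * cnj (multi_power x \<beta>) else 0) * multi_power y \<beta>" for \<beta>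
        by simp
      ultimately show ?thesis by simp
    qed
    have "((\<lambda>\<beta>. if index_cong N \<alpha> \<beta> then (if index_cong N \<alpha> \<beta> then of_real (b \<beta>) * cnj (multi_power x \<beta>) else 0) * multi_power x \<beta> else 0)
        has_sum s N) UNIV"
      unfolding s_def by (rule has_sum_torus_average[OF that inner[OF rot[OF x]]])
    moreover have "(if index_cong N \<alpha> \<beta> then (if index_cong N \<alpha> \<beta> then of_real (b \<beta>) * cnj (multi_power x \<beta>) else 0) * multi_power x \<beta> else 0)
        = (if index_cong N \<alpha> \<beta> \<and> True then diag_term b x x \<beta> else 0)" for \<beta> by simp
    ultimately show ?thesis by simp
  qed
  have s_nonneg: "s N \<in> \<real>\<^sub>\<ge>\<^sub>0" for N
  proof -
    define v where "v = (\<lambda>\<theta>. multi_power (torus_point N \<theta>) \<alpha> / of_nat (N ^ CARD('n)))"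
    have "s N = (\<Sum>\<theta>\<in>torus_index N. \<Sum>\<theta>'\<in>torus_index N. cnj (v \<theta>) * v \<theta>' * G (torus_rotate N \<theta> x) (torus_rotate N \<theta>' x))"
      by (simp add: s_def torus_average_def v_def sum_distrib_left mult_ac)
    also have "\<dots> \<in> \<real>\<^sub>\<ge>\<^sub>0"
    proof (rule psd_kernel_family[OF psd])
      show "finite (torus_index N :: ('n \<Rightarrow> nat) set)" unfolding torus_index_def by (intro finite_PiE) auto
      show "torus_rotate N \<theta> x \<in> D" for \<theta> using rot[OF x] d(2) by blast
    qed
    finally show ?thesis .
  qed
  have "(\<lambda>n. s (Suc n)) \<longlonglongrightarrow> diag_term b x x \<alpha>"
  proof (rule Lim_null[THEN iffD2], rule Lim_null_comparison)
    show "\<forall>\<^sub>F n in sequentially. norm (s (Suc n) - diag_term b x x \<alpha>) \<le> aliasing (Suc n) \<alpha> (\<lambda>\<beta>. norm (diag_term b x x \<beta>))"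
      by (intro always_eventually allI norm_diff_le_aliasing[OF sm, where P = "\<lambda>_. True"] s_sum) auto
    show "(\<lambda>n. aliasing (Suc n) \<alpha> (\<lambda>\<beta>. norm (diag_term b x x \<beta>))) \<longlonglongrightarrow> 0"
      using LIMSEQ_Suc[OF aliasing_tendsto_0[OF sm]] by simp
  qed
  from tendsto_Re[OF this] have "0 \<le> Re (diag_term b x x \<alpha>)"
    by (rule tendsto_lowerbound) (use s_nonneg in \<open>auto simp: complex_nonneg_Reals_iff\<close>)
  also have "diag_term b x x \<alpha> = of_real (b \<alpha> * (\<rho> ^ sum \<alpha> UNIV)\<^sup>2)"
    by (simp add: x_def multi_power_const power2_eq_square mult.assoc)
  finally show ?thesis using \<rho>(1) by (simp add: zero_le_mult_iff)
qed

text \<open>The recursion subtracts nonnegative terms from \<open>a \<gamma>\<close>. At a unit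
  index \<open>inv_coef a\<close> equals \<open>a\<close>, so a unit index strictly below \<gamma>
  contributes a positive term and makes the inequality strict.\<close>

lemma inv_coef_le:
  fixes a :: "('n::finite \<Rightarrow> nat) \<Rightarrow> real"
  assumes a: "\<And>\<alpha>. 0 < a \<alpha>" and b: "\<And>\<alpha>. 0 \<le> inv_coef a \<alpha>"
  shows "inv_coef a \<gamma> \<le> a \<gamma>"
    and "unit_index i \<le> \<gamma> \<Longrightarrow> unit_index i \<noteq> \<gamma> \<Longrightarrow> inv_coef a \<gamma> < a \<gamma>"
proof -
  let ?P = "\<lambda>\<gamma>. {\<beta>. \<beta> \<le> \<gamma> \<and> \<beta> \<noteq> \<gamma>}"
  have finP: "finite (?P \<gamma>)"
    by (rule finite_subset[OF _ finite_le_multi_index[of \<gamma>]]) auto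
  have nn: "0 \<le> inv_coef a \<beta> * a (\<gamma> - \<beta>)" for \<beta> using a b by (simp add: less_imp_le)
  show "inv_coef a \<gamma> \<le> a \<gamma>"
    using sum_nonneg[of "?P \<gamma>" "\<lambda>\<beta>. inv_coef a \<beta> * a (\<gamma> - \<beta>)"] nn a[of \<gamma>] inv_coef.simps[of a \<gamma>]
    by (simp add: less_imp_le split: if_splits)
  assume i: "unit_index i \<le> \<gamma>" "unit_index i \<noteq> \<gamma>"
  have "?P (unit_index i) \<subseteq> {\<lambda>_. 0}"
  proof
    fix \<beta> assume "\<beta> \<in> ?P (unit_index i)"
    then have \<beta>: "\<beta> \<le> unit_index i" "\<beta> \<noteq> unit_index i" by auto
    have off: "\<beta> j = 0" if "j \<noteq> i" for j using le_funD[OF \<beta>(1), of j] that by (simp add: unit_index_def)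
    have "\<beta> i \<noteq> 1"
    proof
      assume "\<beta> i = 1"
      then have "\<beta> = unit_index i" using off by (auto simp: unit_index_def fun_eq_iff)
      then show False using \<beta>(2) by simp
    qed
    then have "\<beta> i = 0" using le_funD[OF \<beta>(1), of i] by (simp add: unit_index_def)
    then have "\<beta> j = 0" for j using off by (cases "j = i") auto
    then show "\<beta> \<in> {\<lambda>_. 0}" by auto
  qed
  then have "(\<Sum>\<beta>\<in>?P (unit_index i). inv_coef a \<beta> * a (unit_index i - \<beta>)) = 0"
    by (intro sum.neutral) (auto simp: inv_coef_0)
  then have "inv_coef a (unit_index i) = a (unit_index i)"
    using inv_coef.simps[of a "unit_index i"] unit_index_nonzero[of i] by simp
  then have "0 < inv_coef a (unit_index i) * a (\<gamma> - unit_index i)" using a by simp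
  moreover have "\<dots> \<le> (\<Sum>\<beta>\<in>?P \<gamma>. inv_coef a \<beta> * a (\<gamma> - \<beta>))"
    using i finP nn by (intro member_le_sum) auto
  moreover have "inv_coef a \<gamma> = a \<gamma> - (\<Sum>\<beta>\<in>?P \<gamma>. inv_coef a \<beta> * a (\<gamma> - \<beta>))"
    using inv_coef.simps[of a \<gamma>] unit_index_le_nonzero[OF i(1)] by simp
  ultimately show "inv_coef a \<gamma> < a \<gamma>" by linarith
qed

lemma multi_power_zero_point: "\<gamma> \<noteq> (\<lambda>_. 0) \<Longrightarrow> multi_power 0 \<gamma> = 0"
  by (auto simp: multi_power_def)

text \<open>At a unit index the two families coincide, which is why the strict inequality is
  restricted to indices strictly above one.\<close>

definition pick_coefficients :: "(complex ^ 'd::finite) set \<Rightarrow> (complex ^ 'd \<Rightarrow> complex ^ 'd \<Rightarrow> complex)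
    \<Rightarrow> (('d \<Rightarrow> nat) \<Rightarrow> real) \<Rightarrow> (('d \<Rightarrow> nat) \<Rightarrow> real) \<Rightarrow> bool" where
  "pick_coefficients \<Omega> s a b \<longleftrightarrow>
     (\<forall>\<alpha>. 0 < a \<alpha> \<and> 0 \<le> b \<alpha> \<and> b \<alpha> \<le> a \<alpha>) \<and> a (\<lambda>_. 0) = 1 \<and> b (\<lambda>_. 0) = 0 \<and>
     (\<forall>i \<gamma>. unit_index i \<le> \<gamma> \<longrightarrow> unit_index i \<noteq> \<gamma> \<longrightarrow> b \<gamma> < a \<gamma>) \<and>
     (\<forall>z\<in>\<Omega>. \<forall>w\<in>\<Omega>. s z w \<noteq> 0 \<and> (diag_term a z w has_sum s z w) UNIV \<and>
        (diag_term b z w has_sum (1 - 1 / s z w)) UNIV)"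

text \<open>Normalization makes \<open>s z 0\<close> and \<open>s 0 w\<close> equal to 1, so the
  Pick inequality with base point 0 says that \<open>1 - 1/s\<close> is positive semidefinite. The
  sign of its coefficients is read off near the origin.\<close>

proposition pick_kernel_coefficients:
  fixes \<Omega> :: "(complex ^ 'd::finite) set"
  assumes dom: "domain_Cn \<Omega>" and s: "normalized_diagonal_holomorphic_kernel \<Omega> s"
    and irr: "irreducible_kernel \<Omega> s" and pick: "complete_pick_kernel \<Omega> s"
  shows "\<exists>a b. pick_coefficients \<Omega> s a b"
proof -
  obtain a where hol: "holomorphic_kernel \<Omega> s" and ex: "diagonal_expansion \<Omega> s a" and a0: "a (\<lambda>_. 0) = 1"
    using s unfolding normalized_diagonal_holomorphic_kernel_def by blast
  obtain H ip where H: "rkhs \<Omega> s H ip" using pick unfolding complete_pick_kernel_def by blast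
  obtain r where a: "\<And>\<alpha>. 0 < a \<alpha>" and r: "r > 0" "ball 0 r \<subseteq> \<Omega>" using ex unfolding diagonal_expansion_def by blast
  have sum_s: "(diag_term a z w has_sum s z w) UNIV" if "z \<in> \<Omega>" "w \<in> \<Omega>" for z w
    using dom hol H ex that by (rule diagonal_expansion_global)
  have nz: "s z w \<noteq> 0" if "z \<in> \<Omega>" "w \<in> \<Omega>" for z w using irr that unfolding irreducible_kernel_def by blast
  have O: "0 \<in> \<Omega>" using r by auto
  have s0: "s z 0 = 1" "s 0 z = 1" if "z \<in> \<Omega>" for z
  proof -
    have "(diag_term a z 0 has_sum 1) UNIV" "(diag_term a 0 z has_sum 1) UNIV"
      by (rule has_sum_finite_neutralI[of "{\<lambda>_. 0}"]; auto simp: a0 multi_power_0 multi_power_zero_point)+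
    then show "s z 0 = 1" "s 0 z = 1" using sum_s[OF that O] sum_s[OF O that] has_sum_unique by blast+
  qed
  have psd: "psd_kernel \<Omega> (\<lambda>z w. 1 - 1 / s z w)"
    unfolding psd_kernel_def
  proof (intro allI impI)
    fix F and c :: "complex ^ 'd \<Rightarrow> complex" assume F: "finite F \<and> F \<subseteq> \<Omega>"
    then have "psd_kernel F (\<lambda>z w. 1 - s z 0 * s 0 w / (s 0 0 * s z w))"
      using O by (intro complete_pick_psd[OF pick nz]) auto
    then have "(\<Sum>x\<in>F. \<Sum>y\<in>F. cnj (c x) * c y * (1 - s x 0 * s 0 y / (s 0 0 * s x y))) \<in> \<real>\<^sub>\<ge>\<^sub>0"
      using F unfolding psd_kernel_def by blast
    also have "(\<Sum>x\<in>F. \<Sum>y\<in>F. cnj (c x) * c y * (1 - s x 0 * s 0 y / (s 0 0 * s x y)))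
        = (\<Sum>x\<in>F. \<Sum>y\<in>F. cnj (c x) * c y * (1 - 1 / s x y))"
      using F O by (intro sum.cong refl) (auto simp: s0 subset_iff)
    finally show "(\<Sum>x\<in>F. \<Sum>y\<in>F. cnj (c x) * c y * (1 - 1 / s x y)) \<in> \<real>\<^sub>\<ge>\<^sub>0" .
  qed
  define b where "b = inv_coef a"
  have "\<exists>d>0. \<forall>z\<in>ball 0 d. \<forall>w\<in>ball 0 d. diag_term b z w summable_on UNIV"
    unfolding b_def
  proof (rule inv_coef_summable_near_0[OF less_imp_le[OF a] r(1)])
    fix z :: "complex ^ 'd" assume "z \<in> ball 0 r"
    then have "z \<in> \<Omega>" using r(2) by blast
    then show "diag_term a z z summable_on UNIV" using sum_s has_sum_imp_summable by blast
  qed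
  then obtain d0 where d0: "d0 > 0" "\<forall>z\<in>ball 0 d0. \<forall>w\<in>ball 0 d0. diag_term b z w summable_on UNIV"
    by (elim exE conjE)
  define d where "d = min d0 r"
  have d: "d > 0" "ball 0 d \<subseteq> \<Omega>" using d0 r by (auto simp: d_def)
  have b_nonneg: "0 \<le> b \<alpha>" for \<alpha>
  proof (rule psd_kernel_diag_coef_nonneg[OF psd d])
    fix z w :: "complex ^ 'd" assume zw: "z \<in> ball 0 d" "w \<in> ball 0 d"
    then have zw': "z \<in> \<Omega>" "w \<in> \<Omega>" using d(2) by blast+
    show "(diag_term b z w has_sum (1 - 1 / s z w)) UNIV"
      unfolding b_def using zw d0(2)
      by (intro has_sum_inv_coef[OF a0 sum_s[OF zw'] nz[OF zw']]) (auto simp: d_def b_def)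
  qed
  have b_le: "b \<alpha> \<le> a \<alpha>" for \<alpha>
    using inv_coef_le(1)[of a, OF a] b_nonneg by (simp add: b_def)
  have b_less: "b \<gamma> < a \<gamma>" if "unit_index i \<le> \<gamma>" "unit_index i \<noteq> \<gamma>" for \<gamma> i
    using inv_coef_le(2)[of a, OF a _ that] b_nonneg by (simp add: b_def)
  \<comment> \<open>With both bounds on \<open>b\<close> at hand, the series of \<open>s\<close>
    dominates on all of \<open>\<Omega>\<close>.\<close>
  have sum_b: "(diag_term b z w has_sum (1 - 1 / s z w)) UNIV" if zw: "z \<in> \<Omega>" "w \<in> \<Omega>" for z w
    unfolding b_def
  proof (rule has_sum_inv_coef[OF a0 sum_s[OF zw] nz[OF zw]])
    show "diag_term (inv_coef a) z w summable_on UNIV"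
    proof (rule abs_summable_summable, rule summable_on_comparison_test[OF has_sum_imp_abs_summable[OF sum_s[OF zw]]])
      fix \<gamma> :: "'d \<Rightarrow> nat"
      have "\<bar>inv_coef a \<gamma>\<bar> \<le> \<bar>a \<gamma>\<bar>" using b_le[of \<gamma>] b_nonneg[of \<gamma>] by (simp add: b_def)
      then show "norm (diag_term (inv_coef a) z w \<gamma>) \<le> norm (diag_term a z w \<gamma>)"
        by (simp add: norm_mult mult_right_mono)
    qed auto
  qed
  show ?thesis
    by (rule exI[of _ a], rule exI[of _ b], unfold pick_coefficients_def)
      (use a a0 b_nonneg b_le b_less sum_s sum_b nz in \<open>auto simp: b_def inv_coef_0\<close>)
qed

section \<open>Products of kernels\<close>

text \<open>Two lower bounds for one nonnegative convolution. The sum collects the terms where a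
  single factor carries all of \<gamma> and is compared with the sum of the \<open>b j\<close>; the
  product keeps one chosen splitting of \<gamma> and yields positivity of \<open>A\<close>.\<close>

lemma product_expansion:
  fixes a :: "'p \<Rightarrow> ('n::finite \<Rightarrow> nat) \<Rightarrow> real"
  assumes nn: "\<And>j \<gamma>. 0 \<le> a j \<gamma>" and a0: "\<And>j. a j (\<lambda>_. 0) = 1"
    and sum_S: "\<And>j z w. z \<in> D \<Longrightarrow> w \<in> D \<Longrightarrow> (diag_term (a j) z w has_sum S j z w) UNIV"
    and "finite J"
  shows "\<exists>A. A (\<lambda>_. 0) = 1 \<and> (\<forall>\<gamma>. 0 \<le> A \<gamma>) \<and> (\<forall>\<gamma>. \<gamma> \<noteq> (\<lambda>_. 0) \<longrightarrow> (\<Sum>j\<in>J. a j \<gamma>) \<le> A \<gamma>) \<and>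
    (\<forall>\<beta> :: 'p \<Rightarrow> 'n \<Rightarrow> nat. (\<Prod>j\<in>J. a j (\<beta> j)) \<le> A (\<lambda>i. \<Sum>j\<in>J. \<beta> j i)) \<and>
    (\<forall>z\<in>D. \<forall>w\<in>D. (diag_term A z w has_sum (\<Prod>j\<in>J. S j z w)) UNIV)"
  using \<open>finite J\<close>
proof (induction J rule: finite_induct)
  case empty
  have "(diag_term (\<lambda>\<gamma>. if \<gamma> = (\<lambda>_. 0) then 1 else 0) z w has_sum 1) UNIV" for z w :: "complex ^ 'n"
    by (rule has_sum_finite_neutralI[of "{\<lambda>_. 0}"]) (auto simp: multi_power_0)
  then show ?case by (intro exI[of _ "\<lambda>\<gamma>. if \<gamma> = (\<lambda>_. 0) then 1 else 0"]) auto
next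
  case (insert j J)
  then obtain A where A: "A (\<lambda>_. 0) = 1" "\<And>\<gamma>. 0 \<le> A \<gamma>" "\<And>\<gamma>. \<gamma> \<noteq> (\<lambda>_. 0) \<Longrightarrow> (\<Sum>j\<in>J. a j \<gamma>) \<le> A \<gamma>"
    "\<And>\<beta> :: 'p \<Rightarrow> 'n \<Rightarrow> nat. (\<Prod>j\<in>J. a j (\<beta> j)) \<le> A (\<lambda>i. \<Sum>j\<in>J. \<beta> j i)"
    "\<And>z w. z \<in> D \<Longrightarrow> w \<in> D \<Longrightarrow> (diag_term A z w has_sum (\<Prod>j\<in>J. S j z w)) UNIV"
    by blast
  define A' where "A' = conv A (a j)"
  have nn': "0 \<le> A \<beta> * a j (\<gamma> - \<beta>)" for \<beta> \<gamma> using A(2) nn by simp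
  have "A' (\<lambda>_. 0) = 1" by (simp add: A'_def conv_zero A a0)
  moreover have "0 \<le> A' \<gamma>" for \<gamma> unfolding A'_def conv_def using nn' by (intro sum_nonneg)
  moreover have "(\<Sum>j\<in>insert j J. a j \<gamma>) \<le> A' \<gamma>" if "\<gamma> \<noteq> (\<lambda>_. 0)" for \<gamma>
  proof -
    have "0 \<le> (\<Sum>\<beta>\<in>{\<beta>. \<beta> \<le> \<gamma>} - {\<lambda>_. 0, \<gamma>}. A \<beta> * a j (\<gamma> - \<beta>))" using nn' by (intro sum_nonneg)
    then show ?thesis unfolding A'_def conv_split[OF that] using A(1) A(3)[OF that] a0 insert.hyps by simp
  qed
  moreover have "(\<Prod>j\<in>insert j J. a j (\<beta> j)) \<le> A' (\<lambda>i. \<Sum>j\<in>insert j J. \<beta> j i)" for \<beta> :: "'p \<Rightarrow> 'n \<Rightarrow> nat"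
  proof -
    define \<sigma> where "\<sigma> = (\<lambda>i. \<Sum>j\<in>J. \<beta> j i)"
    define \<tau> where "\<tau> = (\<lambda>i. \<Sum>j\<in>insert j J. \<beta> j i)"
    have "\<sigma> \<le> \<tau>" "\<tau> - \<sigma> = \<beta> j" using insert.hyps by (auto simp: \<sigma>_def \<tau>_def le_fun_def fun_eq_iff)
    have "(\<Prod>j\<in>insert j J. a j (\<beta> j)) \<le> A \<sigma> * a j (\<tau> - \<sigma>)"
      using insert.hyps A(4)[of \<beta>] nn \<open>\<tau> - \<sigma> = \<beta> j\<close> by (simp add: \<sigma>_def mult.commute mult_left_mono)
    also have "\<dots> \<le> A' \<tau>"
      unfolding A'_def conv_def using \<open>\<sigma> \<le> \<tau>\<close> finite_le_multi_index nn'
      by (intro member_le_sum[of \<sigma> _ "\<lambda>\<sigma>. A \<sigma> * a j (\<tau> - \<sigma>)"]) auto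
    finally show ?thesis by (simp add: \<tau>_def)
  qed
  moreover have "(diag_term A' z w has_sum (\<Prod>j\<in>insert j J. S j z w)) UNIV" if "z \<in> D" "w \<in> D" for z w
  proof -
    have "conv (\<lambda>\<alpha>. complex_of_real (A \<alpha>)) (\<lambda>\<alpha>. complex_of_real (a j \<alpha>)) \<gamma> = of_real (A' \<gamma>)" for \<gamma>
      by (simp add: conv_def A'_def)
    then show ?thesis
      using has_sum_conv_diag[OF A(5)[OF that] sum_S[OF that, of j]] insert.hyps by (simp add: mult.commute)
  qed
  ultimately show ?case by (intro exI[of _ A'] conjI allI impI ballI)
qed

text \<open>Individual factors may have zero coefficients, as tensor factors do. Positivity for the
  product therefore comes from a splitting in \<open>decomp\<close>, and \<open>strict\<close>
  admits indices at which all the \<open>b j\<close> vanish.\<close>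

proposition weighted_composition_iff_product_kernel:
  fixes D :: "(complex ^ 'n::finite) set" and S :: "'p::finite \<Rightarrow> complex ^ 'n \<Rightarrow> complex ^ 'n \<Rightarrow> complex"
    and a b :: "'p \<Rightarrow> ('n \<Rightarrow> nat) \<Rightarrow> real"
  assumes H: "rkhs D k H ip" and D: "open D" "0 \<in> D"
    and T: "bounded_operator H ip T" and nz: "\<And>z. z \<in> D \<Longrightarrow> T (one_on D) z \<noteq> 0"
    and eval: "multiplicative_functionals_are_evaluations D H"
    and k: "\<And>z w. z \<in> D \<Longrightarrow> w \<in> D \<Longrightarrow> k z w = (\<Prod>j\<in>UNIV. S j z w)"
    and S: "\<And>j z w. z \<in> D \<Longrightarrow> w \<in> D \<Longrightarrow> S j z w \<noteq> 0"
    and sum_a: "\<And>j z w. z \<in> D \<Longrightarrow> w \<in> D \<Longrightarrow> (diag_term (a j) z w has_sum S j z w) UNIV"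
    and sum_b: "\<And>j z w. z \<in> D \<Longrightarrow> w \<in> D \<Longrightarrow> (diag_term (b j) z w has_sum (1 - 1 / S j z w)) UNIV"
    and a0: "\<And>j. a j (\<lambda>_. 0) = 1" and b0: "\<And>j. b j (\<lambda>_. 0) = 0"
    and b: "\<And>j \<gamma>. 0 \<le> b j \<gamma>" and ba: "\<And>j \<gamma>. b j \<gamma> \<le> a j \<gamma>"
    and decomp: "\<And>\<gamma>. \<exists>\<beta>. \<gamma> = (\<lambda>i. \<Sum>j\<in>UNIV. \<beta> j i) \<and> (\<Prod>j\<in>UNIV. a j (\<beta> j)) > 0"
    and strict: "\<And>i \<gamma>. unit_index i \<le> \<gamma> \<Longrightarrow> unit_index i \<noteq> \<gamma> \<Longrightarrow> (\<exists>j. b j \<gamma> < a j \<gamma>) \<or> (\<forall>j. b j \<gamma> = 0)"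
  shows "weighted_composition_operator D H ip T \<longleftrightarrow>
    (\<forall>w\<in>D. \<forall>z\<in>D. T (kernel_fun D k w) z * (\<Prod>j\<in>UNIV. T (zext D (\<lambda>z. 1 / S j z w)) z) = (T (one_on D) z) ^ (CARD('p) + 1))"
proof -
  have nn: "0 \<le> a j \<gamma>" for j \<gamma> using b ba order_trans by blast
  have "\<exists>A. A (\<lambda>_. 0) = 1 \<and> (\<forall>\<gamma>. 0 \<le> A \<gamma>) \<and> (\<forall>\<gamma>. \<gamma> \<noteq> (\<lambda>_. 0) \<longrightarrow> (\<Sum>j\<in>UNIV. a j \<gamma>) \<le> A \<gamma>) \<and>
    (\<forall>\<beta> :: 'p \<Rightarrow> 'n \<Rightarrow> nat. (\<Prod>j\<in>UNIV. a j (\<beta> j)) \<le> A (\<lambda>i. \<Sum>j\<in>UNIV. \<beta> j i)) \<and>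
    (\<forall>z\<in>D. \<forall>w\<in>D. (diag_term A z w has_sum (\<Prod>j\<in>UNIV. S j z w)) UNIV)"
    using nn a0 sum_a finite by (rule product_expansion)
  then obtain A where A0: "A (\<lambda>_. 0) = 1" and A_sum: "\<And>\<gamma>. \<gamma> \<noteq> (\<lambda>_. 0) \<Longrightarrow> (\<Sum>j\<in>UNIV. a j \<gamma>) \<le> A \<gamma>"
    and A_prod: "\<And>\<beta> :: 'p \<Rightarrow> 'n \<Rightarrow> nat. (\<Prod>j\<in>UNIV. a j (\<beta> j)) \<le> A (\<lambda>i. \<Sum>j\<in>UNIV. \<beta> j i)"
    and A: "\<And>z w. z \<in> D \<Longrightarrow> w \<in> D \<Longrightarrow> (diag_term A z w has_sum (\<Prod>j\<in>UNIV. S j z w)) UNIV"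
    by blast
  have A_pos: "0 < A \<gamma>" for \<gamma> using decomp[of \<gamma>] A_prod less_le_trans by metis
  obtain r where r: "r > 0" "ball 0 r \<subseteq> D" using D openE by blast
  interpret diagonal_rkhs D k H ip A r
    by (intro diagonal_rkhs.intro H diagonal_rkhs_axioms.intro D r A_pos) (simp add: k A)
  show ?thesis
  proof (rule weighted_composition_iff_product[where b = b and S = S and T = T, OF T nz eval A0 b0 b])
    show "b j \<gamma> \<le> A \<gamma>" for j \<gamma>
    proof (cases "\<gamma> = (\<lambda>_. 0)")
      case False
      have "b j \<gamma> \<le> a j \<gamma>" by (rule ba)
      also have "\<dots> \<le> (\<Sum>j\<in>UNIV. a j \<gamma>)" using nn by (intro member_le_sum) auto
      also have "\<dots> \<le> A \<gamma>" by (rule A_sum[OF False])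
      finally show ?thesis .
    qed (simp add: A0 b0)
    show "(\<Sum>j\<in>UNIV. b j \<gamma>) < A \<gamma>" if i: "unit_index i \<le> \<gamma>" "unit_index i \<noteq> \<gamma>" for \<gamma> i
    proof (cases "\<forall>j. b j \<gamma> = 0")
      case True
      then show ?thesis using A_pos by simp
    next
      case False
      then have "(\<Sum>j\<in>UNIV. b j \<gamma>) < (\<Sum>j\<in>UNIV. a j \<gamma>)"
        using strict[OF i] ba by (intro sum_strict_mono_ex1) auto
      also have "\<dots> \<le> A \<gamma>" by (rule A_sum[OF unit_index_le_nonzero[OF i(1)]])
      finally show ?thesis .
    qed
    show "k z w * (\<Prod>j\<in>UNIV. 1 / S j z w) = 1" if "z \<in> D" "w \<in> D" for z w
      using S[OF that] by (simp add: k that prod_dividef)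
  qed (use sum_b in blast)+
qed

section \<open>Tensor factors as functions of all blocks, and the three equivalences\<close>

definition embed_index :: "'p \<Rightarrow> ('d \<Rightarrow> nat) \<Rightarrow> 'p \<times> 'd \<Rightarrow> nat" where
  "embed_index j \<alpha> = (\<lambda>(j', i). if j' = j then \<alpha> i else 0)"

definition restrict_index :: "'p \<Rightarrow> ('p \<times> 'd \<Rightarrow> nat) \<Rightarrow> 'd \<Rightarrow> nat" where
  "restrict_index j \<gamma> = (\<lambda>i. \<gamma> (j, i))"

text \<open>A function of the \<open>j\<close>-th block alone, expanded on the power domain: indices
  with a nonzero entry in another block have coefficient 0.\<close>

definition embed_coef :: "'p \<Rightarrow> (('d \<Rightarrow> nat) \<Rightarrow> real) \<Rightarrow> ('p \<times> 'd \<Rightarrow> nat) \<Rightarrow> real" where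
  "embed_coef j c \<gamma> = (if \<gamma> \<in> range (embed_index j) then c (restrict_index j \<gamma>) else 0)"

lemma restrict_embed_index [simp]: "restrict_index j (embed_index j \<alpha>) = \<alpha>"
  by (simp add: restrict_index_def embed_index_def)

lemma embed_coef_embed_index [simp]: "embed_coef j c (embed_index j \<alpha>) = c \<alpha>"
  by (simp add: embed_coef_def)

lemma embed_index_0: "embed_index j (\<lambda>_. 0) = (\<lambda>_. 0)"
  by (auto simp: embed_index_def)

lemma multi_power_embed_index:
  fixes z :: "complex ^ ('p::finite \<times> 'd::finite)"
  shows "multi_power z (embed_index j \<alpha>) = multi_power (block j z) \<alpha>"
proof -
  have "multi_power z (embed_index j \<alpha>) = (\<Prod>j'\<in>UNIV. \<Prod>i\<in>UNIV. z $ (j', i) ^ (if j' = j then \<alpha> i else 0))"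
    unfolding multi_power_def embed_index_def UNIV_Times_UNIV[symmetric] prod.cartesian_product
    by (rule prod.cong) auto
  also have "\<dots> = (\<Prod>j'\<in>UNIV. if j' = j then \<Prod>i\<in>UNIV. z $ (j, i) ^ \<alpha> i else 1)"
    by (intro prod.cong) auto
  also have "\<dots> = multi_power (block j z) \<alpha>"
    by (simp add: multi_power_def block_def)
  finally show ?thesis .
qed

lemma has_sum_embed_coef:
  assumes "(diag_term c (block j z) (block j w) has_sum s) UNIV"
  shows "(diag_term (embed_coef j c) z w has_sum s) UNIV"
proof -
  have inj: "inj (embed_index j)" by (rule inj_on_inverseI[where g = "restrict_index j"]) simp
  have "(diag_term (embed_coef j c) z w has_sum s) (range (embed_index j))"
    using assms by (subst has_sum_reindex[OF inj]) (simp add: comp_def multi_power_embed_index)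
  then show ?thesis
    by (rule has_sum_cong_neutral[THEN iffD1, rotated -1]) (auto simp: embed_coef_def)
qed

theorem theorem4:
  shows
   "(\<forall>(D :: (complex ^ 'n) set) k H ip T.
       domain_Cn D \<and> holomorphic_kernel D k \<and> rkhs D k H ip \<and>
       multiplicative_functionals_are_evaluations D H \<and>
       bounded_operator H ip T \<and> (\<forall>z\<in>D. T (one_on D) z \<noteq> 0) \<and>
       0 \<in> D \<and> diagonal_holomorphic_kernel D k \<and>
       (\<forall>w\<in>D. zext D (\<lambda>z. (k z w)\<^sup>2) \<in> H)
       \<longrightarrow>
       (weighted_composition_operator D H ip T \<longleftrightarrow>
        (\<forall>w\<in>D. \<forall>z\<in>D.
           T (zext D (\<lambda>z. (k z w)\<^sup>2)) z * T (one_on D) z = (T (kernel_fun D k w) z)\<^sup>2)))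
    \<and>
    (\<forall>(\<Omega> :: (complex ^ 'd) set) (s :: 'p :: finite \<Rightarrow> complex ^ 'd \<Rightarrow> complex ^ 'd \<Rightarrow> complex) k H ip T.
       domain_Cn \<Omega> \<and> holomorphic_kernel \<Omega> k \<and> rkhs \<Omega> k H ip \<and>
       multiplicative_functionals_are_evaluations \<Omega> H \<and>
       bounded_operator H ip T \<and> (\<forall>z\<in>\<Omega>. T (one_on \<Omega>) z \<noteq> 0) \<and>
       0 \<in> \<Omega> \<and>
       (\<forall>j. normalized_diagonal_holomorphic_kernel \<Omega> (s j) \<and>
            irreducible_kernel \<Omega> (s j) \<and> complete_pick_kernel \<Omega> (s j)) \<and>
       (\<forall>z\<in>\<Omega>. \<forall>w\<in>\<Omega>. k z w = schur_product s z w)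
       \<longrightarrow>
       (weighted_composition_operator \<Omega> H ip T \<longleftrightarrow>
        (\<forall>w\<in>\<Omega>. \<forall>z\<in>\<Omega>.
           T (kernel_fun \<Omega> k w) z * (\<Prod>j\<in>UNIV. T (zext \<Omega> (\<lambda>z. 1 / s j z w)) z)
             = (T (one_on \<Omega>) z) ^ (CARD('p) + 1))))
    \<and>
    (\<forall>(\<Omega> :: (complex ^ 'd) set) (s :: 'p :: finite \<Rightarrow> complex ^ 'd \<Rightarrow> complex ^ 'd \<Rightarrow> complex)
      (D :: (complex ^ ('p \<times> 'd)) set) k H ip T.
       domain_Cn D \<and> holomorphic_kernel D k \<and> rkhs D k H ip \<and>
       multiplicative_functionals_are_evaluations D H \<and>
       bounded_operator H ip T \<and> (\<forall>z\<in>D. T (one_on D) z \<noteq> 0) \<and>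
       domain_Cn \<Omega> \<and> 0 \<in> \<Omega> \<and> D = power_domain \<Omega> \<and>
       (\<forall>j. normalized_diagonal_holomorphic_kernel \<Omega> (s j) \<and>
            irreducible_kernel \<Omega> (s j) \<and> complete_pick_kernel \<Omega> (s j)) \<and>
       (\<forall>z\<in>D. \<forall>w\<in>D. k z w = tensor_product s z w)
       \<longrightarrow>
       (weighted_composition_operator D H ip T \<longleftrightarrow>
        (\<forall>w\<in>D. \<forall>z\<in>D.
           T (kernel_fun D k w) z *
             (\<Prod>j\<in>UNIV. T (zext D (\<lambda>z. 1 / s j (block j z) (block j w))) z)
             = (T (one_on D) z) ^ (CARD('p) + 1))))"
proof (intro conjI allI impI, goal_cases)
  case as: (1 D k H ip T)
  then obtain a where a: "diagonal_expansion D k a" unfolding diagonal_holomorphic_kernel_def by blast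
  then obtain r where r: "r > 0" "ball 0 r \<subseteq> D" and a_pos: "\<And>\<alpha>. a \<alpha> > 0" unfolding diagonal_expansion_def by blast
  have dom: "domain_Cn D" "holomorphic_kernel D k" "rkhs D k H ip" using as by auto
  interpret diagonal_rkhs D k H ip a r
    by (intro diagonal_rkhs.intro diagonal_rkhs_axioms.intro dom r a_pos diagonal_expansion_global[OF dom a])
      (use dom in \<open>simp_all add: domain_Cn_def\<close>)
  show ?case
    by (rule weighted_composition_iff_square) (use as in auto)
next
  case as: (2 \<Omega> s k H ip T)
  then have "\<forall>j. \<exists>a b. pick_coefficients \<Omega> (s j) a b"
    using pick_kernel_coefficients by blast
  then obtain a b where ab: "\<And>j. pick_coefficients \<Omega> (s j) (a j) (b j)" by metis
  note ab' = ab[unfolded pick_coefficients_def]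
  show ?case
  proof (rule weighted_composition_iff_product_kernel[where a = a and b = b])
    show "\<exists>\<beta>. \<gamma> = (\<lambda>i. \<Sum>j\<in>UNIV. \<beta> j i) \<and> (\<Prod>j\<in>UNIV. a j (\<beta> j)) > 0" for \<gamma>
    proof -
      \<comment> \<open>One arbitrary factor takes all of \<gamma>; here every coefficient of every
        factor is positive.\<close>
      define j0 where "j0 = (undefined :: 'p)"
      define \<beta> where "\<beta> = (\<lambda>j i. if j = j0 then \<gamma> i else 0)"
      have "\<gamma> = (\<lambda>i. \<Sum>j\<in>UNIV. \<beta> j i)" by (simp add: \<beta>_def)
      moreover have "(\<Prod>j\<in>UNIV. a j (\<beta> j)) > 0" using ab' by (intro prod_pos) auto
      ultimately show ?thesis by blast
    qed
    show "(\<exists>j. b j \<gamma> < a j \<gamma>) \<or> (\<forall>j. b j \<gamma> = 0)" if "unit_index i \<le> \<gamma>" "unit_index i \<noteq> \<gamma>" for i \<gamma>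
      using ab' that by blast
  qed (use as ab' in \<open>auto simp: domain_Cn_def schur_product_def\<close>)
next
  case as: (3 \<Omega> s D k H ip T)
  then have "\<forall>j. \<exists>a b. pick_coefficients \<Omega> (s j) a b"
    using pick_kernel_coefficients by blast
  then obtain a b where ab: "\<And>j. pick_coefficients \<Omega> (s j) (a j) (b j)" by metis
  note ab' = ab[unfolded pick_coefficients_def]
  have blk: "block j z \<in> \<Omega>" if "z \<in> D" for j z using as that by (simp add: power_domain_def)
  have D0: "0 \<in> D"
  proof -
    have "block j (0 :: complex ^ ('p \<times> 'd)) = 0" for j by (simp add: block_def vec_eq_iff)
    then show ?thesis using as by (simp add: power_domain_def)
  qed
  show ?case
  proof (rule weighted_composition_iff_product_kernel[where S = "\<lambda>j z w. s j (block j z) (block j w)"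
        and a = "\<lambda>j. embed_coef j (a j)" and b = "\<lambda>j. embed_coef j (b j)"])
    show "(diag_term (embed_coef j (a j)) z w has_sum s j (block j z) (block j w)) UNIV" if "z \<in> D" "w \<in> D" for j z w
      using ab' blk that by (intro has_sum_embed_coef) blast
    show "(diag_term (embed_coef j (b j)) z w has_sum (1 - 1 / s j (block j z) (block j w))) UNIV"
      if "z \<in> D" "w \<in> D" for j z w
      using ab' blk that by (intro has_sum_embed_coef) blast
    show "s j (block j z) (block j w) \<noteq> 0" if "z \<in> D" "w \<in> D" for j z w
      using ab' blk that by blast
    show "embed_coef j (a j) (\<lambda>_. 0) = 1" for j
      using embed_coef_embed_index[of j "a j" "\<lambda>_. 0"] ab' by (simp add: embed_index_0)
    show "embed_coef j (b j) (\<lambda>_. 0) = 0" for j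
      using embed_coef_embed_index[of j "b j" "\<lambda>_. 0"] ab' by (simp add: embed_index_0)
    show "0 \<le> embed_coef j (b j) \<gamma>" "embed_coef j (b j) \<gamma> \<le> embed_coef j (a j) \<gamma>" for j \<gamma>
      using ab' by (auto simp: embed_coef_def)
    show "\<exists>\<beta>. \<gamma> = (\<lambda>i. \<Sum>j\<in>UNIV. \<beta> j i) \<and> (\<Prod>j\<in>UNIV. embed_coef j (a j) (\<beta> j)) > 0" for \<gamma> :: "'p \<times> 'd \<Rightarrow> nat"
    proof -
      \<comment> \<open>Each factor takes the part of \<gamma> in its own block, where its
        coefficients are positive.\<close>
      define \<beta> where "\<beta> = (\<lambda>j. embed_index j (restrict_index j \<gamma>))"
      have "\<gamma> i = (\<Sum>j\<in>UNIV. \<beta> j i)" for i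
        by (cases i) (simp add: \<beta>_def embed_index_def restrict_index_def)
      moreover have "(\<Prod>j\<in>UNIV. embed_coef j (a j) (\<beta> j)) > 0"
        using ab' by (intro prod_pos) (auto simp: \<beta>_def)
      ultimately show ?thesis by blast
    qed
    show "(\<exists>j. embed_coef j (b j) \<gamma> < embed_coef j (a j) \<gamma>) \<or> (\<forall>j. embed_coef j (b j) \<gamma> = 0)"
      if i: "unit_index i \<le> \<gamma>" "unit_index i \<noteq> \<gamma>" for i and \<gamma> :: "'p \<times> 'd \<Rightarrow> nat"
    \<comment> \<open>An index spread over several blocks has coefficient 0 in every factor; one
      supported in a single block is an index of that factor, where the strict bound is
      available.\<close>
    proof (cases "\<exists>j. \<gamma> \<in> range (embed_index j)")
      case True
      then obtain j \<alpha> where \<gamma>: "\<gamma> = embed_index j \<alpha>" by blast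
      obtain j' i' where i': "i = (j', i')" by (cases i)
      have "1 \<le> \<gamma> i" using le_funD[OF i(1), of i] by (simp add: unit_index_def)
      \<comment> \<open>Outside block \<open>j\<close> the index \<gamma> is 0, whereas at
        \<open>i\<close> it is at least 1.\<close>
      then have j': "j' = j" by (simp add: \<gamma> i' embed_index_def split: if_splits)
      have u: "unit_index i = embed_index j (unit_index i')"
        by (auto simp: i' j' unit_index_def embed_index_def fun_eq_iff)
      have "unit_index i' \<le> \<alpha>"
        using i(1) unfolding u \<gamma> by (auto simp: le_fun_def embed_index_def dest: spec[of _ j])
      moreover have "unit_index i' \<noteq> \<alpha>" using i(2) unfolding u \<gamma> by auto
      ultimately have "b j \<alpha> < a j \<alpha>" using ab' by blast
      then show ?thesis by (auto simp: \<gamma> intro!: exI[of _ j])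
    qed (auto simp: embed_coef_def)
  qed (use as D0 in \<open>auto simp: domain_Cn_def tensor_product_def\<close>)
qed

end
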